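(* There is an action of $\mathbb{A}^*=\mathbb{A}_{q^{-1}}$ on $V_*$ in which its generators $T_i^*,d_-^*,e_i^*,d_+^*$ act by $$T_i^*=T_i^{-1},\qquad d_-^*=d_-,\qquad e_i^*=e_i,\qquad (d_+^*F)[X]=\gamma\,F[X+(q-1)y_{k+1}]\quad(F\in V_k),$$ where $\gamma$ is the operator which sends $y_i$ to $y_{i+1}$ for $i=1,\dots,k$ and $y_{k+1}$ to $ty_1$. Furthermore, the following additional relations hold (on $V_k$ for every $k$ for which they make sense): $$z_{i+1}d_+=d_+z_i,\qquad y_{i+1}d_+^*=d_+^*y_i,\qquad z_1d_+=-y_1d_+^*\,t\,q^{k+1},\qquad d_+^*d_+^m(1)=d_+^{m+1}(1)$$ for any $m\ge0$, where $1\in V_0$.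
   Context: Plethysm. $\mathrm{Sym}[X]$ is the ring of symmetric functions over $\mathbb{Q}(q,t)$ in $X=x_1+x_2+\cdots$. For an expression $A$, $p_n[A]$ is obtained by replacing every variable and parameter (including $q,t,x_i,y_i$) by its $n$-th power (with $p_n[-A]=-p_n[A]$), and $F[A]$ is the image of $F\in\mathrm{Sym}[X]$ under $p_n\mapsto p_n[A]$ (coefficients fixed). $\mathrm{Exp}[A]=\sum_{n\ge0}h_n[A]$. Operators. $V_k=\mathrm{Sym}[X]\otimes\mathbb{Q}[y_1,\dots,y_k]$, $V_*=\bigoplus_{k\ge0}V_k$; plethystic substitutions act on the $\mathrm{Sym}[X]$ factor only; $e_k$ is the projection onto $V_k$; $y_i$ also denotes multiplication by $y_i$. For $1\le i\le k-1$, $T_i:V_k\to V_k$ is $T_iP=\frac{(q-1)y_iP+(y_{i+1}-qy_i)s_iP}{y_{i+1}-y_i}$, where $s_i$ exchanges $y_i$ and $y_{i+1}$. Define $d_+:V_k\to V_{k+1}$ and $d_-:V_k\to V_{k-1}$ ($k\ge1$) by $$d_+F=T_1\cdots T_k\big(F[X+(q-1)y_{k+1}]\big),\qquad d_-F=-F[X-(q-1)y_k]\,\mathrm{Exp}[-y_k^{-1}X]\big|_{y_k^{-1}},$$ where $|_{y_k^{-1}}$ is the coefficient of $y_k^{-1}$. The algebra $\mathbb{A}_q$ (over $\mathbb{Q}(q,t)$) is the path algebra of the quiver with vertex set $\mathbb{Z}_{\ge0}$, arrows $d_+$ from $i$ to $i+1$, arrows $d_-$ from $i+1$ to $i$, and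 loops $T_1,\dots,T_{k-1}$ at vertex $k$ (products are read as compositions of operators, right to left; $e_k$ is the idempotent at vertex $k$), modulo the relations, for paths beginning at vertex $k$, whenever all terms make sense: $$(T_i-1)(T_i+q)=0,\quad T_iT_{i+1}T_i=T_{i+1}T_iT_{i+1},\quad T_iT_j=T_jT_i\ (|i-j|>1),$$ $$T_id_-=d_-T_i,\quad d_+T_i=T_{i+1}d_+,\quad T_1d_+^2=d_+^2,\quad d_-^2T_{k-1}=d_-^2,$$ $$d_-(d_+d_--d_-d_+)T_{k-1}=q(d_+d_--d_-d_+)d_-\ (k\ge2),\qquad T_1(d_+d_--d_-d_+)d_+=q\,d_+(d_+d_--d_-d_+).$$ $\mathbb{A}^*=\mathbb{A}_{q^{-1}}$ is the same algebra with $q$ replaced by $q^{-1}$ in the relations and with generators denoted $d_\pm^*,T_i^*,e_i^*$. The elements $z_1,\dots,z_k\in e_k^*\mathbb{A}^*e_k^*$ are defined by $$z_k=\frac1{q^{-1}-1}(T_{k-1}^* )^{-1}\cdots(T_1^* )^{-1}(d_+^*d_-^*-d_-^*d_+^* ),\qquad z_i=q\,T_i^*z_{i+1}T_i^*\quad(1\le i<k),$$ and in the additional relations $z_i$ denotes the operator on $V_k$ by which this element acts. *)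

theory Defs
  imports
    "HOL-Library.Poly_Mapping"
    "HOL-Computational_Algebra.Polynomial"
    "HOL-Computational_Algebra.Fraction_Field"
begin

abbreviation "lookup \<equiv> Poly_Mapping.lookup"
abbreviation "keys \<equiv> Poly_Mapping.keys"

section \<open>The coefficient field of rational functions in \<open>q\<close> and \<open>t\<close>\<close>

text \<open>The inner polynomial variable is \<open>q\<close>, the outer one is \<open>t\<close>.\<close>

text \<open>Otherwise the lifting package would unfold \<open>K\<close> in the lifted definitions below.\<close>

lifting_forget fract.lifting
lifting_forget poly.lifting

type_synonym K = "rat poly poly fract"

definition qv :: K where "qv = Fract [:[:0, 1:]:] 1"
definition tv :: K where "tv = Fract [:0, 1:] 1"


section \<open>Symmetric functions\<close>

text \<open>
  A monomial in the infinitely many variables \<open>x\<^sub>0, x\<^sub>1, \<dots>\<close> is its exponent vector.  A symmetric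
  function is a formal power series (a coefficient function on monomials) of bounded degree that
  is invariant under all permutations of the variables.
\<close>

type_synonym xmon = "nat \<Rightarrow>\<^sub>0 nat"

definition xdeg :: "xmon \<Rightarrow> nat" where
  "xdeg m = (\<Sum>i\<in>keys m. lookup m i)"

definition xpairs :: "xmon \<Rightarrow> (xmon \<times> xmon) set" where
  "xpairs m = {(a, b). a + b = m}"

definition xconv :: "(xmon \<Rightarrow> 'a::comm_ring_1) \<Rightarrow> (xmon \<Rightarrow> 'a) \<Rightarrow> xmon \<Rightarrow> 'a" where
  "xconv f g m = (\<Sum>(a, b)\<in>xpairs m. f a * g b)"

definition bounded_degree :: "(xmon \<Rightarrow> 'a::zero) \<Rightarrow> bool" where
  "bounded_degree f \<longleftrightarrow> (\<exists>d. \<forall>m. f m \<noteq> 0 \<longrightarrow> xdeg m \<le> d)"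

definition symmetric_series :: "(xmon \<Rightarrow> 'a) \<Rightarrow> bool" where
  "symmetric_series f \<longleftrightarrow> (\<forall>\<pi>. bij \<pi> \<longrightarrow> (\<forall>m. f (Poly_Mapping.map_key \<pi> m) = f m))"

lemma xdeg_superset: "finite S \<Longrightarrow> keys m \<subseteq> S \<Longrightarrow> xdeg m = (\<Sum>i\<in>S. lookup m i)"
  unfolding xdeg_def by (rule sum.mono_neutral_left) (auto simp: in_keys_iff)

lemma xdeg_add: "xdeg (a + b) = xdeg a + xdeg b"
proof -
  let ?S = "keys a \<union> keys b"
  have "keys (a + b) \<subseteq> ?S" by (rule keys_add)
  then have "xdeg (a + b) = (\<Sum>i\<in>?S. lookup (a + b) i)" by (intro xdeg_superset) auto
  also have "\<dots> = (\<Sum>i\<in>?S. lookup a i) + (\<Sum>i\<in>?S. lookup b i)"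
    by (simp add: lookup_add sum.distrib)
  also have "\<dots> = xdeg a + xdeg b"
    by (subst (1 2) xdeg_superset[of ?S]) auto
  finally show ?thesis .
qed

lemma lookup_map_key_bij: "bij \<pi> \<Longrightarrow> lookup (Poly_Mapping.map_key \<pi> m) i = lookup m (\<pi> i)"
  by (simp add: map_key.rep_eq bij_is_inj)

lemma xdeg_map_key:
  assumes "bij \<pi>"
  shows "xdeg (Poly_Mapping.map_key \<pi> m) = xdeg m"
proof -
  have "keys (Poly_Mapping.map_key \<pi> m) = \<pi> -` keys m"
    using assms by (auto simp: in_keys_iff lookup_map_key_bij)
  moreover have "bij_betw \<pi> (\<pi> -` keys m) (keys m)"
    using assms by (metis bij_betw_subset bij_is_surj image_vimage_eq inf_top_right subset_UNIV)
  ultimately show ?thesis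
    unfolding xdeg_def using assms
    by (auto simp: lookup_map_key_bij intro: sum.reindex_bij_betw)
qed

lemma map_key_inv:
  assumes "bij \<pi>"
  shows "Poly_Mapping.map_key \<pi> (Poly_Mapping.map_key (inv \<pi>) m) = m"
    "Poly_Mapping.map_key (inv \<pi>) (Poly_Mapping.map_key \<pi> m) = m"
  using assms
  by (auto intro!: poly_mapping_eqI simp: lookup_map_key_bij bij_imp_bij_inv
      bij_is_inj bij_is_surj surj_f_inv_f)

lemma finite_xpairs: "finite (xpairs m)"
proof -
  let ?B = "{a :: xmon. \<forall>i. lookup a i \<le> lookup m i}"
  let ?N = "{..xdeg m}"
  have le: "lookup m i \<le> xdeg m" for i
    by (cases "i \<in> keys m") (auto simp: xdeg_def in_keys_iff intro: member_le_sum)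
  have "finite {f. \<forall>i. (i \<in> keys m \<longrightarrow> f i \<in> ?N) \<and> (i \<notin> keys m \<longrightarrow> f i = 0)}"
    by (rule finite_set_of_finite_funs) auto
  moreover have "lookup ` ?B \<subseteq> {f. \<forall>i. (i \<in> keys m \<longrightarrow> f i \<in> ?N) \<and> (i \<notin> keys m \<longrightarrow> f i = 0)}"
    using le by (auto simp: in_keys_iff intro: order_trans) (metis le_zero_eq)
  ultimately have "finite (lookup ` ?B)" by (rule rev_finite_subset)
  then have "finite ?B" by (rule finite_imageD) (auto intro: inj_onI poly_mapping_eqI)
  moreover have "xpairs m \<subseteq> ?B \<times> ?B" by (auto simp: xpairs_def lookup_add)
  ultimately show ?thesis by (meson finite_SigmaI finite_subset)
qed

lemma xconv_comm: "xconv f g = xconv g f"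
proof
  fix m
  have "xconv f g m = (\<Sum>p\<in>xpairs m. f (fst p) * g (snd p))"
    by (simp add: xconv_def case_prod_beta)
  also have "\<dots> = (\<Sum>p\<in>xpairs m. f (snd p) * g (fst p))"
    by (rule sum.reindex_bij_witness[where i = prod.swap and j = prod.swap])
       (auto simp: xpairs_def add.commute)
  also have "\<dots> = xconv g f m" by (simp add: xconv_def case_prod_beta mult.commute)
  finally show "xconv f g m = xconv g f m" .
qed

lemma xconv_assoc: "xconv (xconv f g) h = xconv f (xconv g h)"
proof
  fix m
  have "xconv (xconv f g) h m
      = (\<Sum>p\<in>xpairs m. \<Sum>r\<in>xpairs (fst p). f (fst r) * g (snd r) * h (snd p))"
    by (simp add: xconv_def case_prod_beta sum_distrib_right)
  also have "\<dots> = (\<Sum>(p, r)\<in>Sigma (xpairs m) (\<lambda>p. xpairs (fst p)).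
      f (fst r) * g (snd r) * h (snd p))"
    by (rule sum.Sigma) (auto simp: finite_xpairs)
  also have "\<dots> = (\<Sum>(p, r)\<in>Sigma (xpairs m) (\<lambda>p. xpairs (snd p)).
      f (fst p) * (g (fst r) * h (snd r)))"
    by (rule sum.reindex_bij_witness
        [where i = "\<lambda>(p, r). ((fst p + fst r, snd r), (fst p, fst r))"
          and j = "\<lambda>(p, r). ((fst r, snd r + snd p), (snd r, snd p))"])
       (auto simp: xpairs_def add.assoc mult.assoc)
  also have "\<dots> = (\<Sum>p\<in>xpairs m. \<Sum>r\<in>xpairs (snd p). f (fst p) * (g (fst r) * h (snd r)))"
    by (rule sum.Sigma[symmetric]) (auto simp: finite_xpairs)
  also have "\<dots> = xconv f (xconv g h) m"
    by (simp add: xconv_def case_prod_beta sum_distrib_left)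
  finally show "xconv (xconv f g) h m = xconv f (xconv g h) m" .
qed

lemma xconv_one: "xconv (\<lambda>m. if m = 0 then 1 else 0) f = f"
proof
  fix m
  have "xconv (\<lambda>m. if m = 0 then 1 else 0) f m
      = (\<Sum>p\<in>xpairs m. if p = (0, m) then f m else 0)"
    unfolding xconv_def case_prod_beta
    by (rule sum.cong) (auto simp: xpairs_def)
  also have "\<dots> = f m"
    using finite_xpairs[of m] by (subst sum.delta) (auto simp: xpairs_def)
  finally show "xconv (\<lambda>m. if m = 0 then 1 else 0) f m = f m" .
qed

lemma xconv_add: "xconv (\<lambda>m. f m + g m) h = (\<lambda>m. xconv f h m + xconv g h m)"
  by (rule ext) (simp add: xconv_def case_prod_beta distrib_right sum.distrib)

lemma bounded_degree_xconv:
  assumes "bounded_degree f" "bounded_degree g"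
  shows "bounded_degree (xconv f g)"
proof -
  obtain d e where d: "\<And>m. f m \<noteq> 0 \<Longrightarrow> xdeg m \<le> d" and e: "\<And>m. g m \<noteq> 0 \<Longrightarrow> xdeg m \<le> e"
    using assms by (auto simp: bounded_degree_def)
  have "xdeg m \<le> d + e" if nz: "xconv f g m \<noteq> 0" for m
  proof -
    obtain a b where "a + b = m" "f a * g b \<noteq> 0"
      using nz unfolding xconv_def xpairs_def by (auto elim!: sum.not_neutral_contains_not_neutral)
    then have "f a \<noteq> 0" "g b \<noteq> 0" by auto
    from add_mono[OF d[OF this(1)] e[OF this(2)]] show ?thesis
      by (simp add: xdeg_add flip: \<open>a + b = m\<close>)
  qed
  then show ?thesis by (auto simp: bounded_degree_def)
qed

lemma symmetric_series_xconv:
  assumes "symmetric_series f" "symmetric_series g"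
  shows "symmetric_series (xconv f g)"
  unfolding symmetric_series_def
proof (intro allI impI)
  fix \<pi> :: "nat \<Rightarrow> nat" and m
  assume \<pi>: "bij \<pi>"
  let ?k = "Poly_Mapping.map_key \<pi> :: xmon \<Rightarrow> xmon"
  let ?l = "Poly_Mapping.map_key (inv \<pi>) :: xmon \<Rightarrow> xmon"
  have "xconv f g (?k m) = (\<Sum>p\<in>xpairs m. f (?k (fst p)) * g (?k (snd p)))"
    unfolding xconv_def case_prod_beta
    by (rule sum.reindex_bij_witness[where i = "\<lambda>p. (?k (fst p), ?k (snd p))"
          and j = "\<lambda>p. (?l (fst p), ?l (snd p))"])
       (use \<pi> in \<open>auto simp: xpairs_def map_key_inv bij_is_inj bij_imp_bij_inv
          simp flip: map_key_plus\<close>)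
  also have "\<dots> = xconv f g m"
    using assms \<pi> unfolding xconv_def case_prod_beta symmetric_series_def by simp
  finally show "xconv f g (?k m) = xconv f g m" .
qed

lemma map_key_eq_0_iff:
  "bij (\<pi> :: nat \<Rightarrow> nat) \<Longrightarrow> Poly_Mapping.map_key \<pi> (m :: xmon) = 0 \<longleftrightarrow> m = 0"
  using map_key_inv(2)[of \<pi> m] by (auto simp: bij_is_inj bij_imp_bij_inv)

typedef sym = "{f :: xmon \<Rightarrow> K. bounded_degree f \<and> symmetric_series f}"
  morphisms sym_coeff Abs_sym
  by (rule exI[of _ "\<lambda>_. 0"]) (auto simp: bounded_degree_def symmetric_series_def)

setup_lifting type_definition_sym

lemma bounded_degree_binop:
  assumes "bounded_degree f" "bounded_degree g" "\<And>m. h m \<noteq> 0 \<Longrightarrow> f m \<noteq> 0 \<or> g m \<noteq> 0"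
  shows "bounded_degree h"
proof -
  obtain d e where "\<And>m. f m \<noteq> 0 \<Longrightarrow> xdeg m \<le> d" "\<And>m. g m \<noteq> 0 \<Longrightarrow> xdeg m \<le> e"
    using assms(1,2) by (auto simp: bounded_degree_def)
  then have "\<forall>m. h m \<noteq> 0 \<longrightarrow> xdeg m \<le> max d e"
    using assms(3) by (meson le_max_iff_disj)
  then show ?thesis unfolding bounded_degree_def by blast
qed

lift_definition sym_const :: "K \<Rightarrow> sym" is "\<lambda>c m. if m = 0 then c else 0"
proof
  fix c :: K
  show "bounded_degree (\<lambda>m. if m = 0 then c else 0)"
    unfolding bounded_degree_def by (rule exI[of _ 0]) (simp add: xdeg_def)
  show "symmetric_series (\<lambda>m. if m = 0 then c else 0)"
    unfolding symmetric_series_def by (simp add: map_key_eq_0_iff)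
qed

instantiation sym :: comm_ring_1
begin

lift_definition zero_sym :: sym is "\<lambda>_. 0"
  by (auto simp: bounded_degree_def symmetric_series_def)

lift_definition one_sym :: sym is "\<lambda>m. if m = 0 then 1 else 0"
  using sym_coeff[of "sym_const 1"] by (simp add: sym_const.rep_eq)

lift_definition plus_sym :: "sym \<Rightarrow> sym \<Rightarrow> sym" is "\<lambda>f g m. f m + g m"
proof
  fix f g :: "xmon \<Rightarrow> K"
  assume fg: "bounded_degree f \<and> symmetric_series f" "bounded_degree g \<and> symmetric_series g"
  show "bounded_degree (\<lambda>m. f m + g m)"
    by (rule bounded_degree_binop[of f g]) (use fg in auto)
  show "symmetric_series (\<lambda>m. f m + g m)"
    using fg by (simp add: symmetric_series_def)
qed

lift_definition minus_sym :: "sym \<Rightarrow> sym \<Rightarrow> sym" is "\<lambda>f g m. f m - g m"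
proof
  fix f g :: "xmon \<Rightarrow> K"
  assume fg: "bounded_degree f \<and> symmetric_series f" "bounded_degree g \<and> symmetric_series g"
  show "bounded_degree (\<lambda>m. f m - g m)"
    by (rule bounded_degree_binop[of f g]) (use fg in auto)
  show "symmetric_series (\<lambda>m. f m - g m)"
    using fg by (simp add: symmetric_series_def)
qed

lift_definition uminus_sym :: "sym \<Rightarrow> sym" is "\<lambda>f m. - f m"
  by (auto simp: symmetric_series_def bounded_degree_def)

lift_definition times_sym :: "sym \<Rightarrow> sym \<Rightarrow> sym" is xconv
  by (auto simp: bounded_degree_xconv symmetric_series_xconv)

instance
proof
  fix a b c :: sym
  show "a * b * c = a * (b * c)" by transfer (rule xconv_assoc)
  show "a * b = b * a" by transfer (rule xconv_comm)
  show "1 * a = a" by transfer (rule xconv_one)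
  show "(a + b) * c = a * c + b * c" by transfer (rule xconv_add)
  show "(0::sym) \<noteq> 1" by transfer (auto simp: fun_eq_iff)
qed (transfer; simp add: fun_eq_iff algebra_simps)+

end

lift_definition psym :: "nat \<Rightarrow> sym" is "\<lambda>n m. if \<exists>i. m = Poly_Mapping.single i n then 1 else 0"
proof
  fix n :: nat
  let ?f = "\<lambda>m. if \<exists>i. m = Poly_Mapping.single i n then 1 else 0 :: K"
  show "bounded_degree ?f"
    unfolding bounded_degree_def
    by (rule exI[of _ n]) (auto simp: xdeg_def)
  show "symmetric_series ?f"
    unfolding symmetric_series_def
  proof (intro allI impI)
    fix \<pi> :: "nat \<Rightarrow> nat" and m :: xmon
    assume \<pi>: "bij \<pi>"
    have *: "\<exists>j. Poly_Mapping.map_key \<rho> (Poly_Mapping.single i n) = Poly_Mapping.single j n"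
      if "bij \<rho>" for \<rho> :: "nat \<Rightarrow> nat" and i
    proof -
      have "i = \<rho> (inv \<rho> i)" using that by (simp add: bij_is_surj surj_f_inv_f)
      then show ?thesis using that by (metis bij_is_inj map_key_single)
    qed
    have "(\<exists>i. Poly_Mapping.map_key \<pi> m = Poly_Mapping.single i n) \<longleftrightarrow>
        (\<exists>i. m = Poly_Mapping.single i n)"
      using *[OF \<pi>] *[OF bij_imp_bij_inv[OF \<pi>]] map_key_inv[OF \<pi>] by metis
    then show "?f (Poly_Mapping.map_key \<pi> m) = ?f m" by simp
  qed
qed

lift_definition hsym :: "nat \<Rightarrow> sym" is "\<lambda>n m. if xdeg m = n then 1 else 0"
  by (auto simp: bounded_degree_def symmetric_series_def xdeg_map_key)


section \<open>The spaces \<open>V\<^sub>k\<close>\<close>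

text \<open>
  Everything is embedded in the ring of Laurent polynomials in \<open>y\<^sub>0, y\<^sub>1, \<dots>\<close> over symmetric
  functions; \<open>V k\<close> is the subring of polynomials in \<open>y\<^sub>1, \<dots>, y\<^sub>k\<close>.
\<close>

type_synonym ymon = "nat \<Rightarrow>\<^sub>0 int"
type_synonym yring = "ymon \<Rightarrow>\<^sub>0 sym"

definition V :: "nat \<Rightarrow> yring set" where
  "V k = {F. \<forall>m\<in>keys F. \<forall>i. 0 \<le> lookup m i \<and> (lookup m i \<noteq> 0 \<longrightarrow> 1 \<le> i \<and> i \<le> k)}"

definition sconst :: "sym \<Rightarrow> yring" where "sconst s = Poly_Mapping.single 0 s"
definition kconst :: "K \<Rightarrow> yring" where "kconst c = sconst (sym_const c)"

definition yv :: "nat \<Rightarrow> yring" where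
  "yv i = Poly_Mapping.single (Poly_Mapping.single i 1) 1"
definition yinv :: "nat \<Rightarrow> yring" where
  "yinv i = Poly_Mapping.single (Poly_Mapping.single i (-1)) 1"

text \<open>Coefficient of \<open>y\<^sub>k\<^sup>j\<close>, as an expression in the other variables.\<close>

definition ycoeff :: "nat \<Rightarrow> int \<Rightarrow> yring \<Rightarrow> yring" where
  "ycoeff k j F = (\<Sum>m\<in>{m\<in>keys F. lookup m k = j}.
     Poly_Mapping.single (Poly_Mapping.update k 0 m) (lookup F m))"

text \<open>
  The algebra homomorphism over symmetric functions with \<open>y\<^sub>i \<mapsto> \<sigma> i\<close>; only meaningful for
  polynomials, since \<^const>\<open>nat\<close> truncates negative exponents.
\<close>

definition ysubst :: "(nat \<Rightarrow> yring) \<Rightarrow> yring \<Rightarrow> yring" where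
  "ysubst \<sigma> F = (\<Sum>m\<in>keys F. sconst (lookup F m) * (\<Prod>i\<in>keys m. \<sigma> i ^ nat (lookup m i)))"


section \<open>Plethysm\<close>

datatype expr = PX | Pq | Pt | Py nat | Pyinv nat | POne
  | PAdd expr expr | PNeg expr | PMul expr expr

instantiation expr :: "{one, plus, minus, uminus, times}"
begin
definition "1 = POne"
definition "A + B = PAdd A B"
definition "- A = PNeg A"
definition "A - B = PAdd A (PNeg B)" for A B :: expr
definition "A * B = PMul A B"
instance ..
end

text \<open>\<open>power_subst n A\<close> is \<open>p\<^sub>n[A]\<close>, so that \<open>X = x\<^sub>0 + x\<^sub>1 + \<dots>\<close> becomes \<^term>\<open>psym n\<close>.\<close>

primrec power_subst :: "nat \<Rightarrow> expr \<Rightarrow> yring" where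
  "power_subst n PX = sconst (psym n)"
| "power_subst n Pq = kconst (qv ^ n)"
| "power_subst n Pt = kconst (tv ^ n)"
| "power_subst n (Py i) = yv i ^ n"
| "power_subst n (Pyinv i) = yinv i ^ n"
| "power_subst n POne = 1"
| "power_subst n (PAdd A B) = power_subst n A + power_subst n B"
| "power_subst n (PNeg A) = - power_subst n A"
| "power_subst n (PMul A B) = power_subst n A * power_subst n B"

definition is_plethysm :: "expr \<Rightarrow> (sym \<Rightarrow> yring) \<Rightarrow> bool" where
  "is_plethysm A \<phi> \<longleftrightarrow>
     (\<forall>f g. \<phi> (f + g) = \<phi> f + \<phi> g) \<and>
     (\<forall>f g. \<phi> (f * g) = \<phi> f * \<phi> g) \<and>
     (\<forall>c. \<phi> (sym_const c) = kconst c) \<and>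
     (\<forall>n\<ge>1. \<phi> (psym n) = power_subst n A)"

text \<open>
  Existence and uniqueness of the homomorphism in the next definition are the fact that the power
  sums freely generate the algebra of symmetric functions in characteristic 0.
\<close>

definition pleth :: "expr \<Rightarrow> sym \<Rightarrow> yring" where
  "pleth A = (THE \<phi>. is_plethysm A \<phi>)"

definition vpleth :: "expr \<Rightarrow> yring \<Rightarrow> yring" where
  "vpleth A F = (\<Sum>m\<in>keys F. pleth A (lookup F m) * Poly_Mapping.single m 1)"


section \<open>The operators\<close>

definition s_op :: "nat \<Rightarrow> yring \<Rightarrow> yring" where
  "s_op i = ysubst (\<lambda>j. yv (if j = i then i + 1 else if j = i + 1 then i else j))"

definition T_op :: "nat \<Rightarrow> yring \<Rightarrow> yring" where
  "T_op i P = (THE G. (yv (i + 1) - yv i) * G =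
     kconst (qv - 1) * yv i * P + (yv (i + 1) - kconst qv * yv i) * s_op i P)"

definition T_inv_op :: "nat \<Rightarrow> nat \<Rightarrow> yring \<Rightarrow> yring" where
  "T_inv_op k i = inv_into (V k) (T_op i)"

text \<open>The index \<open>k\<close> of the following operators is that of the space \<open>V k\<close> on which they act.\<close>

definition dplus :: "nat \<Rightarrow> yring \<Rightarrow> yring" where
  "dplus k F = foldr T_op [1..<k + 1] (vpleth (PX + (Pq - 1) * Py (k + 1)) F)"

text \<open>
  The product with \<open>Exp[- y\<^sub>k\<^sup>-\<^sup>1 X] = (\<Sum>n. h\<^sub>n[- y\<^sub>k\<^sup>-\<^sup>1 X])\<close> is formal; only finitely many terms
  contribute to a given coefficient.
\<close>

definition dminus :: "nat \<Rightarrow> yring \<Rightarrow> yring" where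
  "dminus k F = - (\<Sum>n. ycoeff k (-1)
     (vpleth (PX - (Pq - 1) * Py k) F * pleth (- (Pyinv k * PX)) (hsym n)))"

definition gamma_op :: "nat \<Rightarrow> yring \<Rightarrow> yring" where
  "gamma_op k = ysubst (\<lambda>i. if i = k + 1 then kconst tv * yv 1 else yv (i + 1))"

definition dplus_star :: "nat \<Rightarrow> yring \<Rightarrow> yring" where
  "dplus_star k F = gamma_op k (vpleth (PX + (Pq - 1) * Py (k + 1)) F)"

primrec dplus_pow :: "nat \<Rightarrow> yring" where
  "dplus_pow 0 = 1"
| "dplus_pow (Suc m) = dplus m (dplus_pow m)"


section \<open>The path algebra\<close>

text \<open>
  \<open>Dp k : k \<rightarrow> k + 1\<close>, \<open>Dm k : k + 1 \<rightarrow> k\<close>, and \<open>Tl k i\<close> is the loop \<open>T\<^sub>i\<close> at \<open>k\<close>, which is present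
  for \<open>1 \<le> i < k\<close>.  A path is given by its starting vertex and its arrows in the order in which
  they are written in a product: the head of the list is applied last.
\<close>

datatype arrow = Dp nat | Dm nat | Tl nat nat

fun src :: "arrow \<Rightarrow> nat" where
  "src (Dp k) = k" | "src (Dm k) = k + 1" | "src (Tl k i) = k"

fun tgt :: "arrow \<Rightarrow> nat" where
  "tgt (Dp k) = k + 1" | "tgt (Dm k) = k" | "tgt (Tl k i) = k"

fun valid_arrow :: "arrow \<Rightarrow> bool" where
  "valid_arrow (Tl k i) \<longleftrightarrow> 1 \<le> i \<and> i < k"
| "valid_arrow _ \<longleftrightarrow> True"

fun path_end :: "nat \<Rightarrow> arrow list \<Rightarrow> nat" where
  "path_end k [] = k"
| "path_end k (a # as) = tgt a"

fun is_path :: "nat \<Rightarrow> arrow list \<Rightarrow> bool" where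
  "is_path k [] \<longleftrightarrow> True"
| "is_path k (a # as) \<longleftrightarrow> valid_arrow a \<and> is_path k as \<and> src a = path_end k as"

typedef path = "{(k, as). is_path k as}"
  by (rule exI[of _ "(0, [])"]) auto

setup_lifting type_definition_path

lift_definition psrc :: "path \<Rightarrow> nat" is fst .
lift_definition ptgt :: "path \<Rightarrow> nat" is "\<lambda>(k, as). path_end k as" .
lift_definition parrows :: "path \<Rightarrow> arrow list" is snd .

lemma path_end_append: "path_end k (as @ bs) = path_end (path_end k bs) as"
  by (cases as) auto

lemma is_path_append: "is_path k (as @ bs) \<longleftrightarrow> is_path (path_end k bs) as \<and> is_path k bs"
  by (induction as) (auto simp: path_end_append)

text \<open>Composition, with \<open>p\<close> after \<open>r\<close>; if they are not composable, the result is junk.\<close>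

lift_definition pcomp :: "path \<Rightarrow> path \<Rightarrow> path" is
  "\<lambda>(k, as) (l, bs). if k = path_end l bs then (l, as @ bs) else (l, bs)"
  by (auto simp: is_path_append split: prod.splits if_splits)

lemma psrc_pcomp [simp]: "psrc p = ptgt r \<Longrightarrow> psrc (pcomp p r) = psrc r"
  by transfer (auto split: prod.splits)

lemma ptgt_pcomp [simp]: "psrc p = ptgt r \<Longrightarrow> ptgt (pcomp p r) = ptgt p"
  by transfer (auto simp: path_end_append)

lemma pcomp_assoc:
  "psrc p = ptgt r \<Longrightarrow> psrc r = ptgt s \<Longrightarrow> pcomp (pcomp p r) s = pcomp p (pcomp r s)"
  by transfer (auto simp: path_end_append)

type_synonym palg = "path \<Rightarrow>\<^sub>0 K"

definition pbasis_mult :: "path \<Rightarrow> path \<Rightarrow> K \<Rightarrow> palg" where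
  "pbasis_mult p r c = (if psrc p = ptgt r then Poly_Mapping.single (pcomp p r) c else 0)"

definition pmult :: "palg \<Rightarrow> palg \<Rightarrow> palg" (infixl \<open>\<odot>\<close> 70) where
  "f \<odot> g = (\<Sum>p\<in>keys f. \<Sum>r\<in>keys g. pbasis_mult p r (lookup f p * lookup g r))"

definition pscale :: "K \<Rightarrow> palg \<Rightarrow> palg" where
  "pscale c = Poly_Mapping.map ((*) c)"

lemma lookup_pscale [simp]: "lookup (pscale c f) p = c * lookup f p"
  by (simp add: pscale_def map.rep_eq when_def)

lemma pbasis_mult_0 [simp]: "pbasis_mult p r 0 = 0"
  by (simp add: pbasis_mult_def)

lemma pbasis_mult_add: "pbasis_mult p r (c + d) = pbasis_mult p r c + pbasis_mult p r d"
  by (simp add: pbasis_mult_def single_add)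

lemma pmult_superset:
  assumes "finite S" "keys f \<subseteq> S" "finite R" "keys g \<subseteq> R"
  shows "f \<odot> g = (\<Sum>p\<in>S. \<Sum>r\<in>R. pbasis_mult p r (lookup f p * lookup g r))"
proof -
  have "f \<odot> g = (\<Sum>p\<in>keys f. \<Sum>r\<in>R. pbasis_mult p r (lookup f p * lookup g r))"
    unfolding pmult_def using assms
    by (intro sum.cong refl sum.mono_neutral_left) (auto simp: in_keys_iff)
  also have "\<dots> = (\<Sum>p\<in>S. \<Sum>r\<in>R. pbasis_mult p r (lookup f p * lookup g r))"
    using assms by (intro sum.mono_neutral_left) (auto simp: in_keys_iff)
  finally show ?thesis .
qed

lemma pmult_add_left: "(f + f') \<odot> g = f \<odot> g + f' \<odot> g"
proof -
  let ?S = "keys f \<union> keys f'"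
  have "keys (f + f') \<subseteq> ?S" by (rule keys_add)
  then show ?thesis
    by (simp add: pmult_superset[of ?S _ "keys g"] lookup_add distrib_right pbasis_mult_add
        sum.distrib)
qed

lemma pmult_add_right: "f \<odot> (g + g') = f \<odot> g + f \<odot> g'"
proof -
  let ?S = "keys g \<union> keys g'"
  have "keys (g + g') \<subseteq> ?S" by (rule keys_add)
  then show ?thesis
    by (simp add: pmult_superset[of "keys f" _ ?S] lookup_add distrib_left pbasis_mult_add
        sum.distrib)
qed

lemma pmult_0_left [simp]: "0 \<odot> g = 0" and pmult_0_right [simp]: "f \<odot> 0 = 0"
  by (simp_all add: pmult_def)

lemma pmult_single:
  "Poly_Mapping.single p c \<odot> Poly_Mapping.single r d = pbasis_mult p r (c * d)"
  by (subst pmult_superset[of "{p}" _ "{r}"]) auto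

lemma palg_induct:
  assumes "P 0" "\<And>p c. P (Poly_Mapping.single p c)" "\<And>f g. P f \<Longrightarrow> P g \<Longrightarrow> P (f + g)"
  shows "P (f :: palg)"
proof -
  have f: "f = (\<Sum>p\<in>keys f. Poly_Mapping.single p (lookup f p))"
    by (rule poly_mapping_eqI)
       (auto simp: lookup_sum lookup_single when_def in_keys_iff)
  have "P (\<Sum>p\<in>S. Poly_Mapping.single p (lookup f p))" if "finite S" for S
    using that by (induction S) (auto intro: assms)
  then show ?thesis using f by (metis finite_keys)
qed

lemma pmult_assoc: "f \<odot> g \<odot> h = f \<odot> (g \<odot> h)"
proof (induction f rule: palg_induct)
  case (2 p c)
  show ?case
  proof (induction g rule: palg_induct)
    case (2 r d)
    show ?case
      by (induction h rule: palg_induct)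
         (auto simp: pmult_add_right pmult_single pbasis_mult_def pcomp_assoc mult.assoc)
  qed (auto simp: pmult_add_left pmult_add_right)
qed (auto simp: pmult_add_left)

lemma pscale_pmult_left: "pscale c f \<odot> g = pscale c (f \<odot> g)"
proof -
  have add: "pscale c (u + v) = pscale c u + pscale c v" for u v
    by (rule poly_mapping_eqI) (simp add: lookup_add distrib_left)
  have single: "pscale c (Poly_Mapping.single p d) = Poly_Mapping.single p (c * d)" for p d
    by (rule poly_mapping_eqI) (auto simp: lookup_single when_def)
  have zero: "pscale c 0 = 0" by (rule poly_mapping_eqI) simp
  show ?thesis
  proof (induction f rule: palg_induct)
    case (2 p d)
    show ?case
      by (induction g rule: palg_induct)
         (auto simp: pmult_add_right pmult_single pbasis_mult_def add single zero mult.assoc)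
  qed (auto simp: pmult_add_left add zero)
qed

definition ppath :: "nat \<Rightarrow> arrow list \<Rightarrow> palg" where
  "ppath k as = (if is_path k as then Poly_Mapping.single (Abs_path (k, as)) 1 else 0)"

abbreviation pE :: "nat \<Rightarrow> palg" where "pE k \<equiv> ppath k []"
abbreviation parr :: "arrow \<Rightarrow> palg" where "parr a \<equiv> ppath (src a) [a]"
abbreviation pT :: "nat \<Rightarrow> nat \<Rightarrow> palg" where "pT k i \<equiv> parr (Tl k i)"
abbreviation pDp :: "nat \<Rightarrow> palg" where "pDp k \<equiv> parr (Dp k)"
abbreviation pDm :: "nat \<Rightarrow> palg" where "pDm k \<equiv> parr (Dm k)"

text \<open>\<open>d\<^sub>+ d\<^sub>- - d\<^sub>- d\<^sub>+\<close> on paths beginning at \<open>k\<close>, for \<open>k \<ge> 1\<close>.\<close>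

abbreviation pC :: "nat \<Rightarrow> palg" where
  "pC k \<equiv> pDp (k - 1) \<odot> pDm (k - 1) - pDm k \<odot> pDp k"


section \<open>The algebra \<open>A\<^sub>r\<close> and its specialization \<open>A\<^sup>*\<close>\<close>

text \<open>
  In each relation \<open>k\<close> is the vertex at which the paths begin, and \<open>r\<close> is the parameter called \<open>q\<close>
  in \<open>A\<^sub>q\<close>; the side conditions say that all terms make sense.
\<close>

inductive Aq_rel :: "K \<Rightarrow> palg \<Rightarrow> palg \<Rightarrow> bool" for r :: K where
  quadratic: "1 \<le> i \<Longrightarrow> i < k \<Longrightarrow> Aq_rel r ((pT k i - pE k) \<odot> (pT k i + pscale r (pE k))) 0"
| braid: "1 \<le> i \<Longrightarrow> i + 1 < k \<Longrightarrow>
    Aq_rel r (pT k i \<odot> pT k (i + 1) \<odot> pT k i) (pT k (i + 1) \<odot> pT k i \<odot> pT k (i + 1))"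
| commute: "1 \<le> i \<Longrightarrow> i < k \<Longrightarrow> 1 \<le> j \<Longrightarrow> j < k \<Longrightarrow> i + 1 < j \<or> j + 1 < i \<Longrightarrow>
    Aq_rel r (pT k i \<odot> pT k j) (pT k j \<odot> pT k i)"
| T_dm: "1 \<le> i \<Longrightarrow> i < k - 1 \<Longrightarrow>
    Aq_rel r (pT (k - 1) i \<odot> pDm (k - 1)) (pDm (k - 1) \<odot> pT k i)"
| dp_T: "1 \<le> i \<Longrightarrow> i < k \<Longrightarrow> Aq_rel r (pDp k \<odot> pT k i) (pT (k + 1) (i + 1) \<odot> pDp k)"
| T_dp_dp: "Aq_rel r (pT (k + 2) 1 \<odot> pDp (k + 1) \<odot> pDp k) (pDp (k + 1) \<odot> pDp k)"
| dm_dm_T: "2 \<le> k \<Longrightarrow>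
    Aq_rel r (pDm (k - 2) \<odot> pDm (k - 1) \<odot> pT k (k - 1)) (pDm (k - 2) \<odot> pDm (k - 1))"
| dm_C_T: "2 \<le> k \<Longrightarrow>
    Aq_rel r (pDm (k - 1) \<odot> pC k \<odot> pT k (k - 1)) (pscale r (pC (k - 1) \<odot> pDm (k - 1)))"
| T_C_dp: "1 \<le> k \<Longrightarrow>
    Aq_rel r (pT (k + 1) 1 \<odot> pC (k + 1) \<odot> pDp k) (pscale r (pDp k \<odot> pC k))"

inductive_set Aq_ideal :: "K \<Rightarrow> palg set" for r :: K where
  rel: "Aq_rel r f g \<Longrightarrow> f - g \<in> Aq_ideal r"
| zero: "0 \<in> Aq_ideal r"
| add: "f \<in> Aq_ideal r \<Longrightarrow> g \<in> Aq_ideal r \<Longrightarrow> f + g \<in> Aq_ideal r"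
| scale: "f \<in> Aq_ideal r \<Longrightarrow> pscale c f \<in> Aq_ideal r"
| left: "f \<in> Aq_ideal r \<Longrightarrow> g \<odot> f \<in> Aq_ideal r"
| right: "f \<in> Aq_ideal r \<Longrightarrow> f \<odot> g \<in> Aq_ideal r"

definition Aq_cong :: "K \<Rightarrow> palg \<Rightarrow> palg \<Rightarrow> bool" where
  "Aq_cong r f g \<longleftrightarrow> f - g \<in> Aq_ideal r"

lemma pscale_minus_one: "pscale (-1) f = - f"
  by (rule poly_mapping_eqI) simp

lemma pscale_add: "pscale c (f + g) = pscale c f + pscale c g"
  by (rule poly_mapping_eqI) (simp add: lookup_add distrib_left)

lemma pscale_diff: "pscale c (f - g) = pscale c f - pscale c g"
  by (rule poly_mapping_eqI) (simp add: lookup_minus right_diff_distrib)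

lemma pmult_diff_left: "(f - f') \<odot> g = f \<odot> g - f' \<odot> g"
  by (metis add_diff_cancel_right' diff_add_cancel pmult_add_left)

lemma pmult_diff_right: "f \<odot> (g - g') = f \<odot> g - f \<odot> g'"
  by (metis add_diff_cancel_right' diff_add_cancel pmult_add_right)

lemma Aq_ideal_uminus: "f \<in> Aq_ideal r \<Longrightarrow> - f \<in> Aq_ideal r"
  using Aq_ideal.scale[of f r "-1"] by (simp add: pscale_minus_one)

lemma equivp_Aq_cong: "equivp (Aq_cong r)"
proof (rule equivpI)
  show "reflp (Aq_cong r)" by (auto intro: reflpI simp: Aq_cong_def Aq_ideal.zero)
  show "symp (Aq_cong r)"
    by (rule sympI) (metis Aq_cong_def Aq_ideal_uminus minus_diff_eq)
  show "transp (Aq_cong r)"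
  proof (rule transpI)
    fix f g h
    assume "Aq_cong r f g" "Aq_cong r g h"
    then have "(f - g) + (g - h) \<in> Aq_ideal r" by (simp only: Aq_cong_def Aq_ideal.add)
    then show "Aq_cong r f h" by (simp add: Aq_cong_def)
  qed
qed

lemma Aq_cong_add: "Aq_cong r f f' \<Longrightarrow> Aq_cong r g g' \<Longrightarrow> Aq_cong r (f + g) (f' + g')"
  unfolding Aq_cong_def by (simp only: add_diff_add Aq_ideal.add)

lemma Aq_cong_uminus: "Aq_cong r f f' \<Longrightarrow> Aq_cong r (- f) (- f')"
  unfolding Aq_cong_def by (metis Aq_ideal_uminus minus_diff_minus)

lemma Aq_cong_mult:
  assumes "Aq_cong r f f'" "Aq_cong r g g'"
  shows "Aq_cong r (f \<odot> g) (f' \<odot> g')"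
proof -
  have "f \<odot> g - f' \<odot> g' = (f - f') \<odot> g + f' \<odot> (g - g')"
    by (simp add: pmult_diff_left pmult_diff_right)
  then show ?thesis using assms unfolding Aq_cong_def
    by (simp add: Aq_ideal.add Aq_ideal.left Aq_ideal.right)
qed

quotient_type Astar = palg / "Aq_cong (inverse qv)"
  by (rule equivp_Aq_cong)

text \<open>The quiver has infinitely many vertices, so the algebra has no unit.\<close>

instantiation Astar :: ring
begin

lift_definition zero_Astar :: Astar is 0 .
lift_definition plus_Astar :: "Astar \<Rightarrow> Astar \<Rightarrow> Astar" is "(+)" by (rule Aq_cong_add)
lift_definition uminus_Astar :: "Astar \<Rightarrow> Astar" is uminus by (rule Aq_cong_uminus)
lift_definition minus_Astar :: "Astar \<Rightarrow> Astar \<Rightarrow> Astar" is "(-)"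
  by (metis Aq_cong_add Aq_cong_uminus add_uminus_conv_diff)
lift_definition times_Astar :: "Astar \<Rightarrow> Astar \<Rightarrow> Astar" is "(\<odot>)" by (rule Aq_cong_mult)

instance
proof
  fix a b c :: Astar
  note refl = equivp_reflp[OF equivp_Aq_cong]
  show "a + b + c = a + (b + c)" by transfer (simp add: add.assoc refl)
  show "a + b = b + a" by transfer (simp add: add.commute refl)
  show "0 + a = a" by transfer (simp add: refl)
  show "- a + a = 0" by transfer (simp add: refl)
  show "a - b = a + - b" by transfer (simp add: refl)
  show "a * b * c = a * (b * c)" by transfer (simp add: pmult_assoc refl)
  show "(a + b) * c = a * c + b * c" by transfer (simp add: pmult_add_left refl)
  show "a * (b + c) = a * b + a * c" by transfer (simp add: pmult_add_right refl)
qed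

end

lift_definition ascale :: "K \<Rightarrow> Astar \<Rightarrow> Astar" is pscale
  by (metis Aq_cong_def Aq_ideal.scale pscale_diff)

lift_definition aE :: "nat \<Rightarrow> Astar" is "\<lambda>k. pE k" .
lift_definition aT :: "nat \<Rightarrow> nat \<Rightarrow> Astar" is "\<lambda>k i. pT k i" .
lift_definition aDp :: "nat \<Rightarrow> Astar" is "\<lambda>k. pDp k" .
lift_definition aDm :: "nat \<Rightarrow> Astar" is "\<lambda>k. pDm k" .

text \<open>The inverse is taken in the unital algebra \<open>e\<^sub>k A\<^sup>* e\<^sub>k\<close>.\<close>

definition aT_inv :: "nat \<Rightarrow> nat \<Rightarrow> Astar" where
  "aT_inv k i = (THE u. aE k * u * aE k = u \<and> u * aT k i = aE k \<and> aT k i * u = aE k)"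

text \<open>\<open>z_elem k i\<close> is \<open>z\<^sub>i \<in> e\<^sub>k A\<^sup>* e\<^sub>k\<close>, for \<open>1 \<le> i \<le> k\<close>.\<close>

function z_elem :: "nat \<Rightarrow> nat \<Rightarrow> Astar" where
  "z_elem k i =
     (if i < k then ascale qv (aT k i * z_elem k (i + 1) * aT k i)
      else ascale (1 / (inverse qv - 1))
        (foldr (\<lambda>j a. aT_inv k j * a) (rev [1..<k])
          (aDp (k - 1) * aDm (k - 1) - aDm k * aDp k)))"
  by auto
termination by (relation "measure (\<lambda>(k, i). k - i)") auto

declare z_elem.simps [simp del]


section \<open>Actions on \<open>V\<^sub>* = (\<Oplus>k. V\<^sub>k)\<close>\<close>

definition Vstar :: "(nat \<Rightarrow>\<^sub>0 yring) set" where
  "Vstar = {F. \<forall>k. lookup F k \<in> V k}"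

definition vscale :: "K \<Rightarrow> (nat \<Rightarrow>\<^sub>0 yring) \<Rightarrow> (nat \<Rightarrow>\<^sub>0 yring)" where
  "vscale c = Poly_Mapping.map ((*) (kconst c))"

definition is_Astar_action :: "(Astar \<Rightarrow> (nat \<Rightarrow>\<^sub>0 yring) \<Rightarrow> (nat \<Rightarrow>\<^sub>0 yring)) \<Rightarrow> bool" where
  "is_Astar_action act \<longleftrightarrow>
     (\<forall>a. \<forall>F\<in>Vstar. act a F \<in> Vstar) \<and>
     (\<forall>a. \<forall>F\<in>Vstar. \<forall>G\<in>Vstar. act a (F + G) = act a F + act a G) \<and>
     (\<forall>a c. \<forall>F\<in>Vstar. act a (vscale c F) = vscale c (act a F)) \<and>
     (\<forall>a b. \<forall>F\<in>Vstar. act (a + b) F = act a F + act b F) \<and>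
     (\<forall>a c. \<forall>F\<in>Vstar. act (ascale c a) F = vscale c (act a F)) \<and>
     (\<forall>a b. \<forall>F\<in>Vstar. act (a * b) F = act a (act b F))"

definition z_op :: "(Astar \<Rightarrow> (nat \<Rightarrow>\<^sub>0 yring) \<Rightarrow> (nat \<Rightarrow>\<^sub>0 yring)) \<Rightarrow> nat \<Rightarrow> nat \<Rightarrow> yring \<Rightarrow> yring"
  where "z_op act k i F = lookup (act (z_elem k i) (Poly_Mapping.single k F)) k"

end

theory Submission
  imports Defs "HOL-Combinatorics.Permutations" "HOL-Computational_Algebra.Formal_Power_Series"
begin

text \<open>
  Since the power sums freely generate the symmetric functions, the plethystic substitutions
  \<open>F[X \<plusminus> (q - 1) y\<^sub>j]\<close> and the operator \<open>d\<^sub>+\<^sup>*\<close> are ring homomorphisms determined by the images of the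
  power sums and of the variables, and compositions of them can be compared on these generators.
  The operator \<open>d\<^sub>-\<close> is such a homomorphism followed by a linear functional, the extraction of the
  coefficient of \<open>1/y\<^sub>k\<close> after multiplication by \<open>Exp[-X/y\<^sub>k]\<close>.  Hence \<open>C = d\<^sub>+\<^sup>* d\<^sub>- - d\<^sub>- d\<^sub>+\<^sup>*\<close> maps
  \<open>F\<close> to \<open>q - 1\<close> times the coefficient of \<open>1/w\<close> in
  \<open>F(y\<^sub>2, \<dots>, y\<^sub>k, w)[X + (q - 1)(t y\<^sub>1 - w)] Exp[-X/w] t y\<^sub>1 / (w - t y\<^sub>1)\<close>.  The relations of the algebra
  become identities between such coefficients in one or two variables \<open>w, v\<close>.  With two variables the
  exponential factors interact by \<open>(v - w) / (v - q w)\<close>, and this denominator is cancelled because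
  \<open>T\<^sub>i F - F\<close> is divisible by \<open>y\<^sub>i\<^sub>+\<^sub>1 - q y\<^sub>i\<close>.

  For the additional relations, the formula for \<open>C\<close> gives \<open>C T\<^sub>k \<tau> = \<tau> C\<close> on \<open>V\<^sub>k\<close>, where \<open>\<tau>\<close> substitutes
  \<open>X + (q - 1) y\<^sub>k\<^sub>+\<^sub>1\<close> for \<open>X\<close>; with the braid relations this is \<open>z\<^sub>k\<^sub>+\<^sub>1 d\<^sub>+ = d\<^sub>+ z\<^sub>k\<close>, and the other \<open>z\<^sub>i\<close> follow by
  \<open>d\<^sub>+ T\<^sub>i = T\<^sub>i\<^sub>+\<^sub>1 d\<^sub>+\<close>.  In \<open>z\<^sub>1 d\<^sub>+\<close> all \<open>T\<^sub>i\<close> cancel and \<open>w\<close> drops out of \<open>C \<tau>\<close>.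
\<close>

text \<open>Fractions never appear as elements. Homomorphisms are multiplicative only on genuine
  polynomials, since \<open>nat\<close> truncates negative exponents. A pole such as 1 / (w - t y_1)
  or 1 / (v - q w) is therefore kept as a power series in the inverse of the variable to be
  extracted, and is compared or cancelled through identities between series. Identities with
  denominator y_{i+1} - y_i are multiplied out and cancelled afterwards by
  \<open>yv_diff_cancel\<close>. The extracted variable is bound and may be renamed; as V_k starts
  at y_1, the index 0 is free to play the part of w. The renaming is essential: d_+^* would send the
  bound y_k of d_- to t y_1 and so capture it. The factor (v - w) / (v - q w) arises because the
  substitution X - (q - 1) w of the outer operator also acts on the inner series Exp[-X/v]. The
  relations are first proved for T_i, where the formulas are explicit, and then read for the inverse
  of T_i, which exchanges q and its inverse.\<close>

abbreviation "single \<equiv> Poly_Mapping.single"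

text \<open>The single terms are taken from the support of f, so that a condition on the support,
  such as membership in \<open>PV I\<close>, reaches them.\<close>

lemma poly_mapping_induct [case_names zero single add]:
  fixes f :: "'a \<Rightarrow>\<^sub>0 'b::comm_monoid_add"
  assumes "P 0" "\<And>p c. p \<in> keys f \<Longrightarrow> P (single p c)"
    "\<And>f g. P f \<Longrightarrow> P g \<Longrightarrow> P (f + g)"
  shows "P f"
proof -
  have f: "f = (\<Sum>p\<in>keys f. single p (lookup f p))"
    by (rule poly_mapping_eqI) (auto simp: lookup_sum lookup_single when_def in_keys_iff)
  have "P (\<Sum>p\<in>S. single p (lookup f p))" if "finite S" "S \<subseteq> keys f" for S
    using that by (induction S) (auto intro: assms)
  then show ?thesis using f by (metis finite_keys order_refl)
qed

text \<open>Characteristic 0 enters twice: leading coefficients of products of power sums are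
  positive integers, hence invertible, and a series is recovered from its logarithmic derivative by
  dividing by n.\<close>

lemma of_nat_K_eq_0_iff [simp]: "(of_nat n :: K) = 0 \<longleftrightarrow> n = 0"
proof -
  have "(of_nat n :: K) = Fract (of_nat n) 1" by (simp add: Fract_of_nat_eq)
  then show ?thesis by (simp add: Zero_fract_def eq_fract)
qed

section \<open>Power sums generate the symmetric functions freely\<close>

lemma sym_const_0 [simp]: "sym_const 0 = 0" by transfer auto
lemma sym_const_1 [simp]: "sym_const 1 = 1" by transfer auto
lemma sym_const_add: "sym_const (a + b) = sym_const a + sym_const b" by transfer auto
lemma xconv_const: "xconv (\<lambda>m. if m = 0 then c else 0) f = (\<lambda>m. c * f m)"
proof
  fix m
  have "xconv (\<lambda>m. if m = 0 then c else 0) f m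
      = (\<Sum>p\<in>xpairs m. if p = (0, m) then c * f m else 0)"
    unfolding xconv_def case_prod_beta by (rule sum.cong) (auto simp: xpairs_def)
  also have "\<dots> = c * f m"
    using finite_xpairs[of m] by (subst sum.delta) (auto simp: xpairs_def)
  finally show "xconv (\<lambda>m. if m = 0 then c else 0) f m = c * f m" .
qed

lemma sym_coeff_const_mult: "sym_coeff (sym_const c * f) m = c * sym_coeff f m"
  by transfer (simp add: xconv_const)

lemma sym_const_mult: "sym_const (a * b) = sym_const a * sym_const b"
  by (rule sym_coeff_inject[THEN iffD1], rule ext)
     (simp add: sym_coeff_const_mult sym_const.rep_eq)

lemma sym_coeff_add: "sym_coeff (f + g) m = sym_coeff f m + sym_coeff g m"
  by transfer simp

lemma sym_coeff_diff: "sym_coeff (f - g) m = sym_coeff f m - sym_coeff g m"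
  by transfer simp

lemma sym_coeff_0: "sym_coeff 0 m = 0"
  by transfer simp

lemma sym_coeff_sum: "sym_coeff (sum f S) m = (\<Sum>x\<in>S. sym_coeff (f x) m)"
  by (induction S rule: infinite_finite_induct) (auto simp: sym_coeff_add sym_coeff_0)

lemma sym_eqI: "(\<And>m. sym_coeff f m = sym_coeff g m) \<Longrightarrow> f = g"
  by (metis sym_coeff_inject ext)

lemma sym_of_nat: "of_nat n = sym_const (of_nat n)"
  by (induction n) (auto simp: sym_const_add)

lemma single_le_add_diff:
  fixes m :: xmon
  assumes "n \<le> lookup m i"
  shows "single i n + (m - single i n) = m"
  using assms by (intro poly_mapping_eqI) (auto simp: lookup_add lookup_minus lookup_single when_def)

text \<open>A factor x_i^n of the power sum contributes exactly when it divides the monomial; n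
  \<ge> 1 keeps these divisors distinct for distinct i.\<close>

lemma sym_coeff_psym_mult:
  assumes "n \<ge> 1"
  shows "sym_coeff (psym n * f) m =
    (\<Sum>i\<in>{i\<in>keys m. n \<le> lookup m i}. sym_coeff f (m - single i n))"
proof -
  let ?I = "{i\<in>keys m. n \<le> lookup m i}"
  let ?h = "\<lambda>i. (single i n, m - single i n)"
  have inj: "inj_on ?h ?I"
    using assms by (intro inj_onI) (metis One_nat_def Pair_inject keys_single not_one_le_zero singleton_inject)
  have sub: "?h ` ?I \<subseteq> xpairs m" by (auto simp: xpairs_def single_le_add_diff)
  have rest: "i \<in> ?I \<and> b = m - single i n"
    if "(single i n, b) \<in> xpairs m" for i b
  proof -
    have m: "m = single i n + b" using that by (simp add: xpairs_def)
    then have "n \<le> lookup m i" by (simp add: lookup_add)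
    then show ?thesis using assms m by (auto simp: in_keys_iff)
  qed
  have "sym_coeff (psym n * f) m = (\<Sum>p\<in>xpairs m.
      (if \<exists>i. fst p = single i n then 1 else 0) * sym_coeff f (snd p))"
    by (simp add: times_sym.rep_eq xconv_def psym.rep_eq case_prod_beta)
  also have "\<dots> = (\<Sum>p\<in>?h ` ?I. sym_coeff f (snd p))"
    using rest by (intro sum.mono_neutral_cong_right finite_xpairs sub) fastforce+
  also have "\<dots> = (\<Sum>i\<in>?I. sym_coeff f (m - single i n))"
    using inj by (subst sum.reindex) auto
  finally show ?thesis .
qed

text \<open>The generator \<open>x\<close> stands for \<open>p\<close> with index \<open>x + 1\<close>, which makes every multiset admissible.\<close>

definition psym_prod :: "nat multiset \<Rightarrow> sym" where
  "psym_prod M = (\<Prod>x\<in>#M. psym (Suc x))"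

lemma psym_prod_add: "psym_prod (add_mset x M) = psym (Suc x) * psym_prod M"
  by (simp add: psym_prod_def)

section \<open>Triangularity of products of power sums with respect to the number of
  variables\<close>

text \<open>The partition formed by the exponents, with every part lowered by one to match the
  indexing of \<open>psym_prod\<close>: the product \<open>psym_prod (xtype m)\<close> has the
  exponents of m as indices.\<close>

definition xtype :: "xmon \<Rightarrow> nat multiset" where
  "xtype m = image_mset (\<lambda>i. lookup m i - 1) (mset_set (keys m))"

lemma size_xtype: "size (xtype m) = card (keys m)"
  by (simp add: xtype_def)

lemma keys_diff_single:
  fixes m :: xmon
  assumes "n \<le> lookup m i"
  shows "keys (m - single i n) = (if lookup m i = n then keys m - {i} else keys m)"
  using assms by (auto simp: in_keys_iff lookup_minus lookup_single when_def split: if_splits)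

lemma xtype_diff_single:
  assumes "i \<in> keys m"
  shows "xtype m = add_mset (lookup m i - 1) (xtype (m - single i (lookup m i)))"
proof -
  let ?m = "m - single i (lookup m i)"
  have k: "keys ?m = keys m - {i}" by (simp add: keys_diff_single)
  have "xtype m = image_mset (\<lambda>j. lookup m j - 1) (mset_set (insert i (keys m - {i})))"
    using assms by (simp add: xtype_def insert_absorb)
  also have "\<dots> = add_mset (lookup m i - 1)
      (image_mset (\<lambda>j. lookup m j - 1) (mset_set (keys m - {i})))"
    by (subst mset_set.insert) auto
  also have "image_mset (\<lambda>j. lookup m j - 1) (mset_set (keys m - {i})) = xtype ?m"
    unfolding xtype_def k
    by (rule image_mset_cong) (auto simp: lookup_minus lookup_single when_def)
  finally show ?thesis .
qed

lemma xtype_surj: "\<exists>m. xtype m = M"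
proof (induction M)
  case empty
  show ?case by (rule exI[of _ 0]) (simp add: xtype_def)
next
  case (add x M)
  then obtain m where m: "xtype m = M" by blast
  obtain i where i: "i \<notin> keys m" using ex_new_if_finite[OF infinite_UNIV_nat finite_keys] by blast
  let ?m = "m + single i (Suc x)"
  have l: "lookup ?m i = Suc x" using i by (simp add: lookup_add in_keys_iff)
  have "xtype ?m = add_mset x (xtype m)"
    using xtype_diff_single[of i ?m] l by (simp add: in_keys_iff)
  then show ?case using m by blast
qed

text \<open>The coefficient counts the ways of assigning the factors to variables, so nothing
  cancels; if the exponents of m are the indices of the factors, at least one assignment
  exists.\<close>

lemma psym_prod_coeff_nat: "\<exists>c. sym_coeff (psym_prod M) m = of_nat c \<and> (xtype m = M \<longrightarrow> c > 0)"
proof (induction M arbitrary: m)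
  case empty
  show ?case
    by (rule exI[of _ "if m = 0 then 1 else 0"])
       (auto simp: psym_prod_def one_sym.rep_eq xtype_def mset_set_empty_iff)
next
  case (add x M)
  let ?I = "{i\<in>keys m. Suc x \<le> lookup m i}"
  obtain c where c: "\<And>m. sym_coeff (psym_prod M) m = of_nat (c m)"
      "\<And>m. xtype m = M \<Longrightarrow> c m > 0"
    using add.IH by metis
  let ?c = "\<Sum>i\<in>?I. c (m - single i (Suc x))"
  have "sym_coeff (psym_prod (add_mset x M)) m = of_nat ?c"
    by (simp add: psym_prod_add sym_coeff_psym_mult c(1))
  moreover have "?c > 0" if "xtype m = add_mset x M"
  proof -
    have "x \<in># xtype m" using that by simp
    then obtain i where i: "i \<in> keys m" "lookup m i = Suc x"
      by (auto simp: xtype_def in_keys_iff)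
    then have "xtype (m - single i (Suc x)) = M"
      using that xtype_diff_single[of i m] by simp
    then have "0 < c (m - single i (Suc x))" by (rule c(2))
    also have "\<dots> \<le> ?c" using i by (intro member_le_sum) auto
    finally show ?thesis .
  qed
  ultimately show ?case by blast
qed

text \<open>Every factor goes to one variable. Either two factors share a variable, and there are
  fewer variables than factors, or each exponent is the index of its own factor. This triangularity
  drives both generation and independence.\<close>

lemma psym_prod_coeff_nonzero:
  assumes "sym_coeff (psym_prod M) m \<noteq> 0"
  shows "card (keys m) < size M \<or> xtype m = M"
  using assms
proof (induction M arbitrary: m)
  case empty
  then show ?case by (auto simp: psym_prod_def one_sym.rep_eq xtype_def split: if_splits)
next
  case (add x M)
  have "sym_coeff (psym_prod (add_mset x M)) m =
      (\<Sum>i\<in>{i\<in>keys m. Suc x \<le> lookup m i}. sym_coeff (psym_prod M) (m - single i (Suc x)))"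
    by (simp add: psym_prod_add sym_coeff_psym_mult)
  with add.prems obtain i where i: "i \<in> keys m" "Suc x \<le> lookup m i"
      "sym_coeff (psym_prod M) (m - single i (Suc x)) \<noteq> 0"
    by (auto elim!: sum.not_neutral_contains_not_neutral)
  let ?m = "m - single i (Suc x)"
  note IH = add.IH[OF i(3)]
  show ?case
  proof (cases "lookup m i = Suc x")
    case True
    then have "xtype m = add_mset x (xtype ?m)" using xtype_diff_single[OF i(1)] by simp
    moreover from this have "card (keys m) = Suc (card (keys ?m))" by (metis size_xtype size_add_mset)
    ultimately show ?thesis using IH by auto
  next
    case False
    then have "keys ?m = keys m" using i(2) by (simp add: keys_diff_single)
    then have "card (keys m) \<le> size M" using IH size_xtype[of ?m] by auto
    then show ?thesis by simp
  qed
qed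

text \<open>Padded with zeros to the union of both supports, the two exponent vectors have the same
  multiset of values; hence a permutation of that finite set, extended by the identity, carries one
  to the other.\<close>

lemma symmetric_series_xtype:
  assumes "symmetric_series f" "xtype m = xtype m'"
  shows "f m = f m'"
proof -
  let ?A = "keys m \<union> keys m'"
  have *: "image_mset (lookup n) (mset_set (keys n \<union> keys n')) = image_mset Suc (xtype n)
      + replicate_mset (card (keys n \<union> keys n') - card (keys n)) 0" (is "_ (mset_set ?B) = _") for n n' :: xmon
  proof -
    have "mset_set (keys n \<union> (?B - keys n)) = mset_set (keys n) + mset_set (?B - keys n)"
      by (rule mset_set_Union) auto
    moreover have "keys n \<union> (?B - keys n) = ?B" by auto
    ultimately have "mset_set ?B = mset_set (keys n) + mset_set (?B - keys n)" by simp
    moreover have "image_mset (lookup n) (mset_set (?B - keys n)) =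
        image_mset (\<lambda>_. 0) (mset_set (?B - keys n))"
      by (rule image_mset_cong) (auto simp: in_keys_iff)
    moreover have "card (?B - keys n) = card ?B - card (keys n)"
      by (subst card_Diff_subset) auto
    moreover have "image_mset (lookup n) (mset_set (keys n)) = image_mset Suc (xtype n)"
      unfolding xtype_def multiset.map_comp
      by (rule image_mset_cong) (auto simp: in_keys_iff)
    ultimately show ?thesis by (simp add: image_mset_const_eq)
  qed
  have "image_mset (lookup m) (mset_set ?A) = image_mset (lookup m') (mset_set ?A)"
    using *[of m m'] *[of m' m] assms(2) size_xtype[of m] size_xtype[of m']
    by (simp add: Un_commute)
  then obtain p where p: "p permutes ?A" "\<forall>x\<in>?A. lookup m x = lookup m' (p x)"
    by (elim image_mset_eq_implies_permutes[rotated]) auto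
  have "lookup m x = lookup m' (p x)" for x
  proof (cases "x \<in> ?A")
    case False
    then show ?thesis using p(1) by (simp add: permutes_not_in in_keys_iff)
  qed (use p in auto)
  then have "m = Poly_Mapping.map_key p m'"
    using p(1) by (intro poly_mapping_eqI) (simp add: lookup_map_key_bij permutes_bij)
  then show ?thesis using assms(1) p(1) by (auto simp: symmetric_series_def permutes_bij)
qed

lemma sym_coeff_xtype: "xtype m = xtype m' \<Longrightarrow> sym_coeff f m = sym_coeff f m'"
  using sym_coeff[of f] by (auto intro: symmetric_series_xtype)

lemma lookup_le_xdeg: "lookup m i \<le> xdeg m"
  by (cases "i \<in> keys m") (auto simp: xdeg_def in_keys_iff intro: member_le_sum)

text \<open>Power sums generate: the coefficients of f at monomials in the largest number L of
  variables are matched by a combination g of products of L power sums, and by triangularity f - g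
  involves only monomials in fewer variables.\<close>

lemma sym_induct [case_names const psym add mult]:
  assumes const: "\<And>c. P (sym_const c)" and psym: "\<And>n. n \<ge> 1 \<Longrightarrow> P (psym n)"
    and add: "\<And>f g. P f \<Longrightarrow> P g \<Longrightarrow> P (f + g)"
    and mult: "\<And>f g. P f \<Longrightarrow> P g \<Longrightarrow> P (f * g)"
  shows "P f"
proof -
  have prod: "P (psym_prod M)" for M
    by (induction M) (auto simp: psym_prod_def intro!: mult psym, metis const sym_const_1)
  have sum: "P (\<Sum>x\<in>S. h x)" if "\<And>x. P (h x)" for S and h :: "nat multiset \<Rightarrow> sym"
    by (induction S rule: infinite_finite_induct)
       (use const[of 0] that in \<open>auto intro: add\<close>)
  have "P f" if "\<And>m. sym_coeff f m \<noteq> 0 \<Longrightarrow> card (keys m) < L" for L f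
    using that
  proof (induction L arbitrary: f)
    case 0
    then have "f = sym_const 0" by (intro sym_eqI) (auto simp: sym_coeff_0)
    then show ?case using const by metis
  next
    case (Suc L)
    obtain d where d: "\<And>m. sym_coeff f m \<noteq> 0 \<Longrightarrow> xdeg m \<le> d"
      using sym_coeff[of f] by (auto simp: bounded_degree_def)
    \<comment> \<open>The types with L parts that can occur in f; the degree bound makes them
      finitely many.\<close>
    define S where "S = mset ` {xs. set xs \<subseteq> {..d} \<and> length xs = L}"
    have S: "M \<in> S \<longleftrightarrow> size M = L \<and> set_mset M \<subseteq> {..d}" for M
    proof -
      obtain xs where "M = mset xs" by (metis ex_mset)
      then show ?thesis unfolding S_def by (auto simp: image_iff dest: mset_eq_setD mset_eq_length)
    qed
    have fin: "finite S" unfolding S_def by (intro finite_imageI finite_lists_length_eq) simp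
    obtain r where r: "\<And>M. xtype (r M) = M" using xtype_surj by metis
    define g where "g = (\<Sum>M\<in>S. sym_const (sym_coeff f (r M) /
        sym_coeff (psym_prod M) (r M)) * psym_prod M)"
    have g: "sym_coeff g m = (\<Sum>M\<in>S. sym_coeff f (r M) /
        sym_coeff (psym_prod M) (r M) * sym_coeff (psym_prod M) m)" for m
      by (simp add: g_def sym_coeff_sum sym_coeff_const_mult)
    have "P (f - g)"
    proof (rule Suc.IH)
      fix m assume nz: "sym_coeff (f - g) m \<noteq> 0"
      show "card (keys m) < L"
      proof (rule ccontr)
        assume ge: "\<not> card (keys m) < L"
        have z: "sym_coeff (psym_prod M) m = 0" if "M \<in> S" "M \<noteq> xtype m" for M
          using psym_prod_coeff_nonzero[of M m] that ge by (auto simp: S)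
        show False
        proof (cases "xtype m \<in> S")
          case True
          have "sym_coeff g m = sym_coeff f (r (xtype m)) /
              sym_coeff (psym_prod (xtype m)) (r (xtype m)) * sym_coeff (psym_prod (xtype m)) m"
            unfolding g using z by (subst sum.remove[OF fin True]) (auto intro!: sum.neutral)
          moreover have "sym_coeff (psym_prod (xtype m)) m \<noteq> 0"
            using psym_prod_coeff_nat[of "xtype m" m] by auto
          moreover have "xtype (r (xtype m)) = xtype m" by (rule r)
          ultimately have "sym_coeff g m = sym_coeff f m"
            using sym_coeff_xtype[of "r (xtype m)" m] by simp
          then show False using nz by (simp add: sym_coeff_diff)
        next
          case False
          then have "sym_coeff g m = 0" unfolding g using z by (intro sum.neutral) auto
          with nz have f: "sym_coeff f m \<noteq> 0" by (simp add: sym_coeff_diff)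
          have "set_mset (xtype m) \<subseteq> {..d}"
          proof -
            have "lookup m i - 1 \<le> d" for i
              using lookup_le_xdeg[of m i] d[OF f] by linarith
            then show ?thesis by (auto simp: xtype_def)
          qed
          then show False using Suc.prems[OF f] ge False by (auto simp: S size_xtype)
        qed
      qed
    qed
    moreover have "P g" unfolding g_def by (intro sum mult const prod)
    ultimately show ?case using add[of "f - g" g] by simp
  qed
  note levels = this
  obtain d where d: "\<And>m. sym_coeff f m \<noteq> 0 \<Longrightarrow> xdeg m \<le> d"
    using sym_coeff[of f] by (auto simp: bounded_degree_def)
  have "card (keys m) \<le> xdeg m" for m
    unfolding xdeg_def card_eq_sum by (rule sum_mono) (auto simp: in_keys_iff)
  then have "sym_coeff f m \<noteq> 0 \<Longrightarrow> card (keys m) < Suc d" for m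
    using d[of m] by (meson le_imp_less_Suc order_trans)
  then show ?thesis by (rule levels)
qed

section \<open>Evaluation of polynomials, and algebraic independence of the power sums\<close>

text \<open>Finitely supported functions on multisets form the polynomial ring in variables indexed
  by \<open>nat\<close>, and this is its evaluation homomorphism. With values in \<open>sym\<close>
  it compares the ring with symmetric functions; with values in \<open>yring\<close> it produces
  homomorphisms.\<close>

definition mset_eval :: "(K \<Rightarrow> 'a::comm_ring_1) \<Rightarrow> (nat \<Rightarrow> 'a) \<Rightarrow> (nat multiset \<Rightarrow>\<^sub>0 K) \<Rightarrow> 'a" where
  "mset_eval \<iota> \<beta> c = (\<Sum>M\<in>keys c. \<iota> (lookup c M) * (\<Prod>x\<in>#M. \<beta> x))"

context
  fixes \<iota> :: "K \<Rightarrow> 'a::comm_ring_1" and \<beta> :: "nat \<Rightarrow> 'a"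
  assumes \<iota>_add: "\<And>a b. \<iota> (a + b) = \<iota> a + \<iota> b" and \<iota>_mult: "\<And>a b. \<iota> (a * b) = \<iota> a * \<iota> b"
    and \<iota>_0: "\<iota> 0 = 0"
begin

lemma mset_eval_superset:
  "finite S \<Longrightarrow> keys c \<subseteq> S \<Longrightarrow> mset_eval \<iota> \<beta> c = (\<Sum>M\<in>S. \<iota> (lookup c M) * (\<Prod>x\<in>#M. \<beta> x))"
  unfolding mset_eval_def by (rule sum.mono_neutral_left) (auto simp: in_keys_iff \<iota>_0)

lemma mset_eval_single: "mset_eval \<iota> \<beta> (single M k) = \<iota> k * (\<Prod>x\<in>#M. \<beta> x)"
  by (subst mset_eval_superset[of "{M}"]) auto

lemma mset_eval_add: "mset_eval \<iota> \<beta> (c + d) = mset_eval \<iota> \<beta> c + mset_eval \<iota> \<beta> d"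
proof -
  let ?S = "keys c \<union> keys d"
  have "keys (c + d) \<subseteq> ?S" by (rule keys_add)
  then show ?thesis
    by (simp add: mset_eval_superset[of ?S] lookup_add \<iota>_add distrib_right sum.distrib)
qed

lemma mset_eval_mult: "mset_eval \<iota> \<beta> (c * d) = mset_eval \<iota> \<beta> c * mset_eval \<iota> \<beta> d"
proof (induction c rule: poly_mapping_induct)
  case (single M k)
  show ?case
  proof (induction d rule: poly_mapping_induct)
    case (add f g)
    then show ?case by (simp only: mset_eval_add distrib_left)
  qed (auto simp: mset_eval_single mult_single \<iota>_mult ac_simps mset_eval_def[of _ _ 0])
next
  case (add f g)
  then show ?case by (simp only: mset_eval_add distrib_right)
qed (auto simp: mset_eval_def[of _ _ 0])

end

lemma sym_const_hom:
  "sym_const (a + b) = sym_const a + sym_const b" "sym_const (a * b) = sym_const a * sym_const b"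
  by (simp_all add: sym_const_add sym_const_mult)

lemmas sym_eval_single = mset_eval_single[of sym_const, OF sym_const_hom sym_const_0]
lemmas sym_eval_add = mset_eval_add[of sym_const, OF sym_const_hom sym_const_0]
lemmas sym_eval_mult = mset_eval_mult[of sym_const, OF sym_const_hom sym_const_0]

abbreviation psym_eval :: "(nat multiset \<Rightarrow>\<^sub>0 K) \<Rightarrow> sym" where
  "psym_eval \<equiv> mset_eval sym_const (\<lambda>x. psym (Suc x))"

lemma psym_eval_surj: "\<exists>c. psym_eval c = f"
proof (induction f rule: sym_induct)
  case (const k)
  show ?case by (rule exI[of _ "single {#} k"]) (simp add: sym_eval_single)
next
  case (psym n)
  then show ?case
    by (intro exI[of _ "single {#n - 1#} 1"]) (simp add: sym_eval_single)
next
  case (add f g)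
  then show ?case by (metis sym_eval_add)
next
  case (mult f g)
  then show ?case by (metis sym_eval_mult)
qed

text \<open>For M of largest size in the support, every other product of the support vanishes at a
  monomial of type M by triangularity, so the coefficient of M would have to vanish.\<close>

lemma psym_eval_eq_0:
  assumes "psym_eval c = 0"
  shows "c = 0"
proof (rule ccontr)
  assume "c \<noteq> 0"
  then have ne: "keys c \<noteq> {}" by (metis in_keys_iff lookup_zero poly_mapping_eqI empty_iff)
  have "\<exists>M\<in>keys c. \<forall>N\<in>keys c. size N \<le> size M"
  proof -
    have "Max (size ` keys c) \<in> size ` keys c" using ne by (intro Max_in) auto
    then obtain M where "M \<in> keys c" "size M = Max (size ` keys c)" by (metis imageE)
    then show ?thesis by (metis Max_ge finite_imageI finite_keys image_eqI)
  qed
  then obtain M where M: "M \<in> keys c" "\<And>N. N \<in> keys c \<Longrightarrow> size N \<le> size M" by blast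
  obtain m where m: "xtype m = M" using xtype_surj by blast
  have z: "sym_coeff (psym_prod N) m = 0" if "N \<in> keys c" "N \<noteq> M" for N
    using psym_prod_coeff_nonzero[of N m] M(2)[OF that(1)] that m size_xtype[of m] by auto
  have "sym_coeff (psym_eval c) m = (\<Sum>N\<in>keys c. lookup c N * sym_coeff (psym_prod N) m)"
    by (simp add: mset_eval_def sym_coeff_sum sym_coeff_const_mult psym_prod_def)
  also have "\<dots> = lookup c M * sym_coeff (psym_prod M) m"
    using z by (subst sum.remove[OF _ M(1)]) (auto intro!: sum.neutral)
  finally show False
    using assms M(1) psym_prod_coeff_nat[of M m] m by (auto simp: sym_coeff_0 in_keys_iff)
qed

lemma inj_psym_eval: "inj psym_eval"
proof (rule injI)
  fix c d assume "psym_eval c = psym_eval d"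
  moreover have "psym_eval c = psym_eval (c - d) + psym_eval d"
    by (subst sym_eval_add[symmetric]) simp
  ultimately show "c = d" using psym_eval_eq_0[of "c - d"] by simp
qed

section \<open>Homomorphisms between polynomial rings over the symmetric functions\<close>

lemma sconst_0 [simp]: "sconst 0 = 0" by (simp add: sconst_def)
lemma sconst_1 [simp]: "sconst 1 = 1" by (simp add: sconst_def)
lemma sconst_add: "sconst (a + b) = sconst a + sconst b" by (simp add: sconst_def single_add)
lemma sconst_mult: "sconst (a * b) = sconst a * sconst b" by (simp add: sconst_def mult_single)

lemma kconst_0 [simp]: "kconst 0 = 0" by (simp add: kconst_def)
lemma kconst_1 [simp]: "kconst 1 = 1" by (simp add: kconst_def)
lemma kconst_add: "kconst (a + b) = kconst a + kconst b"
  by (simp add: kconst_def sym_const_add sconst_add)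
lemma kconst_mult: "kconst (a * b) = kconst a * kconst b"
  by (simp add: kconst_def sym_const_mult sconst_mult)
lemma kconst_uminus: "kconst (- a) = - kconst a"
  using kconst_add[of a "- a"] by (simp add: eq_neg_iff_add_eq_0 add.commute)
lemma kconst_diff: "kconst (a - b) = kconst a - kconst b"
  using kconst_add[of a "- b"] by (simp add: kconst_uminus)
lemma kconst_power: "kconst (a ^ n) = kconst a ^ n"
  by (induction n) (auto simp: kconst_mult)
lemma kconst_of_nat: "kconst (of_nat n) = of_nat n"
  by (induction n) (auto simp: kconst_add)
lemma kconst_inverse: "a \<noteq> 0 \<Longrightarrow> kconst a * kconst (inverse a) = 1"
  by (simp flip: kconst_mult)
lemma kconst_cancel:
  assumes "a \<noteq> 0" "kconst a * F = kconst a * G"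
  shows "F = G"
proof -
  have inv: "kconst (inverse a) * (kconst a * H) = H" for H
  proof -
    have "kconst (inverse a) * (kconst a * H) = (kconst a * kconst (inverse a)) * H"
      by (simp only: ac_simps)
    then show ?thesis by (simp only: kconst_inverse[OF assms(1)] mult_1)
  qed
  have "F = kconst (inverse a) * (kconst a * F)" by (rule inv[symmetric])
  also have "\<dots> = G" unfolding assms(2) by (rule inv)
  finally show ?thesis .
qed

lemma yring_of_nat_cancel: "n \<noteq> 0 \<Longrightarrow> of_nat n * F = of_nat n * (G :: yring) \<Longrightarrow> F = G"
  using kconst_cancel[of "of_nat n" F G] by (simp add: kconst_of_nat)

lemmas kconst_hom = kconst_add kconst_mult kconst_0
lemmas kconst_eval_single = mset_eval_single[of kconst, OF kconst_hom]
lemmas kconst_eval_add = mset_eval_add[of kconst, OF kconst_hom]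
lemmas kconst_eval_mult = mset_eval_mult[of kconst, OF kconst_hom]

text \<open>The inverse of the bijection \<open>psym_eval\<close> lets arbitrary images of the power
  sums be prescribed; the variable with index x stands for the power sum of index x + 1.\<close>

definition sym_hom :: "(nat \<Rightarrow> yring) \<Rightarrow> sym \<Rightarrow> yring" where
  "sym_hom b f = mset_eval kconst (\<lambda>x. b (Suc x)) (inv psym_eval f)"

lemma psym_eval_inv: "psym_eval (inv psym_eval f) = f"
  by (metis psym_eval_surj surj_def surj_f_inv_f)

lemma inv_psym_eval_eq: "psym_eval c = f \<Longrightarrow> inv psym_eval f = c"
  by (metis inj_psym_eval inv_f_f)

lemma sym_hom_add: "sym_hom b (f + g) = sym_hom b f + sym_hom b g"
proof -
  have "inv psym_eval (f + g) = inv psym_eval f + inv psym_eval g"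
    by (intro inv_psym_eval_eq) (simp add: sym_eval_add psym_eval_inv)
  then show ?thesis by (simp add: sym_hom_def kconst_eval_add)
qed

lemma sym_hom_mult: "sym_hom b (f * g) = sym_hom b f * sym_hom b g"
proof -
  have "inv psym_eval (f * g) = inv psym_eval f * inv psym_eval g"
    by (intro inv_psym_eval_eq) (simp add: sym_eval_mult psym_eval_inv)
  then show ?thesis by (simp add: sym_hom_def kconst_eval_mult)
qed

lemma sym_hom_const: "sym_hom b (sym_const c) = kconst c"
proof -
  have "inv psym_eval (sym_const c) = single {#} c"
    by (intro inv_psym_eval_eq) (simp add: sym_eval_single)
  then show ?thesis by (simp add: sym_hom_def kconst_eval_single)
qed

lemma sym_hom_psym:
  assumes "n \<ge> 1"
  shows "sym_hom b (psym n) = b n"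
proof -
  have "inv psym_eval (psym n) = single {#n - 1#} 1"
    using assms by (intro inv_psym_eval_eq) (simp add: sym_eval_single)
  then show ?thesis using assms by (simp add: sym_hom_def kconst_eval_single)
qed

lemma sym_hom_unique:
  assumes "\<And>f g. \<phi> (f + g) = \<phi> f + \<phi> g" "\<And>f g. \<phi> (f * g) = \<phi> f * \<phi> g"
    "\<And>c. \<phi> (sym_const c) = kconst c" "\<And>n. n \<ge> 1 \<Longrightarrow> \<phi> (psym n) = b n"
  shows "\<phi> = sym_hom b"
proof
  fix f show "\<phi> f = sym_hom b f"
    by (induction f rule: sym_induct)
       (simp_all add: assms sym_hom_add sym_hom_mult sym_hom_const sym_hom_psym)
qed

text \<open>Existence comes from independence and uniqueness from generation; together they resolve
  the definite description in \<open>pleth\<close>.\<close>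

lemma pleth_eq: "pleth A = sym_hom (\<lambda>n. power_subst n A)"
  unfolding pleth_def
proof (rule the_equality)
  show "is_plethysm A (sym_hom (\<lambda>n. power_subst n A))"
    by (simp add: is_plethysm_def sym_hom_add sym_hom_mult sym_hom_const sym_hom_psym)
  show "\<phi> = sym_hom (\<lambda>n. power_subst n A)" if "is_plethysm A \<phi>" for \<phi>
    using that by (intro sym_hom_unique) (auto simp: is_plethysm_def)
qed

lemma sym_hom_sconst: "sym_hom (\<lambda>n. sconst (psym n)) = sconst"
  by (rule sym_hom_unique[symmetric]) (auto simp: sconst_add sconst_mult kconst_def)

section \<open>Polynomial subrings and the homomorphisms on them\<close>

text \<open>V_k is the case of the index set {1..k}; general index sets are needed because bound
  variables such as y_0 are adjoined and removed.\<close>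

definition PV :: "nat set \<Rightarrow> yring set" where
  "PV I = {F. \<forall>m\<in>keys F. \<forall>i. 0 \<le> lookup m i \<and> (lookup m i \<noteq> 0 \<longrightarrow> i \<in> I)}"

abbreviation "yp \<equiv> PV UNIV"

lemma V_PV: "V k = PV {1..k}"
  by (auto simp: V_def PV_def)

lemma PV_mono: "F \<in> PV I \<Longrightarrow> I \<subseteq> J \<Longrightarrow> F \<in> PV J"
  by (auto simp: PV_def)

lemma PV_yp: "F \<in> PV I \<Longrightarrow> F \<in> yp"
  by (auto simp: PV_def)

lemma PV_0 [simp]: "0 \<in> PV I" by (simp add: PV_def)

lemma PV_sconst [simp]: "sconst s \<in> PV I" by (simp add: PV_def sconst_def)
lemma PV_kconst [simp]: "kconst c \<in> PV I" by (simp add: kconst_def)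
lemma PV_1 [simp]: "1 \<in> PV I" by (metis PV_kconst kconst_1)

lemma PV_add [intro, simp]: "F \<in> PV I \<Longrightarrow> G \<in> PV I \<Longrightarrow> F + G \<in> PV I"
  using keys_add[of F G] by (auto simp: PV_def)

lemma PV_uminus [intro, simp]: "F \<in> PV I \<Longrightarrow> - F \<in> PV I"
  by (auto simp: PV_def in_keys_iff)

lemma PV_diff [intro, simp]: "F \<in> PV I \<Longrightarrow> G \<in> PV I \<Longrightarrow> F - G \<in> PV I"
  using PV_add[of F I "- G"] by simp

lemma PV_mult [intro, simp]:
  assumes "F \<in> PV I" "G \<in> PV I"
  shows "F * G \<in> PV I"
  unfolding PV_def
proof safe
  fix m i assume "m \<in> keys (F * G)"
  then obtain a b where m: "m = a + b" and ab: "a \<in> keys F" "b \<in> keys G"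
    using keys_mult[of F G] by blast
  show "0 \<le> lookup m i" using assms ab by (auto simp: PV_def m lookup_add)
  assume "lookup m i \<noteq> 0"
  then have "lookup a i \<noteq> 0 \<or> lookup b i \<noteq> 0" by (auto simp: m lookup_add)
  then show "i \<in> I" using assms ab by (auto simp: PV_def)
qed

lemma PV_yv [intro, simp]: "i \<in> I \<Longrightarrow> yv i \<in> PV I"
  by (auto simp: PV_def yv_def lookup_single when_def)

lemma PV_power [intro, simp]: "F \<in> PV I \<Longrightarrow> F ^ n \<in> PV I"
  by (induction n) auto

lemma PV_sum [intro, simp]: "(\<And>x. x \<in> S \<Longrightarrow> f x \<in> PV I) \<Longrightarrow> sum f S \<in> PV I"
  by (induction S rule: infinite_finite_induct) auto

lemma PV_prod [intro, simp]: "(\<And>x. x \<in> S \<Longrightarrow> f x \<in> PV I) \<Longrightarrow> prod f S \<in> PV I"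
  by (induction S rule: infinite_finite_induct) auto

lemma yv_power: "yv i ^ n = single (single i (int n)) 1"
  by (induction n) (auto simp: yv_def mult_single simp flip: single_add)

lemma single_eq_prod_yv:
  assumes "\<And>i. 0 \<le> lookup m i"
  shows "single m c = sconst c * (\<Prod>i\<in>keys m. yv i ^ nat (lookup m i))"
proof -
  have "(\<Prod>i\<in>S. yv i ^ nat (lookup m i)) =
      single (\<Sum>i\<in>S. single i (lookup m i)) 1" if "finite S" for S
    using that assms by (induction S) (auto simp: yv_power mult_single)
  moreover have "(\<Sum>i\<in>keys m. single i (lookup m i)) = m"
    by (rule poly_mapping_eqI) (auto simp: lookup_sum lookup_single when_def in_keys_iff)
  ultimately show ?thesis by (simp add: sconst_def mult_single)
qed

lemma PV_single:
  "(\<And>i. 0 \<le> lookup m i) \<Longrightarrow> (\<And>i. lookup m i \<noteq> 0 \<Longrightarrow> i \<in> I) \<Longrightarrow> single m c \<in> PV I"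
  by (auto simp: PV_def)

lemma PV_single_induct [consumes 1, case_names zero single add]:
  assumes "F \<in> PV I" "P 0"
    "\<And>m c. (\<And>i. 0 \<le> lookup m i) \<Longrightarrow> (\<And>i. lookup m i \<noteq> 0 \<Longrightarrow> i \<in> I) \<Longrightarrow> P (single m c)"
    "\<And>F G. F \<in> PV I \<Longrightarrow> G \<in> PV I \<Longrightarrow> P F \<Longrightarrow> P G \<Longrightarrow> P (F + G)"
  shows "P F"
proof -
  have "F \<in> PV I \<and> P F"
  proof (induction F rule: poly_mapping_induct)
    case (single p c)
    then have "0 \<le> lookup p i" "lookup p i \<noteq> 0 \<Longrightarrow> i \<in> I" for i
      using assms(1) by (auto simp: PV_def)
    then show ?case by (auto intro: PV_single assms(3))
  qed (auto intro: assms)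
  then show ?thesis by simp
qed

lemma PV_induct [consumes 1, case_names sconst yv add mult]:
  assumes "F \<in> PV I" "\<And>s. P (sconst s)" "\<And>i. i \<in> I \<Longrightarrow> P (yv i)"
    and add: "\<And>F G. F \<in> PV I \<Longrightarrow> G \<in> PV I \<Longrightarrow> P F \<Longrightarrow> P G \<Longrightarrow> P (F + G)"
    and mult: "\<And>F G. F \<in> PV I \<Longrightarrow> G \<in> PV I \<Longrightarrow> P F \<Longrightarrow> P G \<Longrightarrow> P (F * G)"
  shows "P F"
  using assms(1)
proof (induction F rule: PV_single_induct)
  case zero
  show ?case using assms(2)[of 0] by simp
next
  case (single m c)
  have one: "P 1" using assms(2)[of 1] by simp
  have pow: "P (yv i ^ n)" if "i \<in> I" for i n
    using that by (induction n) (auto intro: one mult assms(3))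
  have "P (\<Prod>i\<in>S. yv i ^ nat (lookup m i)) \<and> (\<Prod>i\<in>S. yv i ^ nat (lookup m i)) \<in> PV I"
    if "finite S" "S \<subseteq> keys m" for S
    using that single by (induction S) (auto intro!: one mult pow simp: in_keys_iff)
  then show ?case
    using single by (subst single_eq_prod_yv) (auto intro!: mult assms(2))
qed (auto intro: add)

text \<open>One construction for plethysm and for substitution of the y_i, so that their
  compositions can be compared uniformly. Truncation by \<open>nat\<close> makes it multiplicative
  only on \<open>yp\<close>, which is why \<open>is_hom\<close> asks for no more.\<close>

definition yhom :: "(nat \<Rightarrow> yring) \<Rightarrow> (nat \<Rightarrow> yring) \<Rightarrow> yring \<Rightarrow> yring" where
  "yhom b \<sigma> F = (\<Sum>m\<in>keys F. sym_hom b (lookup F m) * (\<Prod>i\<in>keys m. \<sigma> i ^ nat (lookup m i)))"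

lemma sym_hom_0 [simp]: "sym_hom b 0 = 0"
  by (metis kconst_0 sym_const_0 sym_hom_const)

lemma sym_hom_1 [simp]: "sym_hom b 1 = 1"
  by (metis kconst_1 sym_const_1 sym_hom_const)

lemma yhom_superset: "finite S \<Longrightarrow> keys F \<subseteq> S \<Longrightarrow>
    yhom b \<sigma> F = (\<Sum>m\<in>S. sym_hom b (lookup F m) * (\<Prod>i\<in>keys m. \<sigma> i ^ nat (lookup m i)))"
  unfolding yhom_def by (rule sum.mono_neutral_left) (auto simp: in_keys_iff)

lemma yhom_add: "yhom b \<sigma> (F + G) = yhom b \<sigma> F + yhom b \<sigma> G"
proof -
  let ?S = "keys F \<union> keys G"
  have "keys (F + G) \<subseteq> ?S" by (rule keys_add)
  then show ?thesis
    by (simp add: yhom_superset[of ?S] lookup_add sym_hom_add distrib_right sum.distrib)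
qed

lemma yhom_0 [simp]: "yhom b \<sigma> 0 = 0" by (simp add: yhom_def)

lemma yhom_single:
  "yhom b \<sigma> (single m c) = sym_hom b c * (\<Prod>i\<in>keys m. \<sigma> i ^ nat (lookup m i))"
  by (subst yhom_superset[of "{m}"]) auto

lemma yhom_sconst: "yhom b \<sigma> (sconst s) = sym_hom b s"
  by (simp add: sconst_def yhom_single)

lemma yhom_yv: "yhom b \<sigma> (yv i) = \<sigma> i"
  by (simp add: yv_def yhom_single)

lemma prod_keys_superset:
  fixes m :: ymon and \<sigma> :: "nat \<Rightarrow> yring"
  assumes "finite S" "keys m \<subseteq> S"
  shows "(\<Prod>i\<in>keys m. \<sigma> i ^ nat (lookup m i)) = (\<Prod>i\<in>S. \<sigma> i ^ nat (lookup m i))"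
  using assms by (intro prod.mono_neutral_left) (auto simp: in_keys_iff)

lemma prod_keys_add:
  fixes m n :: ymon and \<sigma> :: "nat \<Rightarrow> yring"
  assumes "\<And>i. 0 \<le> lookup m i" "\<And>i. 0 \<le> lookup n i"
  shows "(\<Prod>i\<in>keys (m + n). \<sigma> i ^ nat (lookup (m + n) i)) =
    (\<Prod>i\<in>keys m. \<sigma> i ^ nat (lookup m i)) * (\<Prod>i\<in>keys n. \<sigma> i ^ nat (lookup n i))"
proof -
  let ?S = "keys m \<union> keys n"
  have "keys (m + n) \<subseteq> ?S" by (rule keys_add)
  then show ?thesis
    using assms
    by (subst (1 2 3) prod_keys_superset[of ?S])
       (auto simp: lookup_add nat_add_distrib power_add prod.distrib)
qed

lemma yhom_mult:
  assumes "F \<in> yp" "G \<in> yp"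
  shows "yhom b \<sigma> (F * G) = yhom b \<sigma> F * yhom b \<sigma> G"
  using assms(1)
proof (induction F rule: PV_single_induct)
  case (single m c)
  show ?case using assms(2)
  proof (induction G rule: PV_single_induct)
    case (single n d)
    show ?case
      by (simp add: mult_single yhom_single sym_hom_mult prod_keys_add \<open>\<And>i. 0 \<le> lookup m i\<close> single)
  qed (simp_all add: yhom_add distrib_left)
qed (simp_all add: yhom_add distrib_right)

definition is_hom :: "(yring \<Rightarrow> yring) \<Rightarrow> bool" where
  "is_hom \<theta> \<longleftrightarrow> (\<forall>F\<in>yp. \<forall>G\<in>yp. \<theta> (F + G) = \<theta> F + \<theta> G) \<and>
    (\<forall>F\<in>yp. \<forall>G\<in>yp. \<theta> (F * G) = \<theta> F * \<theta> G) \<and>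
    (\<forall>c. \<theta> (kconst c) = kconst c) \<and> (\<forall>F\<in>yp. \<theta> F \<in> yp)"

lemma is_hom_add: "is_hom \<theta> \<Longrightarrow> F \<in> yp \<Longrightarrow> G \<in> yp \<Longrightarrow> \<theta> (F + G) = \<theta> F + \<theta> G"
  and is_hom_mult: "is_hom \<theta> \<Longrightarrow> F \<in> yp \<Longrightarrow> G \<in> yp \<Longrightarrow> \<theta> (F * G) = \<theta> F * \<theta> G"
  and is_hom_kconst: "is_hom \<theta> \<Longrightarrow> \<theta> (kconst c) = kconst c"
  and is_hom_yp: "is_hom \<theta> \<Longrightarrow> F \<in> yp \<Longrightarrow> \<theta> F \<in> yp"
  by (auto simp: is_hom_def)

lemma is_hom_0: "is_hom \<theta> \<Longrightarrow> \<theta> 0 = 0"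
  and is_hom_1: "is_hom \<theta> \<Longrightarrow> \<theta> 1 = 1"
  using is_hom_kconst[of \<theta> 0] is_hom_kconst[of \<theta> 1] by simp_all

lemma is_hom_uminus: "is_hom \<theta> \<Longrightarrow> F \<in> yp \<Longrightarrow> \<theta> (- F) = - \<theta> F"
  using is_hom_add[of \<theta> F "- F"] by (simp add: is_hom_0 eq_neg_iff_add_eq_0 add.commute)

lemma is_hom_diff: "is_hom \<theta> \<Longrightarrow> F \<in> yp \<Longrightarrow> G \<in> yp \<Longrightarrow> \<theta> (F - G) = \<theta> F - \<theta> G"
  using is_hom_add[of \<theta> F "- G"] by (simp add: is_hom_uminus)

lemma is_hom_power: "is_hom \<theta> \<Longrightarrow> F \<in> yp \<Longrightarrow> \<theta> (F ^ n) = \<theta> F ^ n"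
  by (induction n) (auto simp: is_hom_1 is_hom_mult)

lemma is_hom_of_nat: "is_hom \<theta> \<Longrightarrow> \<theta> (of_nat n) = of_nat n"
  using is_hom_kconst[of \<theta> "of_nat n"] by (simp add: kconst_of_nat)

lemma is_hom_sum:
  "is_hom \<theta> \<Longrightarrow> (\<And>x. x \<in> S \<Longrightarrow> f x \<in> yp) \<Longrightarrow> \<theta> (sum f S) = (\<Sum>x\<in>S. \<theta> (f x))"
  by (induction S rule: infinite_finite_induct) (auto simp: is_hom_0 is_hom_add)

lemma is_hom_comp: "is_hom \<theta> \<Longrightarrow> is_hom \<eta> \<Longrightarrow> is_hom (\<lambda>F. \<theta> (\<eta> F))"
  by (simp add: is_hom_def)

lemma is_hom_id: "is_hom (\<lambda>F. F)"
  by (simp add: is_hom_def)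

lemma is_hom_PV_induct [consumes 1, case_names kconst psym yv add mult]:
  assumes "F \<in> PV I" "\<And>c. P (kconst c)" "\<And>n. n \<ge> 1 \<Longrightarrow> P (sconst (psym n))" "\<And>i. i \<in> I \<Longrightarrow> P (yv i)"
    and add: "\<And>F G. F \<in> PV I \<Longrightarrow> G \<in> PV I \<Longrightarrow> P F \<Longrightarrow> P G \<Longrightarrow> P (F + G)"
    and mult: "\<And>F G. F \<in> PV I \<Longrightarrow> G \<in> PV I \<Longrightarrow> P F \<Longrightarrow> P G \<Longrightarrow> P (F * G)"
  shows "P F"
  using assms(1)
proof (induction F rule: PV_induct)
  case (sconst s)
  show ?case
    by (induction s rule: sym_induct)
       (auto simp: sconst_add sconst_mult intro!: add mult assms(3) simp flip: kconst_def intro: assms(2))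
qed (auto intro: assms)

text \<open>Agreement is required only at the y_i with i in I. Hence a homomorphism that renames a
  bound variable outside I can replace one that would capture it.\<close>

lemma is_hom_eqI:
  assumes "is_hom \<theta>" "is_hom \<eta>" "F \<in> PV I"
    "\<And>n. n \<ge> 1 \<Longrightarrow> \<theta> (sconst (psym n)) = \<eta> (sconst (psym n))"
    "\<And>i. i \<in> I \<Longrightarrow> \<theta> (yv i) = \<eta> (yv i)"
  shows "\<theta> F = \<eta> F"
  using assms(3)
  by (induction F rule: is_hom_PV_induct)
     (simp_all add: assms is_hom_kconst PV_yp is_hom_add[OF assms(1)] is_hom_add[OF assms(2)]
       is_hom_mult[OF assms(1)] is_hom_mult[OF assms(2)])

lemma is_hom_into:
  assumes "is_hom \<theta>" "F \<in> PV I" "\<And>n. n \<ge> 1 \<Longrightarrow> \<theta> (sconst (psym n)) \<in> PV J"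
    "\<And>i. i \<in> I \<Longrightarrow> \<theta> (yv i) \<in> PV J"
  shows "\<theta> F \<in> PV J"
  using assms(2)
  by (induction F rule: is_hom_PV_induct)
     (simp_all add: assms is_hom_kconst PV_yp is_hom_add[OF assms(1)] is_hom_mult[OF assms(1)])

lemma sym_hom_yp:
  assumes "\<And>n. n \<ge> 1 \<Longrightarrow> b n \<in> PV I"
  shows "sym_hom b s \<in> PV I"
  by (induction s rule: sym_induct)
     (simp_all add: assms sym_hom_add sym_hom_mult sym_hom_const sym_hom_psym)

lemma is_hom_yhom:
  assumes "\<And>n. n \<ge> 1 \<Longrightarrow> b n \<in> yp" "\<And>i. \<sigma> i \<in> yp"
  shows "is_hom (yhom b \<sigma>)"
  unfolding is_hom_def
proof (intro conjI ballI allI)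
  show "yhom b \<sigma> F \<in> yp" for F
    unfolding yhom_def by (intro PV_sum PV_mult PV_prod PV_power sym_hom_yp assms)
qed (auto simp: yhom_add yhom_mult kconst_def yhom_sconst sym_hom_const)

lemma ysubst_eq: "ysubst \<sigma> = yhom (\<lambda>n. sconst (psym n)) \<sigma>"
  by (rule ext) (simp add: ysubst_def yhom_def sym_hom_sconst)

lemma is_hom_ysubst: "(\<And>i. \<sigma> i \<in> yp) \<Longrightarrow> is_hom (ysubst \<sigma>)"
  by (simp add: ysubst_eq is_hom_yhom)

lemma ysubst_sconst [simp]: "ysubst \<sigma> (sconst s) = sconst s"
  and ysubst_yv [simp]: "ysubst \<sigma> (yv i) = \<sigma> i"
  by (simp_all add: ysubst_eq yhom_sconst yhom_yv sym_hom_sconst)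

lemma vpleth_yhom:
  assumes "F \<in> yp"
  shows "vpleth A F = yhom (\<lambda>n. power_subst n A) yv F"
  unfolding vpleth_def yhom_def pleth_eq
  using assms
  by (intro sum.cong refl arg_cong2[of _ _ _ _ "(*)"])
     (auto simp: PV_def single_eq_prod_yv[of _ 1])

lemma is_hom_vpleth:
  assumes "\<And>n. power_subst n A \<in> yp"
  shows "is_hom (vpleth A)"
  using is_hom_yhom[of "\<lambda>n. power_subst n A" yv] assms
  by (auto simp: is_hom_def vpleth_yhom)

lemma vpleth_psym: "n \<ge> 1 \<Longrightarrow> vpleth A (sconst (psym n)) = power_subst n A"
  and vpleth_yv: "vpleth A (yv i) = yv i"
  by (simp_all add: vpleth_yhom yhom_sconst yhom_yv sym_hom_psym)

section \<open>Coefficient functionals\<close>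

text \<open>
  \<open>kap j S F\<close> is the coefficient of \<open>1/y\<^sub>j\<close> in \<open>F\<close> times the series \<open>S\<close> evaluated at \<open>1/y\<^sub>j\<close>, the
  coefficients of \<open>S\<close> being regarded as constants even if they involve \<open>y\<^sub>j\<close>.
\<close>

definition kap :: "nat \<Rightarrow> yring fps \<Rightarrow> yring \<Rightarrow> yring" where
  "kap j S F = (\<Sum>m\<in>keys F. single (Poly_Mapping.update j 0 m) (lookup F m) *
     fps_nth S (Suc (nat (lookup m j))))"

lemma kap_superset: "finite A \<Longrightarrow> keys F \<subseteq> A \<Longrightarrow>
    kap j S F = (\<Sum>m\<in>A. single (Poly_Mapping.update j 0 m) (lookup F m) *
     fps_nth S (Suc (nat (lookup m j))))"
  unfolding kap_def by (rule sum.mono_neutral_left) (auto simp: in_keys_iff)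

lemma kap_add: "kap j S (F + G) = kap j S F + kap j S G"
proof -
  let ?S = "keys F \<union> keys G"
  have "keys (F + G) \<subseteq> ?S" by (rule keys_add)
  then show ?thesis
    by (simp add: kap_superset[of ?S] lookup_add single_add distrib_right sum.distrib)
qed

lemma kap_0 [simp]: "kap j S 0 = 0" by (simp add: kap_def)

lemma kap_uminus: "kap j S (- F) = - kap j S F"
  using kap_add[of j S F "- F"] by (simp add: eq_neg_iff_add_eq_0 add.commute)

lemma kap_diff: "kap j S (F - G) = kap j S F - kap j S G"
  using kap_add[of j S F "- G"] by (simp add: kap_uminus)

lemma kap_single: "kap j S (single m c) =
    single (Poly_Mapping.update j 0 m) c * fps_nth S (Suc (nat (lookup m j)))"
  by (subst kap_superset[of "{m}"]) auto

lemma kap_mult_free: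
  assumes "G \<in> PV I" "j \<notin> I"
  shows "kap j S (G * F) = G * kap j S F"
  using assms(1)
proof (induction G rule: PV_single_induct)
  case (single m c)
  then have m: "lookup m j = 0" using assms(2) by blast
  show ?case
  proof (induction F rule: poly_mapping_induct)
    case (single n d)
    have "Poly_Mapping.update j 0 (m + n) = m + Poly_Mapping.update j 0 n"
      by (rule poly_mapping_eqI) (auto simp: lookup_update lookup_add m)
    then show ?case by (simp add: mult_single kap_single lookup_add m flip: mult.assoc)
  qed (simp_all add: kap_add distrib_left)
qed (simp_all add: kap_add distrib_right)

lemma kap_power: "kap j S (yv j ^ n) = fps_nth S (Suc n)"
proof -
  have "Poly_Mapping.update j 0 (single j (int n)) = 0"
    by (rule poly_mapping_eqI) (simp add: lookup_update lookup_single when_def)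
  then show ?thesis by (simp add: yv_power kap_single)
qed

lemma kap_mult_power: "G \<in> PV I \<Longrightarrow> j \<notin> I \<Longrightarrow> kap j S (G * yv j ^ n) = G * fps_nth S (Suc n)"
  by (simp add: kap_mult_free kap_power)

lemma kap_const: "G \<in> PV I \<Longrightarrow> j \<notin> I \<Longrightarrow> kap j S G = G * fps_nth S 1"
  using kap_mult_power[of G I j S 0] by simp

lemma PV_slice_induct [consumes 1, case_names monom add]:
  assumes "F \<in> PV I" "\<And>G n. G \<in> PV (I - {j}) \<Longrightarrow> j \<in> I \<or> n = 0 \<Longrightarrow> P (G * yv j ^ n)"
    "\<And>F G. F \<in> PV I \<Longrightarrow> G \<in> PV I \<Longrightarrow> P F \<Longrightarrow> P G \<Longrightarrow> P (F + G)"
  shows "P F"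
  using assms(1)
proof (induction F rule: PV_single_induct)
  case zero
  show ?case using assms(2)[of 0 0] by simp
next
  case (single m c)
  let ?G = "single (Poly_Mapping.update j 0 m) c"
  have "Poly_Mapping.update j 0 m + single j (lookup m j) = m"
    by (rule poly_mapping_eqI) (simp add: lookup_update lookup_add lookup_single when_def)
  then have "single m c = ?G * yv j ^ nat (lookup m j)"
    using single by (simp add: yv_power mult_single)
  moreover have "?G \<in> PV (I - {j})" using single by (intro PV_single) (auto simp: lookup_update split: if_splits)
  moreover have "j \<in> I \<or> nat (lookup m j) = 0" using single(2)[of j] by auto
  ultimately show ?case using assms(2) by metis
qed (auto intro: assms)

lemma kap_into:
  assumes "F \<in> PV I" "I - {j} \<subseteq> J" "\<And>n. n \<ge> 1 \<Longrightarrow> fps_nth S n \<in> PV J"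
  shows "kap j S F \<in> PV J"
  using assms(1)
proof (induction F rule: PV_slice_induct[where j = j])
  case (monom G n)
  then show ?case using assms by (auto simp: kap_mult_power[of G "I - {j}"] intro: PV_mono)
qed (auto simp: kap_add)

lemma kap_shift:
  assumes "F \<in> yp"
  shows "kap j S (yv j * F) = kap j (fps_shift 1 S) F"
  using assms
proof (induction F rule: PV_slice_induct[where j = j])
  case (monom G n)
  have "yv j * (G * yv j ^ n) = G * yv j ^ Suc n" by (simp add: ac_simps)
  moreover have "kap j T (G * yv j ^ k) = G * fps_nth T (Suc k)" for T k
    using monom by (intro kap_mult_power) auto
  ultimately show ?case by (simp del: power_Suc)
qed (simp_all add: kap_add distrib_left)

lemma kap_series_add: "kap j (S + T) F = kap j S F + kap j T F"
  by (simp add: kap_def distrib_left sum.distrib)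

lemma kap_series_diff: "kap j (S - T) F = kap j S F - kap j T F"
  by (simp add: kap_def right_diff_distrib sum_subtractf)

lemma kap_series_const: "kap j (fps_const c * S) F = c * kap j S F"
  by (simp add: kap_def sum_distrib_left ac_simps)

text \<open>Multiplication by \<open>1 - c X\<close> is multiplication by \<open>y\<^sub>j - c\<close>, up to a shift.\<close>

lemma kap_linear_factor:
  assumes eq: "T * (1 - fps_const c * fps_X) = S * (1 - fps_const d * fps_X)"
    and "c \<in> PV I" "d \<in> PV I" "j \<notin> I" "F \<in> yp"
  shows "kap j T ((yv j - c) * F) = kap j S ((yv j - d) * F)"
proof -
  have nth: "fps_nth (T * (1 - fps_const c * fps_X)) (Suc n) = fps_nth T (Suc n) - c * fps_nth T n"
    for T :: "yring fps" and c n
  proof -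
    have "T * (1 - fps_const c * fps_X) = T - fps_const c * (fps_X * T)" by (simp add: algebra_simps)
    then show ?thesis by simp
  qed
  have kap: "kap j T ((yv j - c) * F) = kap j (fps_shift 1 (T * (1 - fps_const c * fps_X))) F"
    if "c \<in> PV I" for T c
  proof -
    have "kap j T ((yv j - c) * F) = kap j (fps_shift 1 T - fps_const c * T) F"
      using that assms(4,5)
      by (simp add: left_diff_distrib kap_diff kap_shift kap_series_diff kap_series_const kap_mult_free[of c I])
    also have "\<dots> = kap j (fps_shift 1 (T * (1 - fps_const c * fps_X))) F"
      unfolding kap_def by (simp add: nth)
    finally show ?thesis .
  qed
  show ?thesis using assms by (simp add: kap)
qed

definition fmap :: "(yring \<Rightarrow> yring) \<Rightarrow> yring fps \<Rightarrow> yring fps" where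
  "fmap \<theta> S = Abs_fps (\<lambda>n. \<theta> (fps_nth S n))"

lemma fmap_nth [simp]: "fps_nth (fmap \<theta> S) n = \<theta> (fps_nth S n)"
  by (simp add: fmap_def)

text \<open>
  Since \<open>y\<^sub>j\<close> is eliminated on the left, the homomorphism \<open>\<eta>\<close> inside the functional may treat it
  differently from \<open>\<theta>\<close>; this renames the bound variable.
\<close>

lemma is_hom_kap:
  assumes hom: "is_hom \<theta>" "is_hom \<eta>" and F: "F \<in> PV I" and S: "\<And>n. fps_nth S n \<in> yp"
    and agree: "\<And>G. G \<in> PV (I - {j}) \<Longrightarrow> \<theta> G = \<eta> G"
    and free: "\<And>G. G \<in> PV (I - {j}) \<Longrightarrow> \<eta> G \<in> PV J" "l \<notin> J" and yv: "j \<in> I \<Longrightarrow> \<eta> (yv j) = yv l"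
  shows "\<theta> (kap j S F) = kap l (fmap \<theta> S) (\<eta> F)"
  using F
proof (induction F rule: PV_slice_induct[where j = j])
  case (monom G n)
  have G: "G \<in> yp" using monom by (auto intro: PV_yp)
  have pow: "\<eta> (yv j ^ n) = yv l ^ n"
    using monom(2) yv by (auto simp: is_hom_power[OF hom(2)] is_hom_1[OF hom(2)])
  have "\<theta> (kap j S (G * yv j ^ n)) = \<theta> G * \<theta> (fps_nth S (Suc n))"
    using monom G S by (simp add: kap_mult_power[of G "I - {j}"] is_hom_mult[OF hom(1)])
  also have "\<dots> = kap l (fmap \<theta> S) (\<eta> G * yv l ^ n)"
    using free monom(1) agree by (simp add: kap_mult_power[of "\<eta> G" J])
  also have "\<eta> G * yv l ^ n = \<eta> (G * yv j ^ n)"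
    using G pow by (simp add: is_hom_mult[OF hom(2)])
  finally show ?case .
next
  case (add F G)
  have "kap j S F \<in> yp" "kap j S G \<in> yp"
    using add(1,2)[THEN PV_yp] S by (auto intro!: kap_into)
  then show ?case
    using add by (simp add: kap_add is_hom_add[OF hom(1)] is_hom_add[OF hom(2)] PV_yp)
qed

section \<open>Complete symmetric functions under plethysm\<close>

lemma PV_of_nat [simp]: "of_nat n \<in> PV I"
  by (metis PV_kconst kconst_of_nat)

lemma xdeg_eq_0_iff: "xdeg m = 0 \<longleftrightarrow> m = 0"
proof
  assume "xdeg m = 0"
  then have "lookup m i = 0" for i using lookup_le_xdeg[of m i] by simp
  then show "m = 0" by (intro poly_mapping_eqI) simp
qed (simp add: xdeg_def)

lemma hsym_0: "hsym 0 = 1"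
  by (rule sym_eqI) (simp add: hsym.rep_eq one_sym.rep_eq xdeg_eq_0_iff)

text \<open>At a monomial of degree n both sides count the pairs (i, j) with i between 1 and the
  exponent of x_j; their number is the sum of the exponents.\<close>

lemma newton_hsym: "of_nat n * hsym n = (\<Sum>i=1..n. psym i * hsym (n - i))"
proof (rule sym_eqI)
  fix m :: xmon
  let ?K = "\<lambda>i. {j\<in>keys m. i \<le> lookup m j}"
  have deg: "xdeg (m - single j i) = n - i \<longleftrightarrow> xdeg m = n"
    if "i \<le> n" "i \<le> lookup m j" for i j
  proof -
    have "xdeg m = i + xdeg (m - single j i)"
      using xdeg_add[of "single j i" "m - single j i"] that(2)
      by (simp add: single_le_add_diff) (simp add: xdeg_def)
    then show ?thesis using that(1) by linarith
  qed
  have count: "(\<Sum>i=1..n. card (?K i)) = n" if "xdeg m = n"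
  proof -
    have "(\<Sum>i=1..n. card (?K i)) = (\<Sum>i=1..n. \<Sum>j\<in>keys m. if i \<le> lookup m j then 1 else 0)"
      by (simp add: sum.If_cases Int_def)
    also have "\<dots> = (\<Sum>j\<in>keys m. \<Sum>i=1..n. if i \<le> lookup m j then 1 else 0)" by (rule sum.swap)
    also have "\<dots> = (\<Sum>j\<in>keys m. lookup m j)"
    proof (rule sum.cong[OF refl])
      fix j
      have "{1..n} \<inter> {i. i \<le> lookup m j} = {1..lookup m j}"
        using that lookup_le_xdeg[of m j] by auto
      then show "(\<Sum>i=1..n. if i \<le> lookup m j then 1 else 0) = lookup m j"
        by (simp add: sum.If_cases)
    qed
    finally show ?thesis using that by (simp add: xdeg_def)
  qed
  have "sym_coeff (\<Sum>i=1..n. psym i * hsym (n - i)) m =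
      (\<Sum>i=1..n. \<Sum>j\<in>?K i. if xdeg (m - single j i) = n - i then 1 else 0)"
    by (simp add: sym_coeff_sum sym_coeff_psym_mult hsym.rep_eq)
  also have "\<dots> = (\<Sum>i=1..n. \<Sum>j\<in>?K i. if xdeg m = n then 1 else 0)"
    by (intro sum.cong refl if_cong deg) auto
  also have "\<dots> = of_nat (\<Sum>i=1..n. card (?K i)) * (if xdeg m = n then 1 else 0)"
    by simp
  also have "\<dots> = of_nat n * (if xdeg m = n then 1 else 0)"
    using count by (cases "xdeg m = n") (simp_all del: of_nat_sum)
  also have "\<dots> = sym_coeff (of_nat n * hsym n) m"
    by (simp add: sym_of_nat sym_coeff_const_mult hsym.rep_eq)
  finally show "sym_coeff (of_nat n * hsym n) m = sym_coeff (\<Sum>i=1..n. psym i * hsym (n - i)) m" ..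
qed

section \<open>Exponential series and their logarithmic derivatives\<close>

text \<open>M is X f' / f, written without division. It turns products into sums, which is how the
  multiplicativity of Exp is obtained.\<close>

definition log_deriv :: "yring fps \<Rightarrow> yring fps \<Rightarrow> bool" where
  "log_deriv f M \<longleftrightarrow> fps_nth f 0 = 1 \<and> fps_X * fps_deriv f = M * f"

lemma log_deriv_iff: "log_deriv f M \<longleftrightarrow> fps_nth f 0 = 1 \<and>
    (\<forall>n. of_nat n * fps_nth f n = (\<Sum>i=0..n. fps_nth M i * fps_nth f (n - i)))"
proof -
  have "fps_nth (fps_X * fps_deriv f) n = of_nat n * fps_nth f n" for n
    by (cases n) simp_all
  then show ?thesis by (simp add: log_deriv_def fps_eq_iff fps_mult_nth)
qed

text \<open>As M has no constant term, n times the n-th coefficient is determined by the earlier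
  coefficients, and n can be cancelled.\<close>

lemma log_deriv_unique:
  assumes "log_deriv f M" "log_deriv g M" "fps_nth M 0 = 0"
  shows "f = g"
proof (rule fps_ext)
  fix n show "fps_nth f n = fps_nth g n"
  proof (induction n rule: less_induct)
    case (less n)
    show ?case
    proof (cases "n = 0")
      case False
      have "fps_nth M i * fps_nth f (n - i) = fps_nth M i * fps_nth g (n - i)" if "i \<in> {0..n}" for i
        using less[of "n - i"] assms(3) False by (cases "i = 0") auto
      then have "of_nat n * fps_nth f n = of_nat n * fps_nth g n"
        using assms(1,2) by (simp add: log_deriv_iff)
      then show ?thesis using False yring_of_nat_cancel by blast
    qed (use assms in \<open>simp add: log_deriv_def\<close>)
  qed
qed

lemma log_deriv_mult:
  assumes "log_deriv f M" "log_deriv g N"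
  shows "log_deriv (f * g) (M + N)"
proof -
  have "fps_X * fps_deriv (f * g) = (fps_X * fps_deriv f) * g + f * (fps_X * fps_deriv g)"
    by (simp add: algebra_simps)
  also have "\<dots> = (M + N) * (f * g)" using assms by (simp add: log_deriv_def algebra_simps)
  finally show ?thesis using assms by (simp add: log_deriv_def)
qed

text \<open>In the series variable x, \<open>geo c\<close> is Exp[c x], its inverse
  \<open>lin c\<close> is Exp[-c x], and \<open>pow_series c\<close> is the logarithmic derivative
  of \<open>geo c\<close>.\<close>

definition geo :: "yring \<Rightarrow> yring fps" where
  "geo c = Abs_fps (\<lambda>n. c ^ n)"

definition lin :: "yring \<Rightarrow> yring fps" where
  "lin c = 1 - fps_const c * fps_X"

definition pow_series :: "yring \<Rightarrow> yring fps" where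
  "pow_series c = Abs_fps (\<lambda>n. if n = 0 then 0 else c ^ n)"

lemma lin_nth: "fps_nth (lin c) n = (if n = 0 then 1 else if n = 1 then - c else 0)"
  by (cases n) (simp_all add: lin_def)

lemma mult_lin_nth: "fps_nth (S * lin c) (Suc n) = fps_nth S (Suc n) - c * fps_nth S n"
proof -
  have "S * lin c = S - fps_const c * (fps_X * S)" by (simp add: lin_def algebra_simps)
  then show ?thesis by simp
qed

lemma geo_lin: "geo c * lin c = 1"
proof (rule fps_ext)
  fix n show "fps_nth (geo c * lin c) n = fps_nth 1 n"
    by (cases n) (simp_all add: mult_lin_nth lin_nth geo_def)
qed

lemma geo_0: "geo 0 = 1"
  using geo_lin[of 0] by (simp add: lin_def)

lemma lin_0: "lin 0 = 1"
  by (simp add: lin_def)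

lemma pow_series_eq: "pow_series c = fps_const c * fps_X * geo c"
proof (rule fps_ext)
  fix n show "fps_nth (pow_series c) n = fps_nth (fps_const c * fps_X * geo c) n"
    by (cases n) (simp_all add: pow_series_def geo_def mult.assoc)
qed

lemma log_deriv_lin: "log_deriv (lin c) (- pow_series c)"
proof -
  have "- pow_series c * lin c = - (fps_const c * fps_X * (geo c * lin c))"
    by (simp add: pow_series_eq mult.assoc)
  also have "\<dots> = fps_X * fps_deriv (lin c)"
    by (simp add: geo_lin) (simp add: lin_def mult.commute flip: fps_const_neg)
  finally show ?thesis by (simp add: log_deriv_def lin_nth)
qed

lemma log_deriv_geo: "log_deriv (geo c) (pow_series c)"
  unfolding log_deriv_iff
proof (intro conjI allI)
  fix n
  have "(\<Sum>i=0..n. fps_nth (pow_series c) i * fps_nth (geo c) (n - i)) =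
      (\<Sum>i\<in>{1..n}. c ^ n)"
    by (intro sum.mono_neutral_cong_right) (auto simp: pow_series_def geo_def simp flip: power_add)
  then show "of_nat n * fps_nth (geo c) n =
      (\<Sum>i=0..n. fps_nth (pow_series c) i * fps_nth (geo c) (n - i))"
    by (simp add: geo_def)
qed (simp add: geo_def)

lemma sum_from_0: "fps_nth M 0 = 0 \<Longrightarrow>
    (\<Sum>i=0..n. fps_nth M i * f (n - i)) = (\<Sum>i=1..n. fps_nth M i * (f (n - i) :: yring))"
  by (rule sum.mono_neutral_right) (auto simp: Suc_le_eq)

lemma log_deriv_hsym:
  "log_deriv (Abs_fps (\<lambda>n. sym_hom b (hsym n))) (Abs_fps (\<lambda>n. if n = 0 then 0 else b n))"
proof -
  have "of_nat n * sym_hom b (hsym n) = (\<Sum>i=1..n. b i * sym_hom b (hsym (n - i)))" for n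
  proof -
    have sum: "sym_hom b (sum f S) = (\<Sum>i\<in>S. sym_hom b (f i))" for f and S :: "nat set"
      by (induction S rule: infinite_finite_induct) (auto simp: sym_hom_add)
    have "of_nat n * sym_hom b (hsym n) = sym_hom b (of_nat n * hsym n)"
      by (simp add: sym_of_nat sym_hom_mult sym_hom_const kconst_of_nat)
    then show ?thesis
      by (simp add: newton_hsym sum sym_hom_mult sym_hom_psym)
  qed
  then show ?thesis
    unfolding log_deriv_iff by (subst sum_from_0) (auto simp: hsym_0)
qed

text \<open>The series \<open>Exp[- x X]\<close> in \<open>x\<close>.\<close>

definition Aser :: "yring fps" where
  "Aser = Abs_fps (\<lambda>n. sym_hom (\<lambda>n. - sconst (psym n)) (hsym n))"

definition psum_series :: "yring fps" where
  "psum_series = Abs_fps (\<lambda>n. if n = 0 then 0 else sconst (psym n))"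

lemma log_deriv_Aser: "log_deriv Aser (- psum_series)"
proof -
  have "Abs_fps (\<lambda>n. if n = 0 then 0 else - sconst (psym n)) = - psum_series"
    by (rule fps_ext) (simp add: psum_series_def)
  then show ?thesis
    using log_deriv_hsym[of "\<lambda>n. - sconst (psym n)"] by (simp add: Aser_def)
qed

lemma Aser_PV [simp]: "fps_nth Aser n \<in> PV I"
  unfolding Aser_def by (auto intro!: sym_hom_yp)

lemma Aser_0: "fps_nth Aser 0 = 1"
  by (simp add: Aser_def hsym_0)

text \<open>Homogeneity of h_n: scaling each p_n by the n-th power of u scales h_n in the same way.
  Comparing logarithmic derivatives gives this without using the grading.\<close>

lemma sym_hom_yinv_hsym:
  "pleth (- (Pyinv k * PX)) (hsym n) = yinv k ^ n * fps_nth Aser n"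
proof -
  let ?b = "\<lambda>n. - (yinv k ^ n * sconst (psym n))"
  let ?B = "Abs_fps (\<lambda>n. yinv k ^ n * fps_nth Aser n)"
  let ?M = "Abs_fps (\<lambda>n. if n = 0 then 0 else ?b n)"
  have eq: "pleth (- (Pyinv k * PX)) = sym_hom ?b"
    by (simp add: pleth_eq uminus_expr_def times_expr_def)
  have ser: "Abs_fps (\<lambda>n. sym_hom ?b (hsym n)) = ?B"
  proof (rule log_deriv_unique[OF log_deriv_hsym])
    show "log_deriv ?B ?M"
      unfolding log_deriv_iff
    proof (intro conjI allI)
      fix n
      have "of_nat n * (yinv k ^ n * fps_nth Aser n) = yinv k ^ n * (of_nat n * fps_nth Aser n)"
        by (simp only: ac_simps)
      also have "\<dots> = yinv k ^ n * (\<Sum>i=1..n. - sconst (psym i) * fps_nth Aser (n - i))"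
        using log_deriv_Aser unfolding log_deriv_iff
        by (subst (asm) sum_from_0) (auto simp: psum_series_def intro!: sum.cong)
      also have "\<dots> = (\<Sum>i=1..n. ?b i * (yinv k ^ (n - i) * fps_nth Aser (n - i)))"
      proof -
        have "yinv k ^ n = yinv k ^ i * yinv k ^ (n - i)" if "i \<le> n" for i
          using that by (simp flip: power_add)
        then show ?thesis by (auto simp: sum_distrib_left intro!: sum.cong)
      qed
      finally show "of_nat n * fps_nth ?B n = (\<Sum>i=0..n. fps_nth ?M i * fps_nth ?B (n - i))"
        by (subst sum_from_0) auto
    qed (simp add: Aser_0)
  qed simp
  have "pleth (- (Pyinv k * PX)) (hsym n) = fps_nth (Abs_fps (\<lambda>n. sym_hom ?b (hsym n))) n"
    by (simp only: eq fps_nth_Abs_fps)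
  also have "\<dots> = yinv k ^ n * fps_nth Aser n" by (simp only: ser fps_nth_Abs_fps)
  finally show ?thesis .
qed

abbreviation "qk \<equiv> kconst qv"

text \<open>The value of \<open>p\<^sub>n\<close> at \<open>(q - 1) u\<close>.\<close>

definition dq :: "nat \<Rightarrow> yring \<Rightarrow> yring" where
  "dq n u = (qk * u) ^ n - u ^ n"

lemma dq_PV [simp]: "u \<in> PV I \<Longrightarrow> dq n u \<in> PV I"
  by (simp add: dq_def)

lemma is_hom_dq: "is_hom \<theta> \<Longrightarrow> u \<in> yp \<Longrightarrow> \<theta> (dq n u) = dq n (\<theta> u)"
  by (simp add: dq_def is_hom_diff is_hom_power is_hom_mult is_hom_kconst)

lemmas is_hom_simps = is_hom_add is_hom_diff is_hom_mult is_hom_kconst is_hom_dq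

lemma dq_0: "n \<ge> 1 \<Longrightarrow> dq n 0 = 0"
  by (simp add: dq_def power_0_left)

text \<open>Adding (q - 1)(u - v) to X multiplies Exp[-x X] by (1 - q u x)(1 - v x) / ((1 - u x)(1 -
  q v x)). Both sides have the same logarithmic derivative, that of the left being the image of
  Newton's identities.\<close>

lemma fmap_Aser:
  assumes "is_hom \<theta>"
    and psym: "\<And>n. n \<ge> 1 \<Longrightarrow> \<theta> (sconst (psym n)) = sconst (psym n) + dq n u - dq n v"
  shows "fmap \<theta> Aser = Aser * lin (qk * u) * geo u * lin v * geo (qk * v)"
proof (rule log_deriv_unique)
  let ?M = "- psum_series - pow_series (qk * u) + pow_series u
      - pow_series v + pow_series (qk * v)"
  show "log_deriv (fmap \<theta> Aser) ?M"
    unfolding log_deriv_iff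
  proof (intro conjI allI)
    fix n
    have "of_nat n * fps_nth Aser n = (\<Sum>i=1..n. - sconst (psym i) * fps_nth Aser (n - i))"
      using log_deriv_Aser unfolding log_deriv_iff
      by (subst (asm) sum_from_0) (auto simp: psum_series_def intro!: sum.cong)
    then have "\<theta> (of_nat n * fps_nth Aser n) =
        \<theta> (\<Sum>i=1..n. - sconst (psym i) * fps_nth Aser (n - i))" by simp
    moreover have "\<theta> (of_nat n * fps_nth Aser n) = of_nat n * \<theta> (fps_nth Aser n)"
      using assms(1) by (simp add: is_hom_mult is_hom_of_nat)
    moreover have "\<theta> (\<Sum>i=1..n. - sconst (psym i) * fps_nth Aser (n - i)) =
        (\<Sum>i=1..n. - \<theta> (sconst (psym i)) * \<theta> (fps_nth Aser (n - i)))"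
      using assms(1) by (subst is_hom_sum) (auto simp: is_hom_mult is_hom_uminus)
    ultimately have "of_nat n * \<theta> (fps_nth Aser n) =
        (\<Sum>i=1..n. - \<theta> (sconst (psym i)) * \<theta> (fps_nth Aser (n - i)))" by simp
    also have "\<dots> = (\<Sum>i=1..n. fps_nth ?M i * \<theta> (fps_nth Aser (n - i)))"
      by (intro sum.cong refl arg_cong2[of _ _ _ _ "(*)"])
         (simp add: psym psum_series_def pow_series_def dq_def)
    finally show "of_nat n * fps_nth (fmap \<theta> Aser) n =
        (\<Sum>i=0..n. fps_nth ?M i * fps_nth (fmap \<theta> Aser) (n - i))"
      by (subst sum_from_0) (simp_all add: psum_series_def pow_series_def)
  qed (simp add: Aser_0 is_hom_1 assms(1))
  have "log_deriv (Aser * lin (qk * u) * geo u * lin v * geo (qk * v))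
    (- psum_series + - pow_series (qk * u) + pow_series u
      + - pow_series v + pow_series (qk * v))"
    by (intro log_deriv_mult log_deriv_Aser log_deriv_lin log_deriv_geo)
  then show "log_deriv (Aser * lin (qk * u) * geo u * lin v * geo (qk * v)) ?M"
    by simp
  show "fps_nth ?M 0 = 0" by (simp add: psum_series_def pow_series_def)
qed

lemmas fmap_Aser_plus = fmap_Aser[where v = 0, simplified dq_0 mult_zero_right lin_0 geo_0 diff_zero mult_1_right]
lemmas fmap_Aser_minus = fmap_Aser[where u = 0, simplified dq_0 mult_zero_right lin_0 geo_0 add_0_right mult_1_right]

section \<open>The operators as homomorphisms and coefficient functionals\<close>

abbreviation taup :: "nat \<Rightarrow> yring \<Rightarrow> yring" where
  "taup j \<equiv> vpleth (PX + (Pq - 1) * Py j)"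

abbreviation taum :: "nat \<Rightarrow> yring \<Rightarrow> yring" where
  "taum j \<equiv> vpleth (PX - (Pq - 1) * Py j)"

lemma power_subst_taup: "power_subst n (PX + (Pq - 1) * Py j) = sconst (psym n) + dq n (yv j)"
  and power_subst_taum: "power_subst n (PX - (Pq - 1) * Py j) = sconst (psym n) - dq n (yv j)"
  by (simp_all add: plus_expr_def minus_expr_def times_expr_def one_expr_def dq_def
      kconst_power power_mult_distrib left_diff_distrib)

lemma is_hom_taup: "is_hom (taup j)" and is_hom_taum: "is_hom (taum j)"
  by (intro is_hom_vpleth, simp add: power_subst_taup power_subst_taum)+

lemma taup_psym: "n \<ge> 1 \<Longrightarrow> taup j (sconst (psym n)) = sconst (psym n) + dq n (yv j)"
  and taum_psym: "n \<ge> 1 \<Longrightarrow> taum j (sconst (psym n)) = sconst (psym n) - dq n (yv j)"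
  by (simp_all add: vpleth_psym power_subst_taup power_subst_taum)

abbreviation ty1 :: yring where "ty1 \<equiv> kconst tv * yv 1"

lemma is_hom_gamma: "is_hom (gamma_op k)"
  unfolding gamma_op_def by (rule is_hom_ysubst) simp

lemma gamma_psym: "gamma_op k (sconst s) = sconst s"
  and gamma_yv: "gamma_op k (yv i) = (if i = k + 1 then ty1 else yv (i + 1))"
  by (simp_all add: gamma_op_def)

lemma is_hom_dplus_star: "is_hom (dplus_star k)"
  using is_hom_comp[OF is_hom_gamma[of k] is_hom_taup[of "k + 1"]]
  by (simp add: dplus_star_def[abs_def])

lemma dplus_star_psym:
  "n \<ge> 1 \<Longrightarrow> dplus_star k (sconst (psym n)) = sconst (psym n) + dq n ty1"
  by (simp add: dplus_star_def taup_psym is_hom_simps[OF is_hom_gamma]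
      gamma_psym gamma_yv)

lemma dplus_star_yv: "i \<noteq> k + 1 \<Longrightarrow> dplus_star k (yv i) = yv (i + 1)"
  by (simp add: dplus_star_def vpleth_yv gamma_yv)

lemma dplus_star_PV:
  assumes "F \<in> PV {1..k}"
  shows "dplus_star k F \<in> PV {1..k + 1}"
  by (rule is_hom_into[OF is_hom_dplus_star assms]) (auto simp: dplus_star_psym dplus_star_yv)

lemma ycoeff_superset: "finite A \<Longrightarrow> keys F \<subseteq> A \<Longrightarrow> ycoeff k j F =
    (\<Sum>m\<in>A. if lookup m k = j then single (Poly_Mapping.update k 0 m) (lookup F m) else 0)"
  unfolding ycoeff_def by (rule sum.mono_neutral_cong_left) (auto simp: in_keys_iff)

lemma ycoeff_add: "ycoeff k j (F + G) = ycoeff k j F + ycoeff k j G"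
proof -
  let ?S = "keys F \<union> keys G"
  have "keys (F + G) \<subseteq> ?S" by (rule keys_add)
  then show ?thesis
    by (auto simp: ycoeff_superset[of ?S] lookup_add single_add simp flip: sum.distrib intro!: sum.cong)
qed

lemma ycoeff_monom:
  assumes "G \<in> PV I" "k \<notin> I"
  shows "ycoeff k j (G * single (single k i) 1) = (if i = j then G else 0)"
  using assms(1)
proof (induction G rule: PV_single_induct)
  case zero
  show ?case by (simp add: ycoeff_def)
next
  case (single m c)
  then have m: "lookup m k = 0" using assms(2) by blast
  have "Poly_Mapping.update k 0 (m + single k i) = m"
    by (rule poly_mapping_eqI) (auto simp: lookup_update lookup_add lookup_single when_def m)
  then show ?case
    by (subst ycoeff_superset[of "{m + single k i}"]) (auto simp: mult_single lookup_add m)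
qed (simp add: distrib_right ycoeff_add)

lemma yinv_power: "yinv i ^ n = single (single i (- int n)) 1"
  by (induction n) (auto simp: yinv_def mult_single simp flip: single_add)

text \<open>A term with exponent d of y_k meets only the summand n = d + 1 of the formal product, so
  the partial sums become stationary.\<close>

lemma sum_ycoeff_eq_kap:
  assumes "G \<in> yp"
  shows "\<exists>N. \<forall>M\<ge>N. (\<Sum>n<M. ycoeff k (-1) (G * (yinv k ^ n * fps_nth Aser n))) = kap k Aser G"
  using assms
proof (induction G rule: PV_slice_induct[where j = k])
  case (monom G d)
  have *: "ycoeff k (-1) (G * yv k ^ d * (yinv k ^ n * fps_nth Aser n)) =
      (if n = Suc d then G * fps_nth Aser (Suc d) else 0)" for n
  proof -
    have "G * yv k ^ d * (yinv k ^ n * fps_nth Aser n) =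
        G * fps_nth Aser n * (yv k ^ d * yinv k ^ n)" by (simp only: ac_simps)
    also have "\<dots> = G * fps_nth Aser n *
        single (single k (int d - int n)) 1"
      by (simp add: yv_power yinv_power mult_single flip: single_add)
    finally have eq: "G * yv k ^ d * (yinv k ^ n * fps_nth Aser n) = \<dots>" .
    have "G * fps_nth Aser n \<in> PV (UNIV - {k})" using monom by simp
    from ycoeff_monom[OF this] show ?thesis unfolding eq by auto
  qed
  have "kap k Aser (G * yv k ^ d) = G * fps_nth Aser (Suc d)"
    using monom by (intro kap_mult_power) auto
  then show ?case by (intro exI[of _ "d + 2"]) (simp add: *)
next
  case (add F G)
  then obtain M N where
    "\<forall>L\<ge>M. (\<Sum>n<L. ycoeff k (-1) (F * (yinv k ^ n * fps_nth Aser n))) = kap k Aser F"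
    "\<forall>L\<ge>N. (\<Sum>n<L. ycoeff k (-1) (G * (yinv k ^ n * fps_nth Aser n))) = kap k Aser G"
    by blast
  then show ?case
    by (intro exI[of _ "max M N"]) (simp add: distrib_right ycoeff_add sum.distrib kap_add)
qed

lemma dminus_eq:
  assumes "F \<in> yp"
  shows "dminus k F = - kap k Aser (taum k F)"
proof -
  let ?f = "\<lambda>n. ycoeff k (-1) (taum k F * (yinv k ^ n * fps_nth Aser n))"
  have "taum k F \<in> yp" using assms is_hom_taum is_hom_yp by blast
  then obtain N where N: "\<And>M. M \<ge> N \<Longrightarrow> (\<Sum>n<M. ?f n) = kap k Aser (taum k F)"
    using sum_ycoeff_eq_kap by blast
  \<comment> \<open>Two consecutive stationary partial sums differ by one term. Finiteness of the
    support is what makes the sum over all n meaningful.\<close>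
  have "?f n = 0" if "n \<ge> N" for n
    using N[of "Suc n"] N[of n] that by simp
  then have "{n. ?f n \<noteq> 0} \<subseteq> {..<N}" by (auto simp: not_less[symmetric])
  then have "(\<Sum>n. ?f n) = (\<Sum>n<N. ?f n)" by (intro Sum_any.expand_superset) auto
  then show ?thesis using N[of N] by (simp add: dminus_def sym_hom_yinv_hsym)
qed

lemma taum_PV: "F \<in> PV I \<Longrightarrow> j \<in> I \<Longrightarrow> taum j F \<in> PV I"
  and taup_PV: "F \<in> PV I \<Longrightarrow> j \<in> I \<Longrightarrow> taup j F \<in> PV I"
  by (erule is_hom_into[OF is_hom_taum] is_hom_into[OF is_hom_taup];
      simp add: taum_psym taup_psym vpleth_yv)+

lemma dminus_PV:
  assumes "F \<in> PV I" "k \<in> I"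
  shows "dminus k F \<in> PV (I - {k})"
  unfolding dminus_eq[OF PV_yp[OF assms(1)]]
  by (intro PV_uminus kap_into[OF taum_PV[OF assms]]) auto

section \<open>The commutator C as a coefficient functional\<close>

text \<open>The polynomial F(y_2, ..., y_k, w)[X + (q - 1)(t y_1 - w)] in the formula for C, with
  y_0 in the role of w.\<close>

definition Psi :: "nat \<Rightarrow> yring \<Rightarrow> yring" where
  "Psi k = yhom (\<lambda>n. sconst (psym n) + dq n ty1 - dq n (yv 0)) (\<lambda>i. if i = k then yv 0 else yv (i + 1))"

lemma is_hom_Psi: "is_hom (Psi k)"
  unfolding Psi_def by (rule is_hom_yhom) auto

lemma Psi_psym: "n \<ge> 1 \<Longrightarrow> Psi k (sconst (psym n)) = sconst (psym n) + dq n ty1 - dq n (yv 0)"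
  and Psi_yv: "Psi k (yv i) = (if i = k then yv 0 else yv (i + 1))"
  by (simp_all add: Psi_def yhom_sconst sym_hom_psym yhom_yv)

lemmas hom_gens = dplus_star_psym dplus_star_yv taup_psym taum_psym vpleth_yv Psi_psym Psi_yv

text \<open>The series in \<open>1/w\<close> of \<open>Exp[-X/w] a / (w - a)\<close>.\<close>

definition Sser :: "yring \<Rightarrow> yring fps" where
  "Sser a = fps_const a * fps_X * geo a * Aser"

definition Cst :: "nat \<Rightarrow> yring \<Rightarrow> yring" where
  "Cst k F = dplus_star (k - 1) (dminus k F) - dminus (k + 1) (dplus_star k F)"

text \<open>After renaming the bound variable, both terms of C extract a coefficient from the same
  polynomial \<open>Psi k F\<close>. Only the series differ: d_+^* applied outside multiplies
  Exp[-X/w] by (w - q t y_1) / (w - t y_1), and subtracting leaves the factor (q - 1) t y_1 / (w - t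
  y_1).\<close>

lemma Cst_eq:
  assumes k: "1 \<le> k" and F: "F \<in> PV {1..k}"
  shows "Cst k F = kconst (qv - 1) * kap 0 (Sser ty1) (Psi k F)"
proof -
  \<comment> \<open>\<open>dplus_star (k - 1)\<close> would send the bound variable y_k to t y_1;
    \<open>\<eta>\<close> agrees with it on the remaining variables but renames y_k to y_0.
    Similarly \<open>\<rho>\<close> renames the bound y_{k+1} of the other term.\<close>
  define \<eta> where "\<eta> = yhom (\<lambda>n. sconst (psym n) + dq n ty1) (\<lambda>i. if i = k then yv 0 else yv (i + 1))"
  define \<rho> where "\<rho> = ysubst (\<lambda>i. if i = k + 1 then yv 0 else yv i)"
  have \<eta>: "is_hom \<eta>" unfolding \<eta>_def by (rule is_hom_yhom) auto
  have \<eta>p: "\<eta> (sconst (psym n)) = sconst (psym n) + dq n ty1" if "n \<ge> 1" for n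
    using that by (simp add: \<eta>_def yhom_sconst sym_hom_psym)
  have \<eta>y: "\<eta> (yv i) = (if i = k then yv 0 else yv (i + 1))" for i
    by (simp add: \<eta>_def yhom_yv)
  have \<rho>p: "\<rho> (sconst s) = sconst s" and \<rho>y: "\<rho> (yv i) = (if i = k + 1 then yv 0 else yv i)" for s i
    by (simp_all add: \<rho>_def)
  have \<rho>: "is_hom \<rho>" unfolding \<rho>_def by (rule is_hom_ysubst) auto
  have tF: "taum k F \<in> PV {1..k}" using k F by (intro taum_PV) auto
  have agree: "dplus_star (k - 1) G = \<eta> G" if "G \<in> PV ({1..k} - {k})" for G
    by (rule is_hom_eqI[OF is_hom_dplus_star \<eta> that])
       (use k in \<open>auto simp: dplus_star_psym dplus_star_yv \<eta>p \<eta>y\<close>)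
  have free: "\<eta> G \<in> PV (UNIV - {0})" if "G \<in> PV ({1..k} - {k})" for G
    by (rule is_hom_into[OF \<eta> that]) (auto simp: \<eta>p \<eta>y)
  have "dplus_star (k - 1) (kap k Aser (taum k F)) =
      kap 0 (fmap (dplus_star (k - 1)) Aser) (\<eta> (taum k F))"
    by (rule is_hom_kap[OF is_hom_dplus_star \<eta> tF _ agree free]) (auto simp: \<eta>y)
  also have "fmap (dplus_star (k - 1)) Aser = Aser * lin (qk * ty1) * geo ty1"
    by (rule fmap_Aser_plus[OF is_hom_dplus_star]) (auto simp: dplus_star_psym)
  also have "\<eta> (taum k F) = Psi k F"
    by (rule is_hom_eqI[OF is_hom_comp[OF \<eta> is_hom_taum] is_hom_Psi F])
       (auto simp: taum_psym vpleth_yv \<eta>p \<eta>y Psi_psym Psi_yv is_hom_simps[OF \<eta>])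
  finally have 1: "dplus_star (k - 1) (kap k Aser (taum k F)) =
      kap 0 (Aser * lin (qk * ty1) * geo ty1) (Psi k F)" .
  have dF: "taum (k + 1) (dplus_star k F) \<in> PV {1..k + 1}"
    by (intro taum_PV dplus_star_PV F) auto
  have agree: "G = \<rho> G" if "G \<in> PV ({1..k + 1} - {k + 1})" for G
    by (rule is_hom_eqI[OF is_hom_id \<rho> that]) (auto simp: \<rho>p \<rho>y)
  have free: "\<rho> G \<in> PV (UNIV - {0})" if "G \<in> PV ({1..k + 1} - {k + 1})" for G
    by (rule is_hom_into[OF \<rho> that]) (auto simp: \<rho>p \<rho>y)
  have "kap (k + 1) Aser (taum (k + 1) (dplus_star k F)) =
      kap 0 (fmap (\<lambda>F. F) Aser) (\<rho> (taum (k + 1) (dplus_star k F)))"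
    by (rule is_hom_kap[OF is_hom_id \<rho> dF _ agree free]) (auto simp: \<rho>y)
  also have "fmap (\<lambda>F. F) Aser = Aser" by (rule fps_ext) simp
  also have "\<rho> (taum (k + 1) (dplus_star k F)) = Psi k F"
    by (rule is_hom_eqI[OF is_hom_comp[OF \<rho> is_hom_comp[OF is_hom_taum is_hom_dplus_star]] is_hom_Psi F])
       (use k in \<open>auto simp: dplus_star_psym dplus_star_yv taum_psym vpleth_yv \<rho>p \<rho>y Psi_psym Psi_yv
         is_hom_simps[OF \<rho>] is_hom_simps[OF is_hom_taum] is_hom_mult[OF \<rho>]
         is_hom_kconst[OF is_hom_taum] is_hom_kconst[OF \<rho>]\<close>)
  finally have 2: "kap (k + 1) Aser (taum (k + 1) (dplus_star k F)) = kap 0 Aser (Psi k F)" .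
  have "Aser = Aser * geo ty1 * lin ty1" by (simp add: mult.assoc geo_lin)
  then have "Aser - Aser * lin (qk * ty1) * geo ty1 =
      Aser * geo ty1 * (lin ty1 - lin (qk * ty1))"
    by (simp only: right_diff_distrib) (simp only: ac_simps)
  also have "lin ty1 - lin (qk * ty1) = fps_const (kconst (qv - 1)) * (fps_const ty1 * fps_X)"
    by (rule fps_ext) (simp add: lin_def kconst_diff left_diff_distrib)
  finally have 3: "Aser - Aser * lin (qk * ty1) * geo ty1 =
      fps_const (kconst (qv - 1)) * Sser ty1"
    by (simp only: Sser_def ac_simps)
  have yp: "kap k Aser (taum k F) \<in> yp" by (rule kap_into[OF tF]) auto
  have "Cst k F = - dplus_star (k - 1) (kap k Aser (taum k F))
      + kap (k + 1) Aser (taum (k + 1) (dplus_star k F))"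
    using PV_yp[OF F] PV_yp[OF dplus_star_PV[OF F]] yp
    by (simp add: Cst_def dminus_eq is_hom_uminus[OF is_hom_dplus_star])
  also have "\<dots> = kap 0 (Aser - Aser * lin (qk * ty1) * geo ty1) (Psi k F)"
    unfolding 1 2 by (simp add: kap_series_diff)
  also have "\<dots> = kconst (qv - 1) * kap 0 (Sser ty1) (Psi k F)"
    unfolding 3 kap_series_const ..
  finally show ?thesis .
qed

section \<open>Demazure--Lusztig operators\<close>

lemma lookup_single_mult:
  fixes a m :: ymon and G :: yring
  shows "lookup (single a 1 * G) (a + m) = lookup G m"
proof (induction G rule: poly_mapping_induct)
  case (single p c)
  then show ?case by (simp add: mult_single lookup_single when_def)
qed (simp_all add: distrib_left lookup_add)

text \<open>If (y_j - y_i) H = 0, the coefficients of H do not change when one exponent unit moves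
  from y_i to y_j; a nonzero H would then have infinite support.\<close>

lemma yv_diff_cancel:
  assumes "i \<noteq> j" "(yv j - yv i) * F = (yv j - yv i) * G"
  shows "F = G"
proof (rule ccontr)
  assume "F \<noteq> G"
  define H where "H = F - G"
  let ?d = "single j 1 - single i 1 :: ymon"
  have eq: "yv j * H = yv i * H"
    using assms(2) by (simp add: H_def algebra_simps)
  have step: "lookup H (m + ?d) = lookup H m" for m
  proof -
    have "lookup H m = lookup (yv j * H) (single j 1 + m)"
      by (simp only: yv_def lookup_single_mult)
    also have "single j 1 + m = single i 1 + (m + ?d)" by simp
    also have "lookup (yv j * H) \<dots> = lookup H (m + ?d)"
      unfolding eq by (simp only: yv_def lookup_single_mult)
    finally show ?thesis by simp
  qed
  define f :: "nat \<Rightarrow> ymon" where "f n = single j (int n) - single i (int n)" for n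
  have f: "f 0 = 0" "f (Suc n) = f n + ?d" for n
    by (simp_all add: f_def algebra_simps flip: single_add)
  have inv: "lookup H (m + f n) = lookup H m" for m n
    by (induction n) (simp_all only: f add_0_right step add.assoc[symmetric])
  have "keys H \<noteq> {}" using \<open>F \<noteq> G\<close> by (simp add: H_def)
  then obtain m where m: "m \<in> keys H" by blast
  have "(\<lambda>n. m + f n) ` UNIV \<subseteq> keys H" using m inv by (auto simp: in_keys_iff)
  then have "finite ((\<lambda>n. m + f n) ` UNIV)" by (rule finite_subset) simp
  moreover have "inj (\<lambda>n. m + f n)"
  proof (rule injI)
    fix n n' assume "m + f n = m + f n'"
    then have "lookup (f n) j = lookup (f n') j" by simp
    then show "n = n'" using assms(1) by (simp add: f_def lookup_minus lookup_single when_def)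
  qed
  ultimately show False using finite_imageD infinite_UNIV_nat by blast
qed

lemma is_hom_s_op: "is_hom (s_op i)"
  unfolding s_op_def by (rule is_hom_ysubst) simp

lemma s_op_sconst: "s_op i (sconst s) = sconst s"
  and s_op_yv: "s_op i (yv j) = yv (if j = i then i + 1 else if j = i + 1 then i else j)"
  by (simp_all add: s_op_def)

lemmas s_op_gens = s_op_sconst s_op_yv

lemma s_op_PV:
  assumes "F \<in> PV I" "i \<in> I" "i + 1 \<in> I"
  shows "s_op i F \<in> PV I"
  by (rule is_hom_into[OF is_hom_s_op assms(1)]) (use assms in \<open>auto simp: s_op_gens\<close>)

lemma s_op_involution: "F \<in> yp \<Longrightarrow> s_op i (s_op i F) = F"
  by (rule is_hom_eqI[OF is_hom_comp[OF is_hom_s_op is_hom_s_op] is_hom_id])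
     (auto simp: s_op_gens)

text \<open>A divided difference. Its multiple by y_{i+1} - q y_i is T_i P - P, the divisibility
  that later cancels the denominators in two variables.\<close>

definition ddiff :: "nat \<Rightarrow> yring \<Rightarrow> yring" where
  "ddiff i P = (THE D. (yv (i + 1) - yv i) * D = s_op i P - P)"

lemma ddiff_exists:
  assumes "P \<in> PV I" "i \<in> I" "i + 1 \<in> I"
  shows "\<exists>D\<in>PV I. (yv (i + 1) - yv i) * D = s_op i P - P"
  using assms(1)
proof (induction P rule: PV_induct)
  case (sconst s)
  show ?case by (rule bexI[of _ 0]) (simp_all add: s_op_sconst)
next
  case (yv j)
  show ?case
    by (rule bexI[of _ "if j = i then 1 else if j = i + 1 then - 1 else 0"]) (auto simp: s_op_yv)
next
  case (add F G)
  then obtain D E where "D \<in> PV I" "(yv (i + 1) - yv i) * D = s_op i F - F"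
    "E \<in> PV I" "(yv (i + 1) - yv i) * E = s_op i G - G" by blast
  then show ?case
    using add by (intro bexI[of _ "D + E"]) (simp_all add: distrib_left is_hom_add[OF is_hom_s_op] PV_yp)
next
  case (mult F G)
  then obtain D E where D: "D \<in> PV I" "(yv (i + 1) - yv i) * D = s_op i F - F"
    and E: "E \<in> PV I" "(yv (i + 1) - yv i) * E = s_op i G - G" by blast
  \<comment> \<open>The witness is the twisted Leibniz rule for divided differences.\<close>
  have "(yv (i + 1) - yv i) * (s_op i F * E + D * G) =
      s_op i F * ((yv (i + 1) - yv i) * E) + (yv (i + 1) - yv i) * D * G"
    by (simp only: distrib_left) (simp only: ac_simps)
  also have "\<dots> = s_op i (F * G) - F * G"
    unfolding D E is_hom_mult[OF is_hom_s_op PV_yp[OF mult(1)] PV_yp[OF mult(2)]]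
    by (simp add: algebra_simps)
  finally have "(yv (i + 1) - yv i) * (s_op i F * E + D * G) = s_op i (F * G) - F * G" .
  moreover have "s_op i F * E + D * G \<in> PV I"
    using mult(1,2) D(1) E(1) s_op_PV[OF mult(1) assms(2,3)] by (intro PV_add PV_mult)
  ultimately show ?case by blast
qed

lemma ddiff_eq:
  assumes "P \<in> yp"
  shows "(yv (i + 1) - yv i) * ddiff i P = s_op i P - P"
proof -
  obtain D where D: "(yv (i + 1) - yv i) * D = s_op i P - P"
    using ddiff_exists[OF assms] by blast
  show ?thesis
    unfolding ddiff_def by (rule theI[of _ D], rule D) (rule yv_diff_cancel[of i "i + 1"], simp, simp only: D)
qed

lemma ddiff_unique: "P \<in> yp \<Longrightarrow> (yv (i + 1) - yv i) * D = s_op i P - P \<Longrightarrow> ddiff i P = D"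
  by (rule yv_diff_cancel[of i "i + 1"]) (simp, simp only: ddiff_eq)

lemma ddiff_PV:
  assumes "P \<in> PV I" "i \<in> I" "i + 1 \<in> I"
  shows "ddiff i P \<in> PV I"
  using ddiff_exists[OF assms] ddiff_unique[OF PV_yp[OF assms(1)]] by blast

lemma T_op_unique:
  assumes "(yv (i + 1) - yv i) * G = kconst (qv - 1) * yv i * P + (yv (i + 1) - qk * yv i) * s_op i P"
  shows "T_op i P = G"
  unfolding T_op_def
  by (rule the_equality, rule assms) (rule yv_diff_cancel[of i "i + 1"], simp, simp only: assms)

lemma T_op_ddiff:
  assumes "P \<in> yp"
  shows "T_op i P = P + (yv (i + 1) - qk * yv i) * ddiff i P" (is "_ = ?G")
    and T_op_eq: "(yv (i + 1) - yv i) * T_op i P =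
      kconst (qv - 1) * yv i * P + (yv (i + 1) - qk * yv i) * s_op i P"
proof -
  have "(yv (i + 1) - yv i) * ?G =
      (yv (i + 1) - yv i) * P + (yv (i + 1) - qk * yv i) * ((yv (i + 1) - yv i) * ddiff i P)"
    by (simp only: distrib_left) (simp only: ac_simps)
  then have eq: "(yv (i + 1) - yv i) * ?G =
      kconst (qv - 1) * yv i * P + (yv (i + 1) - qk * yv i) * s_op i P"
    unfolding ddiff_eq[OF assms] by (simp add: kconst_diff algebra_simps)
  show T: "T_op i P = ?G" by (rule T_op_unique[OF eq])
  show "(yv (i + 1) - yv i) * T_op i P =
      kconst (qv - 1) * yv i * P + (yv (i + 1) - qk * yv i) * s_op i P"
    unfolding T by (rule eq)
qed

lemma T_op_PV:
  assumes "P \<in> PV I" "i \<in> I" "i + 1 \<in> I"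
  shows "T_op i P \<in> PV I"
  unfolding T_op_ddiff[OF PV_yp[OF assms(1)]]
  using assms by (intro PV_add PV_mult PV_diff PV_yv PV_kconst ddiff_PV) auto

lemma T_op_yp: "P \<in> yp \<Longrightarrow> T_op i P \<in> yp"
  by (simp add: T_op_PV)

lemma T_op_add:
  assumes "P \<in> yp" "Q \<in> yp"
  shows "T_op i (P + Q) = T_op i P + T_op i Q"
  by (rule T_op_unique)
     (simp only: distrib_left[of _ "T_op i P"] T_op_eq[OF assms(1)] T_op_eq[OF assms(2)]
       is_hom_add[OF is_hom_s_op assms], simp add: algebra_simps)

lemma T_op_mult:
  assumes "P \<in> yp" "G \<in> yp" "s_op i G = G"
  shows "T_op i (G * P) = G * T_op i P"
proof (rule T_op_unique)
  have "(yv (i + 1) - yv i) * (G * T_op i P) = G * ((yv (i + 1) - yv i) * T_op i P)"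
    by (simp only: ac_simps)
  then show "(yv (i + 1) - yv i) * (G * T_op i P) = kconst (qv - 1) * yv i * (G * P) +
      (yv (i + 1) - qk * yv i) * s_op i (G * P)"
    unfolding T_op_eq[OF assms(1)] is_hom_mult[OF is_hom_s_op assms(2,1)] assms(3)
    by (simp only: distrib_left ac_simps)
qed

lemma T_op_kconst: "P \<in> yp \<Longrightarrow> T_op i (kconst c * P) = kconst c * T_op i P"
  by (rule T_op_mult) (simp_all add: is_hom_kconst[OF is_hom_s_op])

lemma T_op_invariant: "s_op i P = P \<Longrightarrow> T_op i P = P"
  by (rule T_op_unique) (simp add: kconst_diff algebra_simps)

lemma is_hom_T_op:
  assumes \<theta>: "is_hom \<theta>" and P: "P \<in> yp" and yv: "\<theta> (yv i) = yv l" "\<theta> (yv (i + 1)) = yv (l + 1)"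
    and s: "\<theta> (s_op i P) = s_op l (\<theta> P)"
  shows "\<theta> (T_op i P) = T_op l (\<theta> P)"
proof (rule T_op_unique[symmetric])
  have sP: "s_op i P \<in> yp" by (rule is_hom_yp[OF is_hom_s_op P])
  have "(yv (l + 1) - yv l) * \<theta> (T_op i P) = \<theta> ((yv (i + 1) - yv i) * T_op i P)"
    by (subst is_hom_mult[OF \<theta>]) (simp_all only: T_op_yp[OF P] is_hom_diff[OF \<theta>] yv PV_yv UNIV_I PV_diff)
  also have "\<dots> = kconst (qv - 1) * yv l * \<theta> P + (yv (l + 1) - qk * yv l) * s_op l (\<theta> P)"
    unfolding T_op_eq[OF P]
    by (simp only: is_hom_simps[OF \<theta>] s
        yv P sP PV_yv UNIV_I PV_diff PV_mult PV_kconst)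
  finally show "(yv (l + 1) - yv l) * \<theta> (T_op i P) =
      kconst (qv - 1) * yv l * \<theta> P + (yv (l + 1) - qk * yv l) * s_op l (\<theta> P)" .
qed

lemma T_op_s_op:
  assumes "P \<in> yp" "i + 1 < j \<or> j + 1 < i"
  shows "s_op j (T_op i P) = T_op i (s_op j P)"
proof (rule is_hom_T_op[OF is_hom_s_op assms(1)])
  show "s_op j (s_op i P) = s_op i (s_op j P)"
    by (rule is_hom_eqI[OF is_hom_comp[OF is_hom_s_op is_hom_s_op] is_hom_comp[OF is_hom_s_op is_hom_s_op] assms(1)])
       (use assms(2) in \<open>auto simp: s_op_gens\<close>)
qed (use assms(2) in \<open>auto simp: s_op_yv\<close>)

text \<open>y_i and y_{i+1} are scalars for T_j, which also commutes with s_i; so T_j can be applied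
  to the equation that characterizes T_i P.\<close>

lemma T_op_commute:
  assumes P: "P \<in> yp" and ij: "i + 1 < j \<or> j + 1 < i"
  shows "T_op i (T_op j P) = T_op j (T_op i P)"
proof (rule T_op_unique)
  have inv: "s_op j (yv i) = yv i" "s_op j (yv (i + 1)) = yv (i + 1)"
    using ij by (auto simp: s_op_yv)
  note hom = is_hom_simps[OF is_hom_s_op] inv
  have sP: "s_op i P \<in> yp" by (rule is_hom_yp[OF is_hom_s_op P])
  have "(yv (i + 1) - yv i) * T_op j (T_op i P) = T_op j ((yv (i + 1) - yv i) * T_op i P)"
    by (rule T_op_mult[symmetric]) (simp_all only: T_op_yp[OF P] hom PV_yv UNIV_I PV_diff)
  also have "\<dots> = T_op j (kconst (qv - 1) * yv i * P) + T_op j ((yv (i + 1) - qk * yv i) * s_op i P)"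
    unfolding T_op_eq[OF P]
    by (rule T_op_add) (simp_all only: P sP PV_yv UNIV_I PV_diff PV_mult PV_kconst)
  also have "T_op j (kconst (qv - 1) * yv i * P) = kconst (qv - 1) * yv i * T_op j P"
    by (rule T_op_mult) (simp_all only: P hom PV_yv UNIV_I PV_mult PV_kconst)
  also have "T_op j ((yv (i + 1) - qk * yv i) * s_op i P) =
      (yv (i + 1) - qk * yv i) * T_op j (s_op i P)"
    by (rule T_op_mult) (simp_all only: sP hom PV_yv UNIV_I PV_mult PV_diff PV_kconst)
  also have "T_op j (s_op i P) = s_op i (T_op j P)"
    by (rule T_op_s_op[symmetric, OF P]) (use ij in auto)
  finally show "(yv (i + 1) - yv i) * T_op j (T_op i P) =
      kconst (qv - 1) * yv i * T_op j P + (yv (i + 1) - qk * yv i) * s_op i (T_op j P)" .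
qed

lemma s_op_T_op:
  assumes "P \<in> yp"
  shows "(yv i - yv (i + 1)) * s_op i (T_op i P) =
    kconst (qv - 1) * yv (i + 1) * s_op i P + (yv i - qk * yv (i + 1)) * P"
proof -
  note s = is_hom_s_op[of i]
  have sP: "s_op i P \<in> yp" by (rule is_hom_yp[OF s assms])
  have y: "s_op i (yv i) = yv (i + 1)" "s_op i (yv (i + 1)) = yv i" by (simp_all add: s_op_yv)
  have "(yv i - yv (i + 1)) * s_op i (T_op i P) = s_op i ((yv (i + 1) - yv i) * T_op i P)"
    by (subst is_hom_mult[OF s]) (simp_all only: T_op_yp[OF assms] is_hom_diff[OF s] y PV_yv UNIV_I PV_diff)
  also have "\<dots> = kconst (qv - 1) * yv (i + 1) * s_op i P + (yv i - qk * yv (i + 1)) * s_op i (s_op i P)"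
    unfolding T_op_eq[OF assms]
    by (simp only: is_hom_simps[OF s] y
        assms sP PV_yv UNIV_I PV_diff PV_mult PV_kconst)
  finally show ?thesis by (simp only: s_op_involution[OF assms])
qed

section \<open>The Hecke relations\<close>

text \<open>Here x, y are y_i, y_{i+1}, and Q, A, B, C are s P, T P, s (T P), T (T P). The factor y
  - x appears twice to clear the denominators of both applications of T.\<close>

lemma quadratic_identity:
  fixes x y q P Q A B C :: "'a::comm_ring_1"
  assumes "(y - x) * A = (q - 1) * x * P + (y - q * x) * Q"
    "(x - y) * B = (q - 1) * y * Q + (x - q * y) * P"
    "(y - x) * C = (q - 1) * x * A + (y - q * x) * B"
  shows "(y - x) * ((y - x) * C) = (y - x) * ((y - x) * (q * P - (q - 1) * A))"
proof -
  have "(y - x) * ((y - x) * C) = (q - 1) * x * ((y - x) * A) - (y - q * x) * ((x - y) * B)"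
    unfolding assms(3) by (simp add: algebra_simps)
  also have "\<dots> = (y - x) * (y - x) * q * P - (y - x) * (q - 1) * ((q - 1) * x * P + (y - q * x) * Q)"
    unfolding assms(1,2) by (simp add: algebra_simps)
  also have "\<dots> = (y - x) * ((y - x) * (q * P - (q - 1) * A))"
    unfolding assms(1)[symmetric] by (simp add: algebra_simps)
  finally show ?thesis .
qed

lemma T_op_quadratic:
  assumes "P \<in> yp"
  shows "T_op i (T_op i P) = qk * P - kconst (qv - 1) * T_op i P"
proof -
  have "(yv (i + 1) - yv i) * ((yv (i + 1) - yv i) * T_op i (T_op i P)) =
      (yv (i + 1) - yv i) * ((yv (i + 1) - yv i) * (qk * P - (qk - 1) * T_op i P))"
    by (rule quadratic_identity)
       (simp_all only: T_op_eq[OF assms] s_op_T_op[OF assms] T_op_eq[OF T_op_yp[OF assms]] kconst_diff kconst_1)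
  then have "(yv (i + 1) - yv i) * T_op i (T_op i P) =
      (yv (i + 1) - yv i) * (qk * P - (qk - 1) * T_op i P)"
    by (rule yv_diff_cancel[rotated]) simp
  then have "T_op i (T_op i P) = qk * P - (qk - 1) * T_op i P"
    by (rule yv_diff_cancel[rotated]) simp
  then show ?thesis by (simp only: kconst_diff kconst_1)
qed

text \<open>
  Both sides of the braid relation are expanded into the six permuted copies of \<open>P\<close>; \<open>Ps\<close>, \<open>Pts\<close>
  and so on stand for \<open>s P\<close>, \<open>t (s P)\<close> and so on.  The pairs \<open>(x1, y1)\<close>, \<open>(x2, y2)\<close>, \<open>(x3, y3)\<close> are
  \<open>(a, b)\<close>, \<open>(a, c)\<close>, \<open>(b, c)\<close> for one side and the same in reverse order for the other.
\<close>

lemma braid_identity: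
  fixes x1 y1 x2 y2 x3 y3 q P Ps Pt Pst Pts Psts A sA tA stA B sB C :: "'a::comm_ring_1"
  assumes A: "(y1 - x1) * A = (q - 1) * x1 * P + (y1 - q * x1) * Ps"
    "(x1 - y1) * sA = (q - 1) * y1 * Ps + (x1 - q * y1) * P"
    "(y2 - x2) * tA = (q - 1) * x2 * Pt + (y2 - q * x2) * Pts"
    "(y3 - x3) * stA = (q - 1) * x3 * Pst + (y3 - q * x3) * Psts"
    and B: "(y3 - x3) * B = (q - 1) * x3 * A + (y3 - q * x3) * tA"
    "(y2 - x2) * sB = (q - 1) * x2 * sA + (y2 - q * x2) * stA"
    and C: "(y1 - x1) * C = (q - 1) * x1 * B + (y1 - q * x1) * sB"
  shows "(y1 - x1) * ((y1 - x1) * ((y3 - x3) * ((y2 - x2) * C))) =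
    (q - 1) * x1 * ((y2 - x2) * (q - 1) * x3 * ((q - 1) * x1 * P + (y1 - q * x1) * Ps)
      + (y1 - x1) * (y3 - q * x3) * ((q - 1) * x2 * Pt + (y2 - q * x2) * Pts))
    + (y1 - q * x1) * ((x3 - y3) * (q - 1) * x2 * ((q - 1) * y1 * Ps + (x1 - q * y1) * P)
      + (y1 - x1) * (y2 - q * x2) * ((q - 1) * x3 * Pst + (y3 - q * x3) * Psts))"
proof -
  have "(y1 - x1) * ((y1 - x1) * ((y3 - x3) * ((y2 - x2) * C))) =
      (y1 - x1) * (y3 - x3) * (y2 - x2) * ((y1 - x1) * C)"
    by (simp only: ac_simps)
  also have "\<dots> = (q - 1) * x1 * ((y1 - x1) * (y2 - x2) * ((y3 - x3) * B))
      + (y1 - q * x1) * ((y1 - x1) * (y3 - x3) * ((y2 - x2) * sB))"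
    unfolding C by (simp only: distrib_left) (simp only: ac_simps)
  also have "(y1 - x1) * (y2 - x2) * ((y3 - x3) * B) =
      (y2 - x2) * (q - 1) * x3 * ((y1 - x1) * A) + (y1 - x1) * (y3 - q * x3) * ((y2 - x2) * tA)"
    unfolding B by (simp only: distrib_left) (simp only: ac_simps)
  also have "(y1 - x1) * (y3 - x3) * ((y2 - x2) * sB) =
      (x3 - y3) * (q - 1) * x2 * ((x1 - y1) * sA) + (y1 - x1) * (y2 - q * x2) * ((y3 - x3) * stA)"
    unfolding B by (simp add: algebra_simps)
  finally show ?thesis unfolding A .
qed

text \<open>The two instances of \<open>braid_identity\<close> clear (b - a)^2 (c - b)(c - a) and (c
  - b)^2 (b - a)(c - a); the outer factors c - b and b - a bring them to a common denominator. What
  remains is linear in the six copies of P.\<close>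

lemma braid_coefficients:
  fixes a b c q P Ps Pt Pst Pts Psts :: "'a::comm_ring_1"
  shows "(c - b) * ((q - 1) * a * ((c - a) * (q - 1) * b * ((q - 1) * a * P + (b - q * a) * Ps)
      + (b - a) * (c - q * b) * ((q - 1) * a * Pt + (c - q * a) * Pts))
    + (b - q * a) * ((b - c) * (q - 1) * a * ((q - 1) * b * Ps + (a - q * b) * P)
      + (b - a) * (c - q * a) * ((q - 1) * b * Pst + (c - q * b) * Psts))) =
    (b - a) * ((q - 1) * b * ((c - a) * (q - 1) * a * ((q - 1) * b * P + (c - q * b) * Pt)
      + (c - b) * (b - q * a) * ((q - 1) * a * Ps + (c - q * a) * Pst))
    + (c - q * b) * ((a - b) * (q - 1) * a * ((q - 1) * c * Pt + (b - q * c) * P)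
      + (c - b) * (c - q * a) * ((q - 1) * a * Pts + (b - q * a) * Psts)))"
  by (simp add: algebra_simps)

lemma T_op_braid:
  assumes P: "P \<in> yp"
  shows "T_op i (T_op (i + 1) (T_op i P)) = T_op (i + 1) (T_op i (T_op (i + 1) P))"
proof -
  define s where "s = s_op i"
  define t where "t = s_op (i + 1)"
  define S where "S = T_op i"
  define T where "T = T_op (i + 1)"
  define a where "a = yv i"
  define b where "b = yv (i + 1)"
  define c where "c = yv (i + 2)"
  have s: "is_hom s" and t: "is_hom t" by (simp_all add: s_def t_def is_hom_s_op)
  have yp [simp]: "a \<in> yp" "b \<in> yp" "c \<in> yp" by (simp_all add: a_def b_def c_def)
  have ypo [simp]: "s F \<in> yp" "t F \<in> yp" "S F \<in> yp" "T F \<in> yp" if "F \<in> yp" for F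
    using that by (simp_all add: is_hom_yp[OF s] is_hom_yp[OF t]) (simp_all add: S_def T_def T_op_yp)
  have st: "s a = b" "s b = a" "s c = c" "t a = a" "t b = c" "t c = b"
    by (simp_all add: s_def t_def a_def b_def c_def s_op_yv)
  have sts: "t (s (t F)) = s (t (s F))" if "F \<in> yp" for F
    by (rule is_hom_eqI[OF is_hom_comp[OF t is_hom_comp[OF s t]] is_hom_comp[OF s is_hom_comp[OF t s]] that])
       (auto simp: s_def t_def s_op_gens)
  have SS: "s (s F) = F" and TT: "t (t F) = F" if "F \<in> yp" for F
    using that by (simp_all add: s_def t_def s_op_involution)
  define q where "q = qk"
  have q: "q \<in> yp" "s q = q" "t q = q"
    by (simp_all add: q_def is_hom_kconst[OF s] is_hom_kconst[OF t])
  note homs = is_hom_simps[OF s] is_hom_1[OF s]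
    is_hom_simps[OF t] is_hom_1[OF t]
    st q yp ypo PV_mult PV_diff PV_add PV_1 SS TT sts
  have S: "(b - a) * S F = (q - 1) * a * F + (b - q * a) * s F"
    and T: "(c - b) * T F = (q - 1) * b * F + (c - q * b) * t F" if "F \<in> yp" for F
    using T_op_eq[OF that, of i] T_op_eq[OF that, of "i + 1"]
    by (simp_all add: a_def b_def c_def S_def T_def s_def t_def q_def kconst_diff)
  have app_s: "s X = s Y" and app_t: "t X = t Y" if "X = Y" for X Y using that by simp_all
  have sS: "(a - b) * s (S F) = (q - 1) * b * s F + (a - q * b) * F"
    and tT: "(b - c) * t (T F) = (q - 1) * c * t F + (b - q * c) * F" if "F \<in> yp" for F
    using app_s[OF S[OF that]] app_t[OF T[OF that]] that by (simp_all only: homs)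
  have tS: "(c - a) * t (S F) = (q - 1) * a * t F + (c - q * a) * t (s F)"
    and sT: "(c - a) * s (T F) = (q - 1) * a * s F + (c - q * a) * s (t F)" if "F \<in> yp" for F
    using app_t[OF S[OF that]] app_s[OF T[OF that]] that by (simp_all only: homs)
  have stS: "(c - b) * s (t (S F)) = (q - 1) * b * s (t F) + (c - q * b) * s (t (s F))"
    and tsT: "(b - a) * t (s (T F)) = (q - 1) * a * t (s F) + (b - q * a) * s (t (s F))" if "F \<in> yp" for F
    using app_s[OF tS[OF that]] app_t[OF sT[OF that]] that by (simp_all only: homs)
  let ?N = "(q - 1) * a * ((c - a) * (q - 1) * b * ((q - 1) * a * P + (b - q * a) * s P)
      + (b - a) * (c - q * b) * ((q - 1) * a * t P + (c - q * a) * t (s P)))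
    + (b - q * a) * ((b - c) * (q - 1) * a * ((q - 1) * b * s P + (a - q * b) * P)
      + (b - a) * (c - q * a) * ((q - 1) * b * s (t P) + (c - q * b) * s (t (s P))))"
  let ?N' = "(q - 1) * b * ((c - a) * (q - 1) * a * ((q - 1) * b * P + (c - q * b) * t P)
      + (c - b) * (b - q * a) * ((q - 1) * a * s P + (c - q * a) * s (t P)))
    + (c - q * b) * ((a - b) * (q - 1) * a * ((q - 1) * c * t P + (b - q * c) * P)
      + (c - b) * (c - q * a) * ((q - 1) * a * t (s P) + (b - q * a) * s (t (s P))))"
  have 1: "(b - a) * ((b - a) * ((c - b) * ((c - a) * S (T (S P))))) = ?N"
    by (rule braid_identity[OF S sS tS stS T sT S]) (simp_all only: homs P)
  have 2: "(c - b) * ((c - b) * ((b - a) * ((c - a) * T (S (T P))))) = ?N'"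
    by (rule braid_identity[OF T tT sT tsT S tS T]) (simp_all only: homs P)
  have "(b - a) * ((b - a) * ((c - b) * ((c - b) * ((c - a) * S (T (S P)))))) =
      (c - b) * ((b - a) * ((b - a) * ((c - b) * ((c - a) * S (T (S P))))))"
    by (simp only: ac_simps)
  also have "\<dots> = (b - a) * ((c - b) * ((c - b) * ((b - a) * ((c - a) * T (S (T P))))))"
    unfolding 1 2 by (rule braid_coefficients)
  also have "\<dots> = (b - a) * ((b - a) * ((c - b) * ((c - b) * ((c - a) * T (S (T P))))))"
    by (simp only: ac_simps)
  finally have *: "(b - a) * ((b - a) * ((c - b) * ((c - b) * ((c - a) * S (T (S P)))))) = \<dots>" .
  have cancel: "(b - a) * F = (b - a) * G \<Longrightarrow> F = G" "(c - b) * F = (c - b) * G \<Longrightarrow> F = G"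
    "(c - a) * F = (c - a) * G \<Longrightarrow> F = G" for F G
    unfolding a_def b_def c_def by (rule yv_diff_cancel[rotated], assumption, simp)+
  have "S (T (S P)) = T (S (T P))"
    by (rule cancel(3)[OF cancel(2)[OF cancel(2)[OF cancel(1)[OF cancel(1)[OF *]]]]])
  then show ?thesis unfolding S_def T_def .
qed

lemma qv_nonzero [simp]: "qv \<noteq> 0"
  by (simp add: qv_def Zero_fract_def eq_fract)

lemma qv_neq_1 [simp]: "qv \<noteq> 1"
  by (simp add: qv_def One_fract_def eq_fract one_pCons)

text \<open>The inverse read off from T (T + q - 1) = q.\<close>

definition T_inv :: "nat \<Rightarrow> yring \<Rightarrow> yring" where
  "T_inv i P = kconst (inverse qv) * (T_op i P + kconst (qv - 1) * P)"

lemma T_inv_PV: "P \<in> PV I \<Longrightarrow> i \<in> I \<Longrightarrow> i + 1 \<in> I \<Longrightarrow> T_inv i P \<in> PV I"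
  by (simp add: T_inv_def T_op_PV)

lemma T_op_T_inv:
  assumes "P \<in> yp"
  shows "T_op i (T_inv i P) = P" "T_inv i (T_op i P) = P"
proof -
  have q: "kconst (inverse qv) * (qk * P) = P"
    using kconst_inverse[of qv] by (simp add: mult.commute[of "kconst (inverse qv)"] flip: mult.assoc)
  show "T_op i (T_inv i P) = P" "T_inv i (T_op i P) = P"
    using assms by (simp_all add: T_inv_def T_op_kconst T_op_add T_op_yp T_op_quadratic q)
qed

lemma T_inv_op_eq:
  assumes "1 \<le> i" "i < k" "P \<in> V k"
  shows "T_inv_op k i P = T_inv i P"
  unfolding T_inv_op_def
proof (rule inv_into_f_eq)
  have V: "F \<in> yp" if "F \<in> V k" for F using that by (auto simp: V_PV PV_yp)
  show "inj_on (T_op i) (V k)"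
    by (rule inj_onI) (metis T_op_T_inv(2) V)
  show "T_inv i P \<in> V k" using assms unfolding V_PV by (intro T_inv_PV) auto
  show "T_op i (T_inv i P) = P" by (rule T_op_T_inv(1)[OF V[OF assms(3)]])
qed

lemma T_inv_add: "P \<in> yp \<Longrightarrow> Q \<in> yp \<Longrightarrow> T_inv i (P + Q) = T_inv i P + T_inv i Q"
  by (simp add: T_inv_def T_op_add algebra_simps)

lemma T_inv_kconst: "P \<in> yp \<Longrightarrow> T_inv i (kconst c * P) = kconst c * T_inv i P"
  by (simp only: T_inv_def T_op_kconst) (simp add: algebra_simps)

section \<open>The relations between the operators\<close>

text \<open>Extraction in y_j is linear over y_i and y_{i+1} and commutes with s_i since the series
  is invariant; so it respects the equation characterizing T_i F.\<close>

lemma kap_T_op: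
  assumes "F \<in> yp" and j: "j \<noteq> i" "j \<noteq> i + 1" and S: "\<And>n. fps_nth S n \<in> yp" "\<And>n. s_op i (fps_nth S n) = fps_nth S n"
  shows "kap j S (T_op i F) = T_op i (kap j S F)"
proof (rule T_op_unique[symmetric])
  have sF: "s_op i F \<in> yp" by (rule is_hom_yp[OF is_hom_s_op assms(1)])
  have fm: "fmap (s_op i) S = S" by (rule fps_ext) (simp add: S)
  have "s_op i (kap j S F) = kap j (fmap (s_op i) S) (s_op i F)"
  proof (rule is_hom_kap[OF is_hom_s_op is_hom_s_op assms(1) S(1) refl])
    show "s_op i G \<in> PV (UNIV - {j})" if "G \<in> PV (UNIV - {j})" for G
      by (rule s_op_PV[OF that]) (use j in auto)
  qed (use j in \<open>auto simp: s_op_yv\<close>)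
  then have s: "s_op i (kap j S F) = kap j S (s_op i F)" by (simp only: fm)
  have "(yv (i + 1) - yv i) * kap j S (T_op i F) = kap j S ((yv (i + 1) - yv i) * T_op i F)"
    by (rule kap_mult_free[of _ "UNIV - {j}", symmetric]) (use j in auto)
  also have "\<dots> = kap j S ((kconst (qv - 1) * yv i) * F) + kap j S ((yv (i + 1) - qk * yv i) * s_op i F)"
    unfolding T_op_eq[OF assms(1)] kap_add ..
  also have "kap j S ((kconst (qv - 1) * yv i) * F) = kconst (qv - 1) * yv i * kap j S F"
    by (rule kap_mult_free[of _ "UNIV - {j}"]) (use j in auto)
  also have "kap j S ((yv (i + 1) - qk * yv i) * s_op i F) =
      (yv (i + 1) - qk * yv i) * kap j S (s_op i F)"
    by (rule kap_mult_free[of _ "UNIV - {j}"]) (use j in auto)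
  finally show "(yv (i + 1) - yv i) * kap j S (T_op i F) = kconst (qv - 1) * yv i * kap j S F +
      (yv (i + 1) - qk * yv i) * s_op i (kap j S F)" unfolding s .
qed

lemma s_op_Aser: "s_op i (fps_nth Aser n) = fps_nth Aser n"
  by (rule is_hom_eqI[OF is_hom_s_op is_hom_id Aser_PV[of n "{}"]]) (auto simp: s_op_sconst)

lemma dminus_T_op:
  assumes "F \<in> yp" "i + 1 < k"
  shows "dminus k (T_op i F) = T_op i (dminus k F)"
proof -
  have "taum k (s_op i F) = s_op i (taum k F)"
    by (rule is_hom_eqI[OF is_hom_comp[OF is_hom_taum is_hom_s_op] is_hom_comp[OF is_hom_s_op is_hom_taum] assms(1)])
       (use assms(2) in \<open>auto simp: hom_gens s_op_gens is_hom_simps[OF is_hom_s_op]\<close>)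
  then have "taum k (T_op i F) = T_op i (taum k F)"
    by (intro is_hom_T_op is_hom_taum assms(1)) (simp_all add: vpleth_yv)
  then have "dminus k (T_op i F) = - T_op i (kap k Aser (taum k F))"
    using assms by (simp add: dminus_eq T_op_yp kap_T_op is_hom_yp[OF is_hom_taum] s_op_Aser)
  also have "\<dots> = T_op i (dminus k F)"
  proof -
    have "kap k Aser (taum k F) \<in> yp" using assms(1) by (intro kap_into[OF is_hom_yp[OF is_hom_taum]]) auto
    from T_op_kconst[OF this, of i "-1"] show ?thesis
      by (simp add: dminus_eq[OF assms(1)] kconst_uminus)
  qed
  finally show ?thesis .
qed

lemma dplus_star_T_op:
  assumes "F \<in> PV {1..k}" "1 \<le> i" "i < k"
  shows "dplus_star k (T_op i F) = T_op (i + 1) (dplus_star k F)"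
proof (rule is_hom_T_op[OF is_hom_dplus_star PV_yp[OF assms(1)]])
  show "dplus_star k (s_op i F) = s_op (i + 1) (dplus_star k F)"
    by (rule is_hom_eqI[OF is_hom_comp[OF is_hom_dplus_star is_hom_s_op] is_hom_comp[OF is_hom_s_op is_hom_dplus_star] assms(1)])
       (use assms(2,3) in \<open>auto simp: hom_gens s_op_gens is_hom_simps[OF is_hom_s_op]\<close>)
qed (use assms in \<open>simp_all add: dplus_star_yv\<close>)

text \<open>The original variables have moved to y_3, y_4, ..., and y_1, y_2 enter only through X +
  (q - 1)(t y_1 + t y_2), which s_1 fixes.\<close>

lemma T_op_dplus_star_twice:
  assumes "F \<in> PV {1..k}"
  shows "T_op 1 (dplus_star (k + 1) (dplus_star k F)) = dplus_star (k + 1) (dplus_star k F)"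
proof (rule T_op_invariant)
  note ps = is_hom_dplus_star[of "k + 1", simplified] and s = is_hom_s_op[of 1, simplified]
  have eq: "s_op (Suc 0) (dplus_star (Suc k) (dplus_star k F)) = dplus_star (Suc k) (dplus_star k F)"
    by (rule is_hom_eqI[OF is_hom_comp[OF s is_hom_comp[OF ps is_hom_dplus_star]] is_hom_comp[OF ps is_hom_dplus_star] assms])
       (auto simp: hom_gens s_op_gens is_hom_simps[OF s] is_hom_simps[OF ps])
  then show "s_op 1 (dplus_star (k + 1) (dplus_star k F)) = dplus_star (k + 1) (dplus_star k F)"
    by simp
qed

lemma fmap_const: "is_hom \<theta> \<Longrightarrow> fmap \<theta> (fps_const c) = fps_const (\<theta> c)"
  by (rule fps_ext) (simp add: is_hom_0)

lemma fmap_X: "is_hom \<theta> \<Longrightarrow> fmap \<theta> fps_X = fps_X"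
  by (rule fps_ext) (simp add: is_hom_0 is_hom_1 fps_X_def)

lemma fmap_geo: "is_hom \<theta> \<Longrightarrow> c \<in> yp \<Longrightarrow> fmap \<theta> (geo c) = geo (\<theta> c)"
  by (rule fps_ext) (simp add: geo_def is_hom_power)

lemma fmap_lin: "is_hom \<theta> \<Longrightarrow> c \<in> yp \<Longrightarrow> fmap \<theta> (lin c) = lin (\<theta> c)"
  by (rule fps_ext) (simp add: lin_nth is_hom_0 is_hom_1 is_hom_uminus)

definition fps_over :: "nat set \<Rightarrow> yring fps set" where
  "fps_over I = {S. \<forall>n. fps_nth S n \<in> PV I}"

lemma fps_over_nth: "S \<in> fps_over I \<Longrightarrow> fps_nth S n \<in> PV I"
  by (simp add: fps_over_def)

lemma fps_over_mono: "S \<in> fps_over I \<Longrightarrow> I \<subseteq> J \<Longrightarrow> S \<in> fps_over J"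
  by (auto simp: fps_over_def intro: PV_mono)

lemma fps_over_mult [intro, simp]: "S \<in> fps_over I \<Longrightarrow> T \<in> fps_over I \<Longrightarrow> S * T \<in> fps_over I"
  by (simp add: fps_over_def fps_mult_nth)

lemma fps_over_const [intro, simp]: "c \<in> PV I \<Longrightarrow> fps_const c \<in> fps_over I"
  by (simp add: fps_over_def)

lemma fps_over_X [simp]: "fps_X \<in> fps_over I"
  by (simp add: fps_over_def fps_X_def)

lemma fps_over_geo [intro, simp]: "c \<in> PV I \<Longrightarrow> geo c \<in> fps_over I"
  by (simp add: fps_over_def geo_def)

lemma fps_over_lin [intro, simp]: "c \<in> PV I \<Longrightarrow> lin c \<in> fps_over I"
  by (simp add: fps_over_def lin_nth)

lemma fps_over_Aser [simp]: "Aser \<in> fps_over I"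
  by (simp add: fps_over_def)

lemma fps_over_Sser [intro, simp]: "a \<in> PV I \<Longrightarrow> Sser a \<in> fps_over I"
  by (simp add: Sser_def)

lemma fmap_mult:
  assumes "is_hom \<theta>" "f \<in> fps_over UNIV" "g \<in> fps_over UNIV"
  shows "fmap \<theta> (f * g) = fmap \<theta> f * fmap \<theta> g"
  using assms by (intro fps_ext) (simp add: fps_mult_nth is_hom_sum is_hom_mult fps_over_nth)

lemma fmap_Sser:
  assumes "is_hom \<theta>" "a \<in> yp"
  shows "fmap \<theta> (Sser a) = fps_const (\<theta> a) * fps_X * geo (\<theta> a) * fmap \<theta> Aser"
  using assms by (simp add: Sser_def fmap_mult fmap_const fmap_X fmap_geo)

lemma fmap_id:
  assumes "\<And>n. \<theta> (fps_nth S n) = fps_nth S n"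
  shows "fmap \<theta> S = S"
  by (rule fps_ext) (simp add: assms)

subsection \<open>Two variables\<close>

text \<open>The coefficient in y_v is taken first, so its series may still contain y_w, as a twisted
  series does.\<close>

definition kap2 :: "nat \<Rightarrow> nat \<Rightarrow> yring fps \<Rightarrow> yring fps \<Rightarrow> yring \<Rightarrow> yring" where
  "kap2 w v S T F = kap w S (kap v T F)"

text \<open>The twist is the expansion of \<open>(v - w) / (v - q w)\<close> in \<open>w/v\<close>.\<close>

definition twist :: "nat \<Rightarrow> yring fps \<Rightarrow> yring fps" where
  "twist w T = T * lin (yv w) * geo (qk * yv w)"

definition swap_hom :: "nat \<Rightarrow> nat \<Rightarrow> yring \<Rightarrow> yring" where
  "swap_hom w v = ysubst (\<lambda>i. yv (if i = w then v else if i = v then w else i))"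

lemma is_hom_swap_hom: "is_hom (swap_hom w v)"
  unfolding swap_hom_def by (rule is_hom_ysubst) simp

lemma swap_hom_sconst: "swap_hom w v (sconst s) = sconst s"
  and swap_hom_yv: "swap_hom w v (yv i) = yv (if i = w then v else if i = v then w else i)"
  by (simp_all add: swap_hom_def)

lemmas swap_hom_gens = swap_hom_sconst swap_hom_yv

lemma swap_hom_free: "F \<in> PV (UNIV - {w} - {v}) \<Longrightarrow> swap_hom w v F = F"
  by (rule is_hom_eqI[OF is_hom_swap_hom is_hom_id]) (auto simp: swap_hom_gens)

lemma twist_lin: "twist w T * lin (qk * yv w) = T * lin (yv w)"
  by (simp add: twist_def geo_lin mult.assoc)

lemma fps_over_twist: "T \<in> fps_over I \<Longrightarrow> w \<in> I \<Longrightarrow> twist w T \<in> fps_over I"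
  by (simp add: twist_def)

lemma kap2_add: "kap2 w v S T (F + G) = kap2 w v S T F + kap2 w v S T G"
  by (simp add: kap2_def kap_add)

lemma kap2_diff: "kap2 w v S T (F - G) = kap2 w v S T F - kap2 w v S T G"
  by (simp add: kap2_def kap_diff)

lemma kap2_twist:
  assumes "w \<noteq> v" "F \<in> yp"
  shows "kap2 w v S (twist w T) ((yv v - qk * yv w) * F) = kap2 w v S T ((yv v - yv w) * F)"
  unfolding kap2_def
  by (intro arg_cong[of _ _ "kap w S"] kap_linear_factor[of _ _ _ _ "UNIV - {v}"])
     (use assms twist_lin in \<open>auto simp: lin_def\<close>)

lemma PV_slice2_induct [consumes 1, case_names monom add]:
  assumes F: "F \<in> PV I" and monom: "\<And>G m n. G \<in> PV (I - {w} - {v}) \<Longrightarrow> P (G * yv v ^ n * yv w ^ m)"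
    and add: "\<And>F G. F \<in> yp \<Longrightarrow> G \<in> yp \<Longrightarrow> P F \<Longrightarrow> P G \<Longrightarrow> P (F + G)"
  shows "P F"
  using F
proof (induction F rule: PV_slice_induct[where j = w])
  case (monom G m)
  from monom(1) show ?case
  proof (induction G rule: PV_slice_induct[where j = v])
    case (add F G)
    then show ?case
      using assms(3)[of "F * yv w ^ m" "G * yv w ^ m"] by (simp add: distrib_right PV_yp)
  qed (rule assms(2))
qed (auto intro: add PV_yp)

lemma kap_mult_power': "G \<in> PV (UNIV - {j}) \<Longrightarrow> kap j S (G * yv j ^ n) = G * fps_nth S (Suc n)"
  by (rule kap_mult_power) auto

lemma kap2_monom:
  assumes "w \<noteq> v" "S \<in> fps_over (UNIV - {w} - {v})" "T \<in> fps_over (UNIV - {w})" "G \<in> PV (UNIV - {w} - {v})"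
  shows "kap2 w v S T (G * yv v ^ n * yv w ^ m) = G * fps_nth T (Suc n) * fps_nth S (Suc m)"
proof -
  have "G * yv v ^ n * yv w ^ m = G * yv w ^ m * yv v ^ n" by (simp only: ac_simps)
  moreover have "G * yv w ^ m \<in> PV (UNIV - {v})"
    using assms(1,4) by (auto intro: PV_mono)
  ultimately have "kap v T (G * yv v ^ n * yv w ^ m) = G * yv w ^ m * fps_nth T (Suc n)"
    by (simp only: kap_mult_power')
  also have "\<dots> = G * fps_nth T (Suc n) * yv w ^ m" by (simp only: ac_simps)
  also have "kap w S \<dots> = G * fps_nth T (Suc n) * fps_nth S (Suc m)"
    using assms by (intro kap_mult_power[of _ "UNIV - {w}"]) (auto simp: fps_over_nth intro: PV_mono)
  finally show ?thesis by (simp add: kap2_def)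
qed

lemma kap2_swap:
  assumes wv: "w \<noteq> v" and ST: "S \<in> fps_over (UNIV - {w} - {v})" "T \<in> fps_over (UNIV - {w} - {v})" and "F \<in> yp"
  shows "kap2 w v S T (swap_hom w v F) = kap2 w v T S F"
  using assms(4)
proof (induction F rule: PV_slice2_induct[where w = w and v = v])
  case (monom G m n)
  note s = is_hom_swap_hom[of w v]
  have G: "G \<in> yp" using monom by (rule PV_yp)
  have "swap_hom w v (G * yv v ^ n * yv w ^ m) = G * yv v ^ m * yv w ^ n"
    using G wv by (simp add: is_hom_mult[OF s] is_hom_power[OF s] swap_hom_yv swap_hom_free[OF monom] ac_simps)
  moreover have over: "S \<in> fps_over (UNIV - {w})" "T \<in> fps_over (UNIV - {w})"
    using ST by (auto intro: fps_over_mono)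
  ultimately show ?case
    by (simp only: kap2_monom[OF wv ST(1) over(2) monom] kap2_monom[OF wv ST(2) over(1) monom])
       (simp only: ac_simps)
next
  case (add F G)
  then show ?case by (simp add: kap2_add is_hom_add[OF is_hom_swap_hom])
qed

text \<open>Both variables are bound: the result contains neither of them, so exchanging their names
  does not change it.\<close>

lemma kap2_twist_rename:
  assumes wv: "w \<noteq> v" and ST: "S \<in> fps_over (UNIV - {w} - {v})" "T \<in> fps_over (UNIV - {w} - {v})" and F: "F \<in> yp"
  shows "kap2 w v S (twist w T) F = kap2 v w S (twist v T) (swap_hom w v F)"
proof -
  note s = is_hom_swap_hom[of w v]
  have S: "fmap (swap_hom w v) S = S" and T: "fmap (swap_hom w v) T = T"
    using ST by (auto intro!: fmap_id swap_hom_free simp: fps_over_nth)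
  have T': "twist w T \<in> fps_over (UNIV - {v})"
    using ST wv by (auto intro!: fps_over_twist intro: fps_over_mono)
  have yp: "fps_nth S n \<in> yp" "fps_nth (twist w T) n \<in> yp" for n
    using ST(1) T' by (auto intro: PV_yp fps_over_nth)
  have "fmap (swap_hom w v) (twist w T) = twist v T"
    using ST by (simp add: twist_def fmap_mult[OF s] fmap_lin[OF s] fmap_geo[OF s] T is_hom_simps[OF s] swap_hom_yv fps_over_mono[of T _ UNIV])
  moreover have "swap_hom w v (kap v (twist w T) F) =
      kap w (fmap (swap_hom w v) (twist w T)) (swap_hom w v F)"
  proof (rule is_hom_kap[OF s s F _ refl])
    show "swap_hom w v G \<in> PV (UNIV - {w})" if "G \<in> PV (UNIV - {v})" for G
      by (rule is_hom_into[OF s that]) (auto simp: swap_hom_gens)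
  qed (auto simp: swap_hom_yv yp)
  ultimately have 1: "swap_hom w v (kap v (twist w T) F) = kap w (twist v T) (swap_hom w v F)" by simp
  have K: "kap v (twist w T) F \<in> PV (UNIV - {v})"
    using F T' by (intro kap_into) (auto simp: fps_over_nth)
  have "swap_hom w v (kap w S (kap v (twist w T) F)) =
      kap v (fmap (swap_hom w v) S) (swap_hom w v (kap v (twist w T) F))"
  proof (rule is_hom_kap[OF s s PV_yp[OF K] _ refl])
    show "swap_hom w v G \<in> PV (UNIV - {v})" if "G \<in> PV (UNIV - {w})" for G
      by (rule is_hom_into[OF s that]) (auto simp: swap_hom_gens)
  qed (auto simp: swap_hom_yv yp)
  moreover have "kap w S (kap v (twist w T) F) \<in> PV (UNIV - {w} - {v})"
    using ST by (intro kap_into[OF K]) (auto simp: fps_over_nth)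
  ultimately show ?thesis by (simp add: kap2_def 1 S swap_hom_free)
qed

text \<open>The difference T F - F is a multiple of v - q w, which cancels the denominator of the
  twist and leaves the untwisted coefficient of s F - F. Untwisted, exchanging the variables in the
  polynomial is the same as exchanging the two series.\<close>

lemma kap2_T_op:
  assumes wv: "w \<noteq> v" and ST: "S \<in> fps_over (UNIV - {w} - {v})" "T \<in> fps_over (UNIV - {w} - {v})"
    and \<theta>: "is_hom \<theta>" and F: "F \<in> yp" and yv: "\<theta> (yv i) = yv w" "\<theta> (yv (i + 1)) = yv v"
    and s: "\<theta> (s_op i F) = swap_hom w v (\<theta> F)"
  shows "kap2 w v S (twist w T) (\<theta> (T_op i F)) =
    kap2 w v S (twist w T) (\<theta> F) + kap2 w v T S (\<theta> F) - kap2 w v S T (\<theta> F)"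
proof -
  have D: "ddiff i F \<in> yp" using F by (auto intro: ddiff_PV)
  have sF: "s_op i F \<in> yp" by (rule is_hom_yp[OF is_hom_s_op F])
  have T: "\<theta> (T_op i F) = \<theta> F + (yv v - qk * yv w) * \<theta> (ddiff i F)"
    unfolding T_op_ddiff[OF F]
    by (simp only: is_hom_simps[OF \<theta>]
        yv F D PV_yv UNIV_I PV_diff PV_mult PV_kconst)
  have "(yv v - yv w) * \<theta> (ddiff i F) = \<theta> ((yv (i + 1) - yv i) * ddiff i F)"
    by (simp only: is_hom_simps[OF \<theta>] yv D PV_yv UNIV_I PV_diff)
  also have "\<dots> = swap_hom w v (\<theta> F) - \<theta> F"
    unfolding ddiff_eq[OF F] by (simp only: is_hom_diff[OF \<theta>] F sF s)
  finally have E: "(yv v - yv w) * \<theta> (ddiff i F) = swap_hom w v (\<theta> F) - \<theta> F" .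
  show ?thesis
    unfolding T kap2_add kap2_twist[OF wv is_hom_yp[OF \<theta> D]] E kap2_diff
      kap2_swap[OF wv ST is_hom_yp[OF \<theta> F]] by simp
qed

text \<open>The outer substitution X - (q - 1) y_j also acts on the inner series Exp[-X/y_k], and
  this produces the twist; the two signs of d_- cancel.\<close>

lemma dminus_twice:
  assumes "F \<in> yp" "j \<noteq> k"
  shows "dminus j (dminus k F) = kap2 j k Aser (twist j Aser) (taum j (taum k F))"
proof -
  have G: "taum k F \<in> yp" by (rule is_hom_yp[OF is_hom_taum assms(1)])
  have K: "kap k Aser (taum k F) \<in> yp" by (rule kap_into[OF G]) auto
  have "taum j (kap k Aser (taum k F)) = kap k (fmap (taum j) Aser) (taum j (taum k F))"
  proof (rule is_hom_kap[OF is_hom_taum is_hom_taum G _ refl])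
    show "taum j H \<in> PV (UNIV - {k})" if "H \<in> PV (UNIV - {k})" for H
      using that assms(2) by (intro taum_PV) auto
  qed (auto simp: vpleth_yv)
  also have "fmap (taum j) Aser = twist j Aser"
    unfolding twist_def by (rule fmap_Aser_minus[OF is_hom_taum]) (simp add: taum_psym)
  finally show ?thesis
    by (simp add: dminus_eq[OF assms(1)] dminus_eq[OF PV_uminus[OF K]] is_hom_uminus[OF is_hom_taum K]
        kap_uminus kap2_def)
qed

text \<open>Both series are \<open>Aser\<close>, so the two correction terms in
  \<open>kap2_T_op\<close> cancel each other.\<close>

lemma dminus_twice_T_op:
  assumes "F \<in> yp"
  shows "dminus i (dminus (i + 1) (T_op i F)) = dminus i (dminus (i + 1) F)"
proof -
  let ?\<theta> = "\<lambda>F. taum i (taum (i + 1) F)"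
  note t = is_hom_taum and s = is_hom_swap_hom
  have \<theta>: "is_hom ?\<theta>" by (rule is_hom_comp[OF t t])
  have "?\<theta> (s_op i F) = swap_hom i (i + 1) (?\<theta> F)"
    by (rule is_hom_eqI[OF is_hom_comp[OF \<theta> is_hom_s_op] is_hom_comp[OF s \<theta>] assms])
       (auto simp: hom_gens s_op_gens swap_hom_gens is_hom_simps[OF t] is_hom_simps[OF s])
  then have "kap2 i (i + 1) Aser (twist i Aser) (?\<theta> (T_op i F)) = kap2 i (i + 1) Aser (twist i Aser) (?\<theta> F)"
    by (subst kap2_T_op[OF _ _ _ \<theta> assms]) (auto simp: vpleth_yv)
  then show ?thesis
    using assms by (simp add: dminus_twice T_op_yp)
qed

text \<open>Divided by B(w) B(v) and multiplied by w v (v - q w) / a, this is the polynomial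
  identity (q - 1) w (v - q a) + (w - q a)(v - q w) = q (w - a)(v - w). Since the twist is an
  expansion in w/v, the denominator is cleared coefficientwise, by induction on the power of
  1/v.\<close>

lemma kap2_key_identity:
  assumes wv: "w \<noteq> v" and B: "B \<in> fps_over (UNIV - {w} - {v})" and a: "a \<in> PV (UNIV - {w} - {v})"
    and F: "F \<in> yp" and S1: "S1 = fps_const a * fps_X * B" and T1: "T1 = B * lin (qk * a)"
    and S2: "S2 = B * lin a"
  shows "kap2 w v S1 (twist w T1) F + kap2 w v T1 S1 F - kap2 w v S1 T1 F =
    qk * kap2 w v S2 (twist w S1) F"
proof -
  define q where "q = qk"
  have over: "S1 \<in> fps_over (UNIV - {w} - {v})" "T1 \<in> fps_over (UNIV - {w} - {v})" "S2 \<in> fps_over (UNIV - {w} - {v})"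
    using B a by (auto simp: S1 T1 S2)
  have over_w: "S1 \<in> fps_over (UNIV - {w})" "T1 \<in> fps_over (UNIV - {w})" "S2 \<in> fps_over (UNIV - {w})"
    using over by (auto intro: fps_over_mono)
  \<comment> \<open>The coefficient of the n-th power of 1/v in the twisted series is a polynomial
    in w; it is multiplied by the m-th power of w and then extracted.\<close>
  define R where "R S T m n = kap w S (yv w ^ m * fps_nth (twist w T) n)" for S T m n
  have R0: "R S T m 0 = fps_nth S (Suc m) * fps_nth T 0" if "T \<in> fps_over (UNIV - {w})" for S T m
  proof -
    have "fps_nth (twist w T) 0 = fps_nth T 0" by (simp add: twist_def lin_nth geo_def)
    then show ?thesis
      using kap_mult_power[OF fps_over_nth[OF that, of 0], of w S m] by (simp add: R_def mult.commute)
  qed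
  \<comment> \<open>Clearing the denominator v - q w by \<open>twist_lin\<close> gives a recursion
    that lowers n and raises m, hence the arbitrary m in the induction for
    \<open>key\<close>.\<close>
  have RS: "R S T m (Suc n) = q * R S T (Suc m) n + fps_nth S (Suc m) * fps_nth T (Suc n)
      - fps_nth S (Suc (Suc m)) * fps_nth T n" if "T \<in> fps_over (UNIV - {w})" for S T m n
  proof -
    have "fps_nth (twist w T) (Suc n) - q * yv w * fps_nth (twist w T) n =
        fps_nth T (Suc n) - yv w * fps_nth T n"
      using arg_cong[OF twist_lin[of w T], of "\<lambda>f. fps_nth f (Suc n)"] by (simp only: mult_lin_nth q_def)
    then have *: "fps_nth (twist w T) (Suc n) = q * yv w * fps_nth (twist w T) n +
        fps_nth T (Suc n) - yv w * fps_nth T n" by (simp add: algebra_simps)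
    have "yv w ^ m * fps_nth (twist w T) (Suc n) = q * (yv w ^ Suc m * fps_nth (twist w T) n) +
        fps_nth T (Suc n) * yv w ^ m - fps_nth T n * yv w ^ Suc m"
      unfolding * by (simp add: algebra_simps)
    moreover have "kap w S (q * G) = q * kap w S G" for G
      by (rule kap_mult_free[of q "{}"]) (auto simp: q_def)
    moreover have "kap w S (fps_nth T j * yv w ^ d) = fps_nth T j * fps_nth S (Suc d)" for j d
      using that by (intro kap_mult_power[of _ "UNIV - {w}"]) (auto simp: fps_over_nth)
    ultimately show ?thesis
      by (simp only: R_def kap_add kap_diff) (simp only: ac_simps)
  qed
  have S10: "fps_nth S1 0 = 0" and S1S: "fps_nth S1 (Suc j) = a * fps_nth B j" for j
    by (simp_all add: S1 mult.assoc)
  have T10: "fps_nth T1 0 = fps_nth B 0" and T1S: "fps_nth T1 (Suc j) = fps_nth B (Suc j) - q * a * fps_nth B j" for j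
    by (simp_all add: T1 mult_lin_nth lin_nth q_def)
  have S2S: "fps_nth S2 (Suc j) = fps_nth B (Suc j) - a * fps_nth B j" for j
    by (simp add: S2 mult_lin_nth)
  have key: "R S1 T1 m n + fps_nth T1 (Suc m) * fps_nth S1 n - fps_nth S1 (Suc m) * fps_nth T1 n =
      q * R S2 S1 m n" for m n
  proof (induction n arbitrary: m)
    case 0
    show ?case by (simp add: R0 over_w S10)
  next
    case (Suc n)
    have IH: "R S1 T1 (Suc m) n = q * R S2 S1 (Suc m) n - fps_nth T1 (Suc (Suc m)) * fps_nth S1 n
        + fps_nth S1 (Suc (Suc m)) * fps_nth T1 n"
      using Suc[of "Suc m"] by (simp add: algebra_simps)
    show ?case
      unfolding RS[OF over_w(1)] RS[OF over_w(2)] IH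
      by (cases n) (simp_all add: S10 S1S T10 T1S S2S algebra_simps)
  qed
  have L: "kap2 w v S (twist w T) (G * yv v ^ n * yv w ^ m) = G * R S T m (Suc n)"
    if G: "G \<in> PV (UNIV - {w} - {v})" and T: "T \<in> fps_over (UNIV - {w} - {v})" for S T G m n
  proof -
    have "G * yv v ^ n * yv w ^ m = G * yv w ^ m * yv v ^ n" by (simp only: ac_simps)
    moreover have "G * yv w ^ m \<in> PV (UNIV - {v})" using G wv by (auto intro: PV_mono)
    ultimately have "kap v (twist w T) (G * yv v ^ n * yv w ^ m) = G * (yv w ^ m * fps_nth (twist w T) (Suc n))"
      by (simp only: kap_mult_power') (simp only: mult.assoc)
    moreover have "kap w S (G * H) = G * kap w S H" for H
      using G by (intro kap_mult_free) auto
    ultimately show ?thesis by (simp add: kap2_def R_def)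
  qed
  show ?thesis
    using F
  proof (induction F rule: PV_slice2_induct[where w = w and v = v])
    case (monom G m n)
    have "kap2 w v S1 (twist w T1) (G * yv v ^ n * yv w ^ m) + kap2 w v T1 S1 (G * yv v ^ n * yv w ^ m)
        - kap2 w v S1 T1 (G * yv v ^ n * yv w ^ m) =
      G * (R S1 T1 m (Suc n) + fps_nth T1 (Suc m) * fps_nth S1 (Suc n) - fps_nth S1 (Suc m) * fps_nth T1 (Suc n))"
      by (simp only: L[OF monom over(2)] kap2_monom[OF wv over(2) over_w(1) monom]
          kap2_monom[OF wv over(1) over_w(2) monom]) (simp add: algebra_simps)
    then show ?case unfolding key by (simp only: L[OF monom over(1)] q_def) (simp only: ac_simps)
  next
    case (add F G)
    then show ?case by (simp add: kap2_add algebra_simps)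
  qed
qed

section \<open>Relations of C with d_- and d_+^*\<close>

lemma dminus_add: "F \<in> yp \<Longrightarrow> G \<in> yp \<Longrightarrow> dminus k (F + G) = dminus k F + dminus k G"
  by (simp add: dminus_eq is_hom_add[OF is_hom_taum] kap_add)

lemma kap_kconst: "kap j S (kconst c * F) = kconst c * kap j S F"
  by (rule kap_mult_free[of _ "{}"]) auto

lemma dminus_kconst: "F \<in> yp \<Longrightarrow> dminus k (kconst c * F) = kconst c * dminus k F"
  by (simp add: dminus_eq is_hom_simps[OF is_hom_taum] kap_kconst)

lemma dplus_star_kconst: "F \<in> yp \<Longrightarrow> dplus_star k (kconst c * F) = kconst c * dplus_star k F"
  by (simp add: is_hom_simps[OF is_hom_dplus_star])

lemma Psi_PV: "F \<in> PV {1..k} \<Longrightarrow> 1 \<le> k \<Longrightarrow> Psi k F \<in> PV {0..k}"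
  by (rule is_hom_into[OF is_hom_Psi]) (auto simp: hom_gens)

text \<open>The outer substitution X - (q - 1) y_k twists the factor Exp[-X/w] of the series of C;
  the factor depending on t y_1 is left alone.\<close>

lemma dminus_Cst:
  assumes k: "2 \<le> k" and F: "F \<in> PV {1..k}"
  shows "dminus k (Cst k F) = - (kconst (qv - 1) * kap2 k 0 Aser (twist k (Sser ty1)) (taum k (Psi k F)))"
proof -
  have N: "Psi k F \<in> yp" using F is_hom_yp[OF is_hom_Psi] PV_yp by blast
  have S: "Sser ty1 \<in> fps_over (UNIV - {0})" by auto
  have K: "kap 0 (Sser ty1) (Psi k F) \<in> yp"
    using N by (rule kap_into) (auto intro: fps_over_nth)
  have "taum k (kap 0 (Sser ty1) (Psi k F)) = kap 0 (fmap (taum k) (Sser ty1)) (taum k (Psi k F))"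
  proof (rule is_hom_kap[OF is_hom_taum is_hom_taum N _ refl])
    show "taum k H \<in> PV (UNIV - {0})" if "H \<in> PV (UNIV - {0})" for H
      using that k by (intro taum_PV) auto
  qed (auto simp: vpleth_yv intro: fps_over_nth)
  also have "fmap (taum k) Aser = twist k Aser"
    unfolding twist_def by (rule fmap_Aser_minus[OF is_hom_taum]) (simp add: taum_psym)
  then have "fmap (taum k) (Sser ty1) = twist k (Sser ty1)"
    by (simp add: fmap_Sser[OF is_hom_taum] is_hom_simps[OF is_hom_taum] vpleth_yv)
       (simp add: twist_def Sser_def mult.assoc)
  finally have T: "taum k (kap 0 (Sser ty1) (Psi k F)) = kap 0 (twist k (Sser ty1)) (taum k (Psi k F))" .
  have "1 \<le> k" using k by simp
  then show ?thesis
    by (simp only: Cst_eq[OF _ F] dminus_kconst[OF K] dminus_eq[OF K] T kap2_def mult_minus_right)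
qed

text \<open>Here \<open>Psi (k - 1)\<close> acts on the series of the inner d_-: its summand (q - 1)
  t y_1 multiplies the series by (v - q t y_1) / (v - t y_1), and its summand - (q - 1) w gives the
  twist. In \<open>\<theta>\<close> the variable y_k stays in place as v, while y_{k-1} becomes
  w.\<close>

lemma Cst_dminus:
  assumes k: "2 \<le> k"
  obtains \<theta> where "is_hom \<theta>" "\<And>n. n \<ge> 1 \<Longrightarrow> \<theta> (sconst (psym n)) = sconst (psym n) + dq n ty1 - dq n (yv 0) - dq n (yv k)"
    "\<And>i. \<theta> (yv i) = (if i = k - 1 then yv 0 else if i = k then yv k else yv (i + 1))"
    "\<And>F. F \<in> PV {1..k} \<Longrightarrow> Cst (k - 1) (dminus k F) = - (kconst (qv - 1) *
      kap2 0 k (Sser ty1) (twist 0 (Aser * lin (qk * ty1) * geo ty1)) (\<theta> F))"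
proof
  define \<eta> where "\<eta> = yhom (\<lambda>n. sconst (psym n) + dq n ty1 - dq n (yv 0))
    (\<lambda>i. if i = k - 1 then yv 0 else if i = k then yv k else yv (i + 1))"
  have \<eta>: "is_hom \<eta>" unfolding \<eta>_def by (rule is_hom_yhom) auto
  have \<eta>p: "\<eta> (sconst (psym n)) = sconst (psym n) + dq n ty1 - dq n (yv 0)" if "n \<ge> 1" for n
    using that by (simp add: \<eta>_def yhom_sconst sym_hom_psym)
  have \<eta>y: "\<eta> (yv i) = (if i = k - 1 then yv 0 else if i = k then yv k else yv (i + 1))" for i
    by (simp add: \<eta>_def yhom_yv)
  let ?\<theta> = "\<lambda>F. \<eta> (taum k F)"
  note t = is_hom_taum[of k]
  show "is_hom ?\<theta>" by (rule is_hom_comp[OF \<eta> t])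
  show "?\<theta> (sconst (psym n)) = sconst (psym n) + dq n ty1 - dq n (yv 0) - dq n (yv k)" if "n \<ge> 1" for n
    using that k by (auto simp: taum_psym is_hom_simps[OF \<eta>] \<eta>p \<eta>y)
  show "?\<theta> (yv i) = (if i = k - 1 then yv 0 else if i = k then yv k else yv (i + 1))" for i
    by (simp only: vpleth_yv \<eta>y)
  show "Cst (k - 1) (dminus k F) = - (kconst (qv - 1) *
      kap2 0 k (Sser ty1) (twist 0 (Aser * lin (qk * ty1) * geo ty1)) (?\<theta> F))"
    if F: "F \<in> PV {1..k}" for F
  proof -
    have G: "taum k F \<in> PV {1..k}" using F k by (intro taum_PV) auto
    have yp: "kap k Aser (taum k F) \<in> yp" by (rule kap_into[OF G]) auto
    have D: "dminus k F \<in> PV {1..k - 1}"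
      using k by (intro PV_mono[OF dminus_PV[OF F]]) auto
    have "Psi (k - 1) (kap k Aser (taum k F)) = kap k (fmap (Psi (k - 1)) Aser) (\<eta> (taum k F))"
    proof (rule is_hom_kap[OF is_hom_Psi \<eta> G])
      show "Psi (k - 1) H = \<eta> H" if "H \<in> PV ({1..k} - {k})" for H
        by (rule is_hom_eqI[OF is_hom_Psi \<eta> that]) (auto simp: hom_gens \<eta>p \<eta>y)
      show "\<eta> H \<in> PV (UNIV - {k})" if "H \<in> PV ({1..k} - {k})" for H
        by (rule is_hom_into[OF \<eta> that]) (use k in \<open>auto simp: \<eta>p \<eta>y\<close>)
    qed (use k in \<open>auto simp: \<eta>y\<close>)
    also have "fmap (Psi (k - 1)) Aser = twist 0 (Aser * lin (qk * ty1) * geo ty1)"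
      unfolding twist_def by (rule fmap_Aser[OF is_hom_Psi]) (simp add: Psi_psym)
    finally have P: "Psi (k - 1) (dminus k F) = - kap k (twist 0 (Aser * lin (qk * ty1) * geo ty1)) (\<eta> (taum k F))"
      by (simp add: dminus_eq[OF PV_yp[OF F]] is_hom_uminus[OF is_hom_Psi yp])
    have "Cst (k - 1) (dminus k F) = kconst (qv - 1) * kap 0 (Sser ty1) (Psi (k - 1) (dminus k F))"
      using k D by (intro Cst_eq) auto
    then show ?thesis by (simp only: P kap_uminus kap2_def mult_minus_right)
  qed
qed

text \<open>Renaming bound variables brings both sides to the polynomial \<open>\<theta> F\<close>,
  on which s_{k-1} exchanges w and v. Then \<open>kap2_T_op\<close> removes T_{k-1}, and
  \<open>kap2_key_identity\<close> with a = t y_1 compares the series.\<close>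

lemma dminus_Cst_T_op:
  assumes k: "2 \<le> k" and F: "F \<in> PV {1..k}"
  shows "Cst (k - 1) (dminus k (T_op (k - 1) F)) = qk * dminus k (Cst k F)"
proof -
  obtain \<theta> where \<theta>: "is_hom \<theta>"
    and \<theta>p: "\<And>n. n \<ge> 1 \<Longrightarrow> \<theta> (sconst (psym n)) = sconst (psym n) + dq n ty1 - dq n (yv 0) - dq n (yv k)"
    and \<theta>y: "\<And>i. \<theta> (yv i) = (if i = k - 1 then yv 0 else if i = k then yv k else yv (i + 1))"
    and C: "\<And>F. F \<in> PV {1..k} \<Longrightarrow> Cst (k - 1) (dminus k F) = - (kconst (qv - 1) *
      kap2 0 k (Sser ty1) (twist 0 (Aser * lin (qk * ty1) * geo ty1)) (\<theta> F))"
    using Cst_dminus[OF k] by blast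
  define S where "S = Sser ty1"
  define T where "T = Aser * lin (qk * ty1) * geo ty1"
  note s = is_hom_swap_hom[of 0 k] and t = is_hom_taum[of k]
  have Fyp: "F \<in> yp" by (rule PV_yp[OF F])
  have a: "ty1 \<in> PV (UNIV - {0} - {k})" using k by auto
  have B: "Aser * geo ty1 \<in> fps_over (UNIV - {0} - {k})" using a by auto
  have ST: "S \<in> fps_over (UNIV - {0} - {k})" "T \<in> fps_over (UNIV - {0} - {k})"
    using a by (auto simp: S_def T_def)
  have "kap2 k 0 Aser (twist k S) (taum k (Psi k F)) = kap2 0 k Aser (twist 0 S) (\<theta> F)"
  proof -
    have N: "taum k (Psi k F) \<in> yp" by (intro is_hom_yp[OF t] is_hom_yp[OF is_hom_Psi] Fyp)
    have "kap2 k 0 Aser (twist k S) (taum k (Psi k F)) = kap2 0 k Aser (twist 0 S) (swap_hom k 0 (taum k (Psi k F)))"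
      using k ST N by (intro kap2_twist_rename) (auto simp: Diff_insert2[symmetric] insert_commute)
    also have "swap_hom k 0 (taum k (Psi k F)) = \<theta> F"
      by (rule is_hom_eqI[OF is_hom_comp[OF is_hom_swap_hom is_hom_comp[OF t is_hom_Psi]] \<theta> F])
         (use k in \<open>auto simp: hom_gens swap_hom_gens \<theta>p \<theta>y
           is_hom_simps[OF t]
           is_hom_simps[OF is_hom_swap_hom]\<close>)
    finally show ?thesis .
  qed
  then have D: "dminus k (Cst k F) = - (kconst (qv - 1) * kap2 0 k Aser (twist 0 S) (\<theta> F))"
    using dminus_Cst[OF assms] by (simp add: S_def)
  have \<theta>s: "\<theta> (s_op (k - 1) F) = swap_hom 0 k (\<theta> F)"
    by (rule is_hom_eqI[OF is_hom_comp[OF \<theta> is_hom_s_op] is_hom_comp[OF s \<theta>] F])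
       (use k in \<open>auto simp: s_op_gens swap_hom_gens \<theta>p \<theta>y
         is_hom_simps[OF s]\<close>)
  have TF: "T_op (k - 1) F \<in> PV {1..k}" using F k by (intro T_op_PV) auto
  have "kap2 0 k S (twist 0 T) (\<theta> (T_op (k - 1) F)) =
      kap2 0 k S (twist 0 T) (\<theta> F) + kap2 0 k T S (\<theta> F) - kap2 0 k S T (\<theta> F)"
    by (rule kap2_T_op[OF _ ST \<theta> Fyp _ _ \<theta>s]) (use k in \<open>auto simp: \<theta>y\<close>)
  also have "\<dots> = qk * kap2 0 k Aser (twist 0 S) (\<theta> F)"
  proof (rule kap2_key_identity[OF _ B a is_hom_yp[OF \<theta> Fyp]])
    show "S = fps_const ty1 * fps_X * (Aser * geo ty1)" by (simp only: S_def Sser_def ac_simps)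
    show "T = Aser * geo ty1 * lin (qk * ty1)" by (simp only: T_def ac_simps)
    show "Aser = Aser * geo ty1 * lin ty1" by (simp only: mult.assoc geo_lin mult_1_right)
  qed (use k in auto)
  finally have "kap2 0 k S (twist 0 T) (\<theta> (T_op (k - 1) F)) = qk * kap2 0 k Aser (twist 0 S) (\<theta> F)" .
  then show ?thesis
    unfolding C[OF TF] D S_def[symmetric] T_def[symmetric] by (simp add: ac_simps)
qed

text \<open>Both sides extract coefficients of the same polynomial \<open>N\<close>, in which y_1
  and y_2 occur only through the symmetric X + (q - 1)(t y_1 + t y_2 - w). Hence s_1 only replaces
  the series \<open>U\<close> by \<open>U'\<close>, and the relation reduces to an identity between
  series.\<close>

lemma T_op_Cst_dplus_star:
  assumes k: "1 \<le> k" and F: "F \<in> PV {1..k}"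
  shows "T_op 1 (dplus_star k (Cst k F)) = qk * Cst (k + 1) (dplus_star k F)"
proof -
  define \<eta> where "\<eta> = yhom (\<lambda>n. sconst (psym n) + dq n ty1) (\<lambda>i. if i = 0 then yv 0 else yv (i + 1))"
  have \<eta>: "is_hom \<eta>" unfolding \<eta>_def by (rule is_hom_yhom) auto
  have \<eta>p: "\<eta> (sconst (psym n)) = sconst (psym n) + dq n ty1" if "n \<ge> 1" for n
    using that by (simp add: \<eta>_def yhom_sconst sym_hom_psym)
  have \<eta>y: "\<eta> (yv i) = (if i = 0 then yv 0 else yv (i + 1))" for i
    by (simp add: \<eta>_def yhom_yv)
  define ty2 where "ty2 = kconst tv * yv 2"
  have [simp]: "ty2 \<in> yp" by (simp add: ty2_def)
  note p = is_hom_dplus_star[of k] and P = is_hom_Psi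
  note s = is_hom_s_op[of 1] is_hom_s_op[of 1, simplified]
  define N where "N = Psi (k + 1) (dplus_star k F)"
  define U where "U = fps_const ty2 * fps_X * geo ty2 * (Aser * lin (qk * ty1) * geo ty1)"
  define U' where "U' = fps_const ty1 * fps_X * geo ty1 * (Aser * lin (qk * ty2) * geo ty2)"
  have F': "dplus_star k F \<in> PV {1..k + 1}" by (rule dplus_star_PV[OF F])
  have Nyp: "N \<in> yp" unfolding N_def by (rule is_hom_yp[OF P PV_yp[OF F']])
  have over: "U \<in> fps_over (UNIV - {0})" "U' \<in> fps_over (UNIV - {0})"
    by (auto simp: U_def U'_def ty2_def)
  have K: "kap 0 S N \<in> yp" if "S \<in> fps_over (UNIV - {0})" for S
    using Nyp that by (intro kap_into) (auto intro: fps_over_nth[OF fps_over_mono])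
  have D: "dplus_star k (kap 0 (Sser ty1) (Psi k F)) = kap 0 (fmap (dplus_star k) (Sser ty1)) (\<eta> (Psi k F))"
  proof (rule is_hom_kap[OF p \<eta> Psi_PV[OF F k]])
    show "dplus_star k H = \<eta> H" if "H \<in> PV ({0..k} - {0})" for H
      by (rule is_hom_eqI[OF p \<eta> that]) (auto simp: hom_gens \<eta>p \<eta>y)
    show "\<eta> H \<in> PV (UNIV - {0})" if "H \<in> PV ({0..k} - {0})" for H
      by (rule is_hom_into[OF \<eta> that]) (auto simp: \<eta>p \<eta>y)
  qed (auto simp: \<eta>y intro: fps_over_nth)
  have "fmap (dplus_star k) Aser = Aser * lin (qk * ty1) * geo ty1"
    by (rule fmap_Aser_plus[OF p]) (auto simp: dplus_star_psym)
  moreover have "dplus_star k ty1 = ty2"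
    using k by (simp add: is_hom_simps[OF p] dplus_star_yv ty2_def numeral_2_eq_2)
  ultimately have U: "fmap (dplus_star k) (Sser ty1) = U"
    by (subst fmap_Sser[OF p]) (auto simp: U_def)
  have "\<eta> (Psi k F) = N"
    unfolding N_def
    by (rule is_hom_eqI[OF is_hom_comp[OF \<eta> P] is_hom_comp[OF P p] F])
       (use k in \<open>auto simp: hom_gens \<eta>p \<eta>y hom_gens is_hom_simps[OF \<eta>]
         is_hom_simps[OF P]\<close>)
  with D U have D: "dplus_star k (kap 0 (Sser ty1) (Psi k F)) = kap 0 U N" by (simp only:)
  have "s_op (Suc 0) (Psi (k + 1) (dplus_star k F)) = Psi (k + 1) (dplus_star k F)"
    by (rule is_hom_eqI[OF is_hom_comp[OF s(2) is_hom_comp[OF P p]] is_hom_comp[OF P p] F])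
       (use k in \<open>auto simp: hom_gens s_op_gens
         is_hom_simps[OF s(2)]
         is_hom_simps[OF P]\<close>)
  then have sN: "s_op 1 N = N" by (simp add: N_def)
  have s2: "s_op 1 ty1 = ty2" "s_op 1 ty2 = ty1"
    by (simp_all add: ty2_def is_hom_simps[OF s(2)] s_op_yv numeral_2_eq_2)
  have sA: "fmap (s_op 1) Aser = Aser" by (rule fmap_id) (rule s_op_Aser)
  have sU: "fmap (s_op 1) U = U'"
    unfolding U_def U'_def
    by (simp add: fmap_mult[OF s(2)] fmap_const[OF s(2)] fmap_X[OF s(2)] fmap_geo[OF s(2)] fmap_lin[OF s(2)]
        sA[simplified] is_hom_mult[OF s(2), of "qk"] is_hom_kconst[OF s(2)] s2[simplified])
  have sK: "s_op 1 (kap 0 U N) = kap 0 U' N"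
  proof -
    have "s_op 1 (kap 0 U N) = kap 0 (fmap (s_op 1) U) (s_op 1 N)"
    proof (rule is_hom_kap[OF s(1) s(1) Nyp _ refl])
      show "s_op 1 H \<in> PV (UNIV - {0})" if "H \<in> PV (UNIV - {0})" for H
        by (rule s_op_PV[OF that]) auto
    qed (use over in \<open>auto simp: s_op_yv intro: fps_over_nth[OF fps_over_mono]\<close>)
    then show ?thesis by (simp only: sU sN)
  qed
  \<comment> \<open>Without the common factor \<open>Z\<close> both sides are linear polynomials in
    the series variable, so only two coefficients have to agree.\<close>
  have series: "fps_const ((yv 2 - yv 1) * qk) * Sser ty1 =
      fps_const (kconst (qv - 1) * yv 1) * U + fps_const (yv 2 - qk * yv 1) * U'"
  proof -
    define Z where "Z = fps_X * geo ty1 * geo ty2 * Aser"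
    have "Sser ty1 = fps_const ty1 * fps_X * geo ty1 * Aser * (geo ty2 * lin ty2)"
      by (simp add: Sser_def geo_lin)
    also have "\<dots> = fps_const ty1 * lin ty2 * Z" by (simp only: Z_def ac_simps)
    finally have "fps_const ((yv 2 - yv 1) * qk) * Sser ty1 =
        (fps_const ((yv 2 - yv 1) * qk) * (fps_const ty1 * lin ty2)) * Z" by (simp only: ac_simps)
    also have "fps_const ((yv 2 - yv 1) * qk) * (fps_const ty1 * lin ty2) =
        fps_const (kconst (qv - 1) * yv 1) * (fps_const ty2 * lin (qk * ty1)) +
        fps_const (yv 2 - qk * yv 1) * (fps_const ty1 * lin (qk * ty2))"
      by (rule fps_ext) (simp add: lin_nth ty2_def kconst_diff algebra_simps)
    finally show ?thesis
      by (simp only: U_def U'_def Z_def distrib_right) (simp only: ac_simps)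
  qed
  have "T_op 1 (kap 0 U N) = qk * kap 0 (Sser ty1) N"
  proof (rule T_op_unique)
    have "(yv 2 - yv 1) * qk * kap 0 (Sser ty1) N =
        kconst (qv - 1) * yv 1 * kap 0 U N + (yv 2 - qk * yv 1) * kap 0 U' N"
      unfolding kap_series_const[symmetric] series kap_series_add ..
    then show "(yv (1 + 1) - yv 1) * (qk * kap 0 (Sser ty1) N) =
        kconst (qv - 1) * yv 1 * kap 0 U N + (yv (1 + 1) - qk * yv 1) * s_op 1 (kap 0 U N)"
      unfolding sK one_add_one by (simp only: mult.assoc)
  qed
  moreover have "dplus_star k (Cst k F) = kconst (qv - 1) * kap 0 U N"
  proof -
    have "kap 0 (Sser ty1) (Psi k F) \<in> yp"
      by (rule kap_into[OF Psi_PV[OF F k]]) (auto intro: fps_over_nth)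
    then show ?thesis by (simp only: Cst_eq[OF k F] dplus_star_kconst D)
  qed
  moreover have "Cst (k + 1) (dplus_star k F) = kconst (qv - 1) * kap 0 (Sser ty1) N"
    unfolding N_def by (rule Cst_eq[OF _ F']) simp
  ultimately show ?thesis
    by (simp add: T_op_kconst K[OF over(1)] ac_simps)
qed

section \<open>Passing C through the plethystic part of d_+\<close>

lemma Sser_nth: "fps_nth (Sser a) 0 = 0" "fps_nth (Sser a) 1 = a"
  by (simp_all add: Sser_def mult.assoc geo_def Aser_0)

text \<open>The added (q - 1) y_{k+1} becomes (q - 1) w and cancels the - (q - 1) w of
  \<open>Psi\<close>, so the bound variable disappears.\<close>

lemma Psi_taup:
  assumes "F \<in> PV {1..k}"
  shows "Psi (k + 1) (taup (k + 1) F) = dplus_star k F"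
  by (rule is_hom_eqI[OF is_hom_comp[OF is_hom_Psi is_hom_taup] is_hom_dplus_star assms])
     (auto simp: hom_gens is_hom_simps[OF is_hom_Psi]
       hom_gens)

lemma Cst_taup:
  assumes F: "F \<in> PV {1..k}"
  shows "Cst (k + 1) (taup (k + 1) F) = kconst (qv - 1) * (dplus_star k F * ty1)"
proof -
  have "taup (k + 1) F \<in> PV {1..k + 1}"
    by (rule taup_PV) (auto intro: PV_mono[OF F])
  \<comment> \<open>A polynomial free of w only meets the first coefficient of the series, which is
    t y_1.\<close>
  moreover have "kap 0 (Sser ty1) (dplus_star k F) = dplus_star k F * ty1"
    using kap_const[OF dplus_star_PV[OF F], of 0 "Sser ty1"] by (simp only: Sser_nth) simp
  ultimately show ?thesis by (simp only: Cst_eq[of "k + 1"] le_add2 Psi_taup[OF F])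
qed

text \<open>With y = y_{k+1} and D the image of the divided difference, the polynomials on the two
  sides are A + (w - q y) D and A + (w - y) D, where A is free of w. The substitution outside C
  multiplies the series by (w - q y) / (w - y), which exactly compensates the difference in the
  second summand.\<close>

lemma Cst_T_op_taup:
  assumes k: "1 \<le> k" and F: "F \<in> PV {1..k}"
  shows "Cst (k + 1) (T_op k (taup (k + 1) F)) = taup (k + 1) (Cst k F)"
proof -
  note P = is_hom_Psi and t = is_hom_taup
  define G where "G = taup (k + 1) F"
  define y where "y = yv (k + 1)"
  have y [simp]: "y \<in> PV (UNIV - {0})" by (simp add: y_def)
  have G: "G \<in> PV {1..k + 1}" unfolding G_def by (rule taup_PV) (auto intro: PV_mono[OF F])
  have Gyp: "G \<in> yp" by (rule PV_yp[OF G])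
  have D: "ddiff k G \<in> yp" using Gyp by (auto intro: ddiff_PV)
  have PD: "Psi (k + 1) (ddiff k G) \<in> yp" by (rule is_hom_yp[OF P D])
  have sG: "s_op k G \<in> yp" by (rule is_hom_yp[OF is_hom_s_op Gyp])
  have Py: "Psi (k + 1) (yv (k + 1)) = yv 0" "Psi (k + 1) (yv k) = y" by (simp_all add: Psi_yv y_def)
  have T: "Psi (k + 1) (T_op k G) = Psi (k + 1) G + (yv 0 - qk * y) * Psi (k + 1) (ddiff k G)"
    unfolding T_op_ddiff[OF Gyp]
    by (simp only: is_hom_simps[OF P] Py Gyp D
        PV_yv UNIV_I PV_diff PV_mult PV_kconst)
  have "(yv 0 - y) * Psi (k + 1) (ddiff k G) = Psi (k + 1) ((yv (k + 1) - yv k) * ddiff k G)"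
    by (simp only: is_hom_simps[OF P] Py D PV_yv UNIV_I PV_diff)
  also have "\<dots> = Psi (k + 1) (s_op k G) - Psi (k + 1) G"
    unfolding ddiff_eq[OF Gyp] by (simp only: is_hom_diff[OF P] Gyp sG)
  also have "Psi (k + 1) (s_op k G) = taup (k + 1) (Psi k F)"
    unfolding G_def
    by (rule is_hom_eqI[OF is_hom_comp[OF P is_hom_comp[OF is_hom_s_op t]] is_hom_comp[OF t P] F])
       (use k in \<open>auto simp: hom_gens s_op_gens hom_gens is_hom_simps[OF is_hom_s_op] is_hom_simps[OF P]
         is_hom_simps[OF t]\<close>)
  finally have E: "taup (k + 1) (Psi k F) = Psi (k + 1) G + (yv 0 - y) * Psi (k + 1) (ddiff k G)"
    by (simp add: algebra_simps)
  define S where "S = Sser ty1 * lin (qk * y) * geo y"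
  have S: "S * (1 - fps_const y * fps_X) = Sser ty1 * (1 - fps_const (qk * y) * fps_X)"
    unfolding S_def lin_def[symmetric] by (simp only: mult.assoc geo_lin mult_1_right)
  \<comment> \<open>The part free of w sees only this coefficient. It is unchanged because
    \<open>Sser ty1\<close> has no constant term and the extra factor starts with 1.\<close>
  have S1: "fps_nth S 1 = fps_nth (Sser ty1) 1"
  proof -
    have 0: "fps_nth S 0 = 0" by (simp add: S_def Sser_nth)
    show ?thesis
      using arg_cong[OF S[folded lin_def], of "\<lambda>f. fps_nth f (Suc 0)"]
      by (simp only: mult_lin_nth 0 Sser_nth(1)) simp
  qed
  have N: "Psi k F \<in> yp" by (rule is_hom_yp[OF P PV_yp[OF F]])
  have "taup (k + 1) (kap 0 (Sser ty1) (Psi k F)) = kap 0 (fmap (taup (k + 1)) (Sser ty1)) (taup (k + 1) (Psi k F))"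
  proof (rule is_hom_kap[OF t t N _ refl])
    show "taup (k + 1) H \<in> PV (UNIV - {0})" if "H \<in> PV (UNIV - {0})" for H
      using that by (intro taup_PV) auto
  qed (auto simp: vpleth_yv intro: fps_over_nth)
  moreover have "fmap (taup (k + 1)) Aser = Aser * lin (qk * y) * geo y"
    unfolding y_def by (rule fmap_Aser_plus[OF t]) (rule taup_psym)
  then have "fmap (taup (k + 1)) (Sser ty1) = S"
    by (simp add: fmap_Sser[OF t] is_hom_simps[OF t] vpleth_yv)
       (simp add: S_def Sser_def mult.assoc)
  ultimately have R: "taup (k + 1) (kap 0 (Sser ty1) (Psi k F)) = kap 0 S (taup (k + 1) (Psi k F))" by simp
  have "kap 0 S ((yv 0 - y) * Psi (k + 1) (ddiff k G)) =
      kap 0 (Sser ty1) ((yv 0 - qk * y) * Psi (k + 1) (ddiff k G))"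
    by (rule kap_linear_factor[OF S y _ _ PD]) auto
  moreover have "kap 0 S (Psi (k + 1) G) = kap 0 (Sser ty1) (Psi (k + 1) G)"
    unfolding G_def Psi_taup[OF F] using kap_const[OF dplus_star_PV[OF F], of 0] S1 by simp
  ultimately have "kap 0 S (taup (k + 1) (Psi k F)) = kap 0 (Sser ty1) (Psi (k + 1) (T_op k G))"
    unfolding E T kap_add by (rule arg_cong2[of _ _ _ _ "(+)", rotated])
  moreover have "T_op k G \<in> PV {1..k + 1}" using k G by (intro T_op_PV) auto
  moreover have "kap 0 (Sser ty1) (Psi k F) \<in> yp"
    by (rule kap_into[OF N]) (auto intro: fps_over_nth)
  moreover have "1 \<le> k + 1" by simp
  ultimately show ?thesis
    by (simp only: Cst_eq[of "k + 1"] Cst_eq[OF k F] is_hom_simps[OF t] R PV_kconst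
        flip: G_def)
qed

section \<open>The operators by which the elements z act\<close>

lemma T_op_diff:
  assumes "P \<in> yp" "Q \<in> yp"
  shows "T_op i (P - Q) = T_op i P - T_op i Q"
proof -
  have "T_op i (P + kconst (-1) * Q) = T_op i P + kconst (-1) * T_op i Q"
    using assms by (simp add: T_op_add T_op_kconst del: kconst_uminus)
  then show ?thesis by (simp add: kconst_uminus)
qed

lemma dminus_V: "1 \<le> k \<Longrightarrow> F \<in> PV {1..k} \<Longrightarrow> dminus k F \<in> PV {1..k - 1}"
  by (rule PV_mono[OF dminus_PV]) auto

lemma Cst_PV:
  assumes "1 \<le> k" "F \<in> PV {1..k}"
  shows "Cst k F \<in> PV {1..k}"
  unfolding Cst_def
proof (rule PV_diff)
  show "dplus_star (k - 1) (dminus k F) \<in> PV {1..k}"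
    using dplus_star_PV[OF dminus_V[OF assms]] assms(1) by simp
  show "dminus (k + 1) (dplus_star k F) \<in> PV {1..k}"
    using dminus_V[OF _ dplus_star_PV[OF assms(2)]] by simp
qed

lemma Cst_T_op:
  assumes i: "1 \<le> i" "i + 1 < k" and F: "F \<in> PV {1..k}"
  shows "Cst k (T_op i F) = T_op (i + 1) (Cst k F)"
proof -
  have k: "1 \<le> k" using i by simp
  note Fy = PV_yp[OF F] and D = dminus_V[OF k F] and S = dplus_star_PV[OF F]
  have yp: "dplus_star (k - 1) (dminus k F) \<in> yp" "dminus (k + 1) (dplus_star k F) \<in> yp"
    by (intro PV_yp[OF dplus_star_PV[OF D]]) (intro PV_yp[OF dminus_V[OF _ S]], simp)
  have "dplus_star (k - 1) (dminus k (T_op i F)) = T_op (i + 1) (dplus_star (k - 1) (dminus k F))"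
    using i by (simp only: dminus_T_op[OF Fy i(2)], intro dplus_star_T_op[OF D]) auto
  moreover have "dminus (k + 1) (dplus_star k (T_op i F)) = T_op (i + 1) (dminus (k + 1) (dplus_star k F))"
    using i by (simp only: dplus_star_T_op[OF F i(1)] Suc_eq_plus1[symmetric] Suc_lessD, simp)
      (rule dminus_T_op[OF PV_yp[OF S], simplified], simp)
  ultimately show ?thesis by (simp only: Cst_def T_op_diff[OF yp])
qed

section \<open>Words in the T_i\<close>

lemma foldr_T_op_PV:
  "F \<in> PV I \<Longrightarrow> (\<And>i. i \<in> set is \<Longrightarrow> i \<in> I \<and> i + 1 \<in> I) \<Longrightarrow> foldr T_op is F \<in> PV I"
  by (induction "is") (auto intro: T_op_PV)

lemma foldr_T_op_yp: "F \<in> yp \<Longrightarrow> foldr T_op is F \<in> yp"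
  by (rule foldr_T_op_PV) auto

lemma foldr_T_op_kconst: "F \<in> yp \<Longrightarrow> foldr T_op is (kconst c * F) = kconst c * foldr T_op is F"
  by (induction "is") (simp_all add: T_op_kconst foldr_T_op_yp)

lemma foldr_T_op_commute:
  "F \<in> yp \<Longrightarrow> (\<And>i. i \<in> set is \<Longrightarrow> i + 1 < j) \<Longrightarrow> foldr T_op is (T_op j F) = T_op j (foldr T_op is F)"
  by (induction "is") (auto simp: foldr_T_op_yp intro: T_op_commute)


text \<open>T_i commutes with the factors beyond T_{i+1}, a braid move turns T_i T_{i+1} T_i into
  T_{i+1} T_i T_{i+1}, and T_{i+1} commutes with T_1, ..., T_{i-1}. With n = 0 the word ends in T_i
  T_{i+1}, the shortest case in which the braid move is possible.\<close>

lemma foldr_upt_T_op_aux: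
  assumes "F \<in> yp" "1 \<le> i"
  shows "foldr T_op [1..<i + n + 2] (T_op i F) = T_op (i + 1) (foldr T_op [1..<i + n + 2] F)"
  using assms(1)
proof (induction n arbitrary: F)
  case 0
  have u: "[1..<i + 0 + 2] = [1..<i] @ [i, i + 1]"
    using assms(2) by (simp add: upt_rec[of i] upt_conv_Cons)
  have "foldr T_op [1..<i] (T_op i (T_op (i + 1) (T_op i F))) =
      foldr T_op [1..<i] (T_op (i + 1) (T_op i (T_op (i + 1) F)))"
    by (simp only: T_op_braid[OF 0])
  also have "\<dots> = T_op (i + 1) (foldr T_op [1..<i] (T_op i (T_op (i + 1) F)))"
    by (rule foldr_T_op_commute) (use 0 in \<open>auto intro!: T_op_yp\<close>)
  finally show ?case unfolding u by simp
next
  case (Suc n)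
  have u: "[1..<i + Suc n + 2] = [1..<i + n + 2] @ [i + n + 2]" by simp
  have "T_op (i + n + 2) (T_op i F) = T_op i (T_op (i + n + 2) F)"
    by (rule T_op_commute[OF Suc.prems]) simp
  then show ?case
    unfolding u using Suc.IH[OF T_op_yp[OF Suc.prems, of "i + n + 2"]] by simp
qed

lemma foldr_upt_T_op:
  assumes "F \<in> yp" "1 \<le> i" "i < k"
  shows "foldr T_op [1..<k + 1] (T_op i F) = T_op (i + 1) (foldr T_op [1..<k + 1] F)"
proof -
  have "k + 1 = i + (k - i - 1) + 2" using assms(3) by simp
  then show ?thesis using foldr_upt_T_op_aux[OF assms(1,2), of "k - i - 1"] by simp
qed

text \<open>The two reduced words \<open>s\<^sub>k \<dots> s\<^sub>1 \<dots> s\<^sub>k\<close> and \<open>s\<^sub>1 \<dots> s\<^sub>k \<dots> s\<^sub>1\<close> of a reflection.\<close>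

lemma reflection_words:
  assumes "F \<in> yp" "1 \<le> k"
  shows "foldr T_op (rev [1..<k + 1]) (foldr T_op [2..<k + 1] F) =
    foldr T_op [1..<k + 1] (foldr T_op (rev [1..<k]) F)"
proof -
  have "foldr T_op [1..<k + 1] (foldr T_op (rev [1..<m + 1]) F) =
      foldr T_op (rev [2..<m + 2]) (foldr T_op [1..<k + 1] F)" if "m < k" for m
    using that
  proof (induction m)
    case (Suc m)
    have "rev [1..<Suc m + 1] = Suc m # rev [1..<m + 1]" "rev [2..<Suc m + 2] = (Suc m + 1) # rev [2..<m + 2]"
      by simp_all
    then show ?case
      using Suc foldr_upt_T_op[OF foldr_T_op_yp[OF assms(1)], of "Suc m" k "rev [1..<m + 1]"]
      by (simp only: foldr.simps o_apply)
  qed simp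
  from this[of "k - 1"] have "foldr T_op [1..<k + 1] (foldr T_op (rev [1..<k]) F) =
      foldr T_op (rev [2..<k + 1]) (foldr T_op [1..<k + 1] F)"
    using assms(2) by simp
  moreover have "[1..<k + 1] = 1 # [2..<k + 1]" using assms(2) by (simp add: upt_rec numeral_2_eq_2)
  ultimately show ?thesis by simp
qed

section \<open>Operators realizing the z_i, and their relations with d_+\<close>

definition z_const :: K where "z_const = 1 / (inverse qv - 1)"

text \<open>The normalization of z times the factor q - 1 in the formula for C is -q. This is the
  source of the sign and of one factor q in the relation for z_1 d_+; the remaining k factors come
  from the recursion for the z_i.\<close>

lemma z_const_eq: "z_const * qv ^ k * (qv - 1) = - (qv ^ (k + 1))"
proof -
  have "z_const * (qv - 1) = - qv"
  proof -
    have "inverse qv - 1 = (1 - qv) / qv" by (simp add: divide_simps)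
    moreover have "1 - qv \<noteq> 0" using qv_neq_1 by (metis eq_iff_diff_eq_0)
    ultimately show ?thesis by (simp add: z_const_def divide_simps) (simp add: algebra_simps)
  qed
  then have "qv ^ k * (z_const * (qv - 1)) = qv ^ k * - qv" by simp
  then show ?thesis by (simp add: algebra_simps)
qed

text \<open>The recursion of \<open>z_elem\<close> with generators replaced by operators:
  \<open>aT\<close> becomes \<open>T_inv\<close>, and \<open>aT_inv\<close> becomes
  \<open>T_op\<close>.\<close>

function z_act :: "nat \<Rightarrow> nat \<Rightarrow> yring \<Rightarrow> yring" where
  "z_act k i F =
     (if i < k then qk * T_inv i (z_act k (i + 1) (T_inv i F))
      else kconst z_const * foldr T_op (rev [1..<k]) (Cst k F))"
  by auto
termination by (relation "measure (\<lambda>(k, i, F). k - i)") auto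

declare z_act.simps [simp del]

lemma z_act_PV:
  assumes "1 \<le> i" "i \<le> k" "F \<in> PV {1..k}"
  shows "z_act k i F \<in> PV {1..k}"
  using assms
proof (induction k i F rule: z_act.induct)
  case (1 k i F)
  show ?case
  proof (cases "i < k")
    case True
    then have i: "i \<in> {1..k}" "i + 1 \<in> {1..k}" using 1 by auto
    have "z_act k (i + 1) (T_inv i F) \<in> PV {1..k}"
      using True 1 by (intro 1(1) T_inv_PV i) auto
    then show ?thesis
      using True 1(2) by (subst z_act.simps) (auto intro!: PV_mult T_inv_PV)
  next
    case False
    have "Cst k F \<in> PV {1..k}" using 1 by (intro Cst_PV) auto
    with False show ?thesis
      using 1 by (subst z_act.simps) (auto intro!: PV_mult foldr_T_op_PV)
  qed
qed

lemma taup_T_op: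
  assumes "F \<in> yp" "i < j"
  shows "taup (j + 1) (T_op i F) = T_op i (taup (j + 1) F)"
proof (rule is_hom_T_op[OF is_hom_taup assms(1)])
  show "taup (j + 1) (s_op i F) = s_op i (taup (j + 1) F)"
    by (rule is_hom_eqI[OF is_hom_comp[OF is_hom_taup is_hom_s_op] is_hom_comp[OF is_hom_s_op is_hom_taup] assms(1)])
       (use assms(2) in \<open>auto simp: hom_gens s_op_gens is_hom_simps[OF is_hom_s_op]\<close>)
qed (simp_all add: vpleth_yv)

lemma dplus_T_op:
  assumes "F \<in> yp" "1 \<le> i" "i < k"
  shows "dplus k (T_op i F) = T_op (i + 1) (dplus k F)"
  unfolding dplus_def taup_T_op[OF assms(1,3)]
  by (rule foldr_upt_T_op[OF is_hom_yp[OF is_hom_taup assms(1)] assms(2,3)])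

lemma T_inv_yp: "F \<in> yp \<Longrightarrow> T_inv i F \<in> yp"
  by (simp add: T_inv_PV)

lemma dplus_yp: "F \<in> yp \<Longrightarrow> dplus k F \<in> yp"
  unfolding dplus_def by (intro foldr_T_op_yp is_hom_yp[OF is_hom_taup])

lemma dplus_T_inv:
  assumes "F \<in> yp" "1 \<le> i" "i < k"
  shows "dplus k (T_inv i F) = T_inv (i + 1) (dplus k F)"
proof -
  have "T_inv (i + 1) (dplus k F) = T_inv (i + 1) (T_op (i + 1) (dplus k (T_inv i F)))"
    using dplus_T_op[OF T_inv_yp[OF assms(1), of i] assms(2,3)] T_op_T_inv(1)[OF assms(1), of i] by simp
  then show ?thesis by (simp only: T_op_T_inv(2)[OF dplus_yp[OF T_inv_yp[OF assms(1)]]])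
qed

lemma dplus_kconst: "F \<in> yp \<Longrightarrow> dplus k (kconst c * F) = kconst c * dplus k F"
  by (simp add: dplus_def is_hom_simps[OF is_hom_taup] foldr_T_op_kconst
      is_hom_yp[OF is_hom_taup] del: upt_Suc)

lemma foldr_T_op_taup:
  "F \<in> yp \<Longrightarrow> (\<And>i. i \<in> set is \<Longrightarrow> i < k) \<Longrightarrow> taup (k + 1) (foldr T_op is F) = foldr T_op is (taup (k + 1) F)"
  by (induction "is") (simp_all add: taup_T_op[simplified] foldr_T_op_yp)

lemma Cst_foldr_T_op:
  assumes "F \<in> PV {1..k}" "m < k"
  shows "Cst k (foldr T_op [1..<m] F) = foldr T_op [2..<m + 1] (Cst k F)"
proof -
  have *: "Cst k (foldr T_op is F) = foldr T_op (map Suc is) (Cst k F)"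
    if "\<And>i. i \<in> set is \<Longrightarrow> 1 \<le> i \<and> i + 1 < k" for "is"
    using that
  proof (induction "is")
    case (Cons i "is")
    have "foldr T_op is F \<in> PV {1..k}"
      using Cons.prems by (intro foldr_T_op_PV assms(1)) fastforce
    then show ?case using Cons Cst_T_op[of i k "foldr T_op is F"] by simp
  qed simp
  have "map Suc [1..<m] = [2..<m + 1]" by (simp add: map_Suc_upt numeral_2_eq_2)
  then show ?thesis using *[of "[1..<m]"] assms(2) by auto
qed

lemma z_act_last_dplus:
  assumes k: "1 \<le> k" and F: "F \<in> PV {1..k}"
  shows "z_act (k + 1) (k + 1) (dplus k F) = dplus k (z_act k k F)"
proof -
  let ?C = "taup (k + 1) (Cst k F)"
  have tF: "taup (k + 1) F \<in> PV {1..k + 1}" by (rule taup_PV) (auto intro: PV_mono[OF F])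
  have Tt: "T_op k (taup (k + 1) F) \<in> PV {1..k + 1}" using k by (intro T_op_PV tF) auto
  have C: "Cst k F \<in> yp" by (rule PV_yp[OF Cst_PV[OF k F]])
  have tC: "?C \<in> yp" by (rule is_hom_yp[OF is_hom_taup C])
  \<comment> \<open>Only the last factor T_k takes part in C T_k \<tau> = \<tau> C; the factors T_1,
    ..., T_{k-1} pass C with their indices raised by one.\<close>
  have "[1..<k + 1] = [1..<k] @ [k]" using k by simp
  then have "dplus k F = foldr T_op [1..<k] (T_op k (taup (k + 1) F))"
    by (simp only: dplus_def foldr_append foldr.simps o_apply id_apply)
  then have "Cst (k + 1) (dplus k F) = foldr T_op [2..<k + 1] ?C"
    using Cst_foldr_T_op[OF Tt, of k] Cst_T_op_taup[OF k F] by simp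
  then have "z_act (k + 1) (k + 1) (dplus k F) =
      kconst z_const * foldr T_op (rev [1..<k + 1]) (foldr T_op [2..<k + 1] ?C)"
    by (subst z_act.simps) simp
  also have "\<dots> = kconst z_const * foldr T_op [1..<k + 1] (foldr T_op (rev [1..<k]) ?C)"
    by (simp only: reflection_words[OF tC k])
  also have "foldr T_op (rev [1..<k]) ?C = taup (k + 1) (foldr T_op (rev [1..<k]) (Cst k F))"
    by (rule foldr_T_op_taup[symmetric, OF C]) simp
  also have "kconst z_const * foldr T_op [1..<k + 1] \<dots> = dplus k (z_act k k F)"
    by (subst z_act.simps) (simp only: less_irrefl if_False dplus_kconst[OF foldr_T_op_yp[OF C]], simp only: dplus_def)
  finally show ?thesis .
qed

lemma z_act_dplus:
  assumes "1 \<le> i" "i \<le> k" "F \<in> PV {1..k}"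
  shows "z_act (k + 1) (i + 1) (dplus k F) = dplus k (z_act k i F)"
  using assms
proof (induction k i F rule: z_act.induct)
  case (1 k i F)
  show ?case
  proof (cases "i < k")
    case True
    have Fy: "F \<in> yp" by (rule PV_yp[OF 1(4)])
    have TF: "T_inv i F \<in> PV {1..k}" using True 1 by (intro T_inv_PV) auto
    have zy: "z_act k (i + 1) (T_inv i F) \<in> yp" using True TF by (intro PV_yp[OF z_act_PV]) auto
    have "z_act (k + 1) (i + 1) (dplus k F) =
        qk * T_inv (i + 1) (z_act (k + 1) (i + 1 + 1) (T_inv (i + 1) (dplus k F)))"
      using True by (subst z_act.simps) simp
    also have "T_inv (i + 1) (dplus k F) = dplus k (T_inv i F)"
      by (rule dplus_T_inv[symmetric, OF Fy 1(2) True])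
    also have "z_act (k + 1) (i + 1 + 1) (dplus k (T_inv i F)) = dplus k (z_act k (i + 1) (T_inv i F))"
      using True TF by (intro 1(1)) auto
    also have "T_inv (i + 1) \<dots> = dplus k (T_inv i (z_act k (i + 1) (T_inv i F)))"
      by (rule dplus_T_inv[symmetric, OF zy 1(2) True])
    also have "qk * \<dots> = dplus k (z_act k i F)"
      using True by (subst z_act.simps[of k i]) (simp add: dplus_kconst T_inv_yp zy[simplified])
    finally show ?thesis .
  next
    case False
    then show ?thesis using 1 z_act_last_dplus[of k F] by simp
  qed
qed

text \<open>Each recursion step cancels twice: its inner inverse removes the leftmost factor of T_i
  ... T_{k-1}, its outer one removes the leftmost factor of T_i ... T_1. A factor q is left
  over.\<close>

lemma z_act_foldr:
  assumes "F \<in> PV {1..k}" "1 \<le> i" "i \<le> k"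
  shows "z_act k i (foldr T_op [i..<k] F) = kconst (z_const * qv ^ (k - i)) * foldr T_op (rev [1..<i]) (Cst k F)"
  using assms(3,2)
proof (induction i rule: inc_induct)
  case base
  show ?case by (subst z_act.simps) simp
next
  case (step i)
  have k: "1 \<le> k" using step by simp
  have Fy: "F \<in> yp" and C: "Cst k F \<in> yp" using assms(1) Cst_PV[OF k assms(1)] by (auto intro: PV_yp)
  let ?G = "foldr T_op (rev [1..<i]) (Cst k F)"
  have "[i..<k] = i # [Suc i..<k]" using step by (simp add: upt_rec)
  then have "z_act k i (foldr T_op [i..<k] F) = qk * T_inv i (z_act k (Suc i) (foldr T_op [Suc i..<k] F))"
    using step by (subst z_act.simps) (simp add: T_op_T_inv foldr_T_op_yp Fy)
  also have "z_act k (Suc i) (foldr T_op [Suc i..<k] F) =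
      kconst (z_const * qv ^ (k - Suc i)) * foldr T_op (rev [1..<Suc i]) (Cst k F)"
    using step by simp
  also have "foldr T_op (rev [1..<Suc i]) (Cst k F) = T_op i ?G" using step by simp
  also have "T_inv i (kconst (z_const * qv ^ (k - Suc i)) * T_op i ?G) = kconst (z_const * qv ^ (k - Suc i)) * ?G"
    by (simp only: T_inv_kconst T_op_yp foldr_T_op_yp C T_op_T_inv)
  also have "qk * \<dots> = kconst (z_const * qv ^ (k - i)) * ?G"
  proof -
    have "qv ^ (k - i) = qv * qv ^ (k - Suc i)" using step by (metis Suc_diff_Suc power_Suc)
    then have "z_const * qv ^ (k - i) = qv * (z_const * qv ^ (k - Suc i))" by simp
    then show ?thesis by (simp only: kconst_mult mult.assoc)
  qed
  finally show ?case .
qed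

lemma z_act_first_dplus:
  assumes F: "F \<in> PV {1..k}"
  shows "z_act (k + 1) 1 (dplus k F) = - yv 1 * dplus_star k (kconst (tv * qv ^ (k + 1)) * F)"
proof -
  have tF: "taup (k + 1) F \<in> PV {1..k + 1}" by (rule taup_PV) (auto intro: PV_mono[OF F])
  have "z_act (k + 1) 1 (dplus k F) = kconst (z_const * qv ^ k) * Cst (k + 1) (taup (k + 1) F)"
    using z_act_foldr[OF tF, of 1] by (simp add: dplus_def del: upt_Suc)
  also have "\<dots> = kconst (z_const * qv ^ k * (qv - 1)) * (dplus_star k F * ty1)"
    unfolding Cst_taup[OF F] kconst_mult[of "z_const * qv ^ k"] by (simp only: mult.assoc)
  also have "\<dots> = - (kconst (qv ^ (k + 1)) * (dplus_star k F * ty1))"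
    unfolding z_const_eq kconst_uminus by simp
  also have "\<dots> = - yv 1 * (kconst (tv * qv ^ (k + 1)) * dplus_star k F)"
    unfolding kconst_mult[of tv] by (simp add: ac_simps del: power_Suc)
  finally show ?thesis unfolding dplus_star_kconst[OF PV_yp[OF F]] .
qed

text \<open>Plethysm fixes constants and T_i fixes s_i-invariants. So the last relation only asks
  that d_+^* fix 1.\<close>

lemma dplus_pow_eq_1: "dplus_pow m = 1"
proof (induction m)
  case (Suc m)
  have "foldr T_op is 1 = 1" for "is"
    by (induction "is") (simp_all add: T_op_invariant is_hom_1[OF is_hom_s_op])
  then show ?case using Suc by (simp add: dplus_def is_hom_1[OF is_hom_taup] del: upt_Suc)
qed simp

section \<open>The action of the path algebra\<close>

lemma T_inv_eqI: "P \<in> yp \<Longrightarrow> T_op i P = Q \<Longrightarrow> T_inv i Q = P"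
  using T_op_T_inv(2) by blast

text \<open>Multiplying the quadratic relation of T_i by the inverse square of T_i exchanges q and
  its inverse, as the parameter of A^* requires.\<close>

lemma T_inv_quadratic:
  assumes "P \<in> yp"
  shows "T_inv i (T_inv i P) = kconst (1 - inverse qv) * T_inv i P + kconst (inverse qv) * P"
proof -
  define y where "y = T_inv i (T_inv i P)"
  have y: "y \<in> yp" "T_op i y = T_inv i P" "T_op i (T_op i y) = P"
    using assms by (simp_all add: y_def T_inv_yp T_op_T_inv)
  have "kconst (inverse qv) * (qk * y) = y"
    by (simp flip: kconst_mult mult.assoc)
  moreover have "kconst (inverse qv) * (kconst (qv - 1) * T_op i y) = kconst (1 - inverse qv) * T_op i y"
    by (simp add: right_diff_distrib flip: kconst_mult mult.assoc)
  ultimately have "kconst (inverse qv) * T_op i (T_op i y) = y - kconst (1 - inverse qv) * T_op i y"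
    unfolding T_op_quadratic[OF y(1)] right_diff_distrib by simp
  then show ?thesis unfolding y(2) T_op_T_inv(1)[OF assms] y_def[symmetric] by simp
qed

lemma T_inv_braid:
  assumes "P \<in> yp"
  shows "T_inv i (T_inv (i + 1) (T_inv i P)) = T_inv (i + 1) (T_inv i (T_inv (i + 1) P))"
proof -
  define y where "y = T_inv i (T_inv (i + 1) (T_inv i P))"
  have y: "y \<in> yp" using assms by (simp add: y_def T_inv_yp)
  have "T_op i (T_op (i + 1) (T_op i y)) = P"
    using assms by (simp add: y_def T_inv_yp T_op_T_inv)
  then have P: "P = T_op (i + 1) (T_op i (T_op (i + 1) y))" by (simp only: T_op_braid[OF y])
  have "T_inv (i + 1) (T_inv i (T_inv (i + 1) P)) = y"
    unfolding P by (simp only: T_op_T_inv(2) T_op_yp y)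
  then show ?thesis by (simp only: y_def)
qed

lemma T_inv_commute:
  assumes "P \<in> yp" "i + 1 < j \<or> j + 1 < i"
  shows "T_inv i (T_inv j P) = T_inv j (T_inv i P)"
proof -
  define y where "y = T_inv i (T_inv j P)"
  have y: "y \<in> yp" using assms by (simp add: y_def T_inv_yp)
  have "T_op j (T_op i y) = P" using assms by (simp add: y_def T_inv_yp T_op_T_inv)
  then have P: "P = T_op i (T_op j y)" using T_op_commute[OF y assms(2)] by simp
  have "T_inv j (T_inv i P) = y" unfolding P by (simp only: T_op_T_inv(2) T_op_yp y)
  then show ?thesis by (simp only: y_def)
qed

lemma dminus_yp: "F \<in> yp \<Longrightarrow> dminus k F \<in> yp"
  using dminus_PV[of F UNIV k] by (auto intro: PV_yp)

lemma dminus_T_inv: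
  assumes "F \<in> yp" "i + 1 < k"
  shows "T_inv i (dminus k F) = dminus k (T_inv i F)"
  using dminus_T_op[OF T_inv_yp[OF assms(1), of i] assms(2)] T_op_T_inv(1)[OF assms(1), of i]
  by (intro T_inv_eqI dminus_yp T_inv_yp assms) simp

lemma dplus_star_T_inv:
  assumes "F \<in> PV {1..k}" "1 \<le> i" "i < k"
  shows "dplus_star k (T_inv i F) = T_inv (i + 1) (dplus_star k F)"
proof (rule T_inv_eqI[symmetric])
  have T: "T_inv i F \<in> PV {1..k}" using assms by (intro T_inv_PV) auto
  show "dplus_star k (T_inv i F) \<in> yp" by (rule is_hom_yp[OF is_hom_dplus_star PV_yp[OF T]])
  show "T_op (i + 1) (dplus_star k (T_inv i F)) = dplus_star k F"
    unfolding dplus_star_T_op[OF T assms(2,3), symmetric] T_op_T_inv(1)[OF PV_yp[OF assms(1)]] ..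
qed

section \<open>Paths as operators\<close>

text \<open>\<open>Dm k\<close> is named after its target and starts at k + 1, whereas
  \<open>dminus\<close> is indexed by its source.\<close>

fun arrow_op :: "arrow \<Rightarrow> yring \<Rightarrow> yring" where
  "arrow_op (Dp k) = dplus_star k"
| "arrow_op (Dm k) = dminus (k + 1)"
| "arrow_op (Tl k i) = T_inv i"

lemma arrow_op_PV: "valid_arrow a \<Longrightarrow> F \<in> PV {1..src a} \<Longrightarrow> arrow_op a F \<in> PV {1..tgt a}"
proof (cases a)
  case (Dm k)
  then show "F \<in> PV {1..src a} \<Longrightarrow> arrow_op a F \<in> PV {1..tgt a}"
    using dminus_V[of "k + 1" F] by simp
qed (auto intro: dplus_star_PV[simplified] T_inv_PV)

lemma arrow_op_add: "F \<in> yp \<Longrightarrow> G \<in> yp \<Longrightarrow> arrow_op a (F + G) = arrow_op a F + arrow_op a G"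
  by (cases a) (simp_all add: is_hom_add[OF is_hom_dplus_star] dminus_add T_inv_add)

lemma arrow_op_kconst: "F \<in> yp \<Longrightarrow> arrow_op a (kconst c * F) = kconst c * arrow_op a F"
  by (cases a) (simp_all add: dplus_star_kconst dminus_kconst T_inv_kconst)

abbreviation path_op :: "arrow list \<Rightarrow> yring \<Rightarrow> yring" where
  "path_op \<equiv> foldr arrow_op"

lemma arrow_op_yp: "F \<in> yp \<Longrightarrow> arrow_op a F \<in> yp"
  by (cases a) (simp_all add: is_hom_yp[OF is_hom_dplus_star] dminus_yp T_inv_yp)

lemma path_op_yp: "F \<in> yp \<Longrightarrow> path_op as F \<in> yp"
  by (induction as) (simp_all add: arrow_op_yp)

lemma path_op_PV: "is_path k as \<Longrightarrow> F \<in> PV {1..k} \<Longrightarrow> path_op as F \<in> PV {1..path_end k as}"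
proof (induction as)
  case (Cons a as)
  then show ?case using arrow_op_PV[of a "path_op as F"] by simp
qed simp

lemma path_op_add: "F \<in> yp \<Longrightarrow> G \<in> yp \<Longrightarrow> path_op as (F + G) = path_op as F + path_op as G"
  by (induction as) (simp_all add: arrow_op_add path_op_yp)

lemma path_op_kconst: "F \<in> yp \<Longrightarrow> path_op as (kconst c * F) = kconst c * path_op as F"
  by (induction as) (simp_all add: arrow_op_kconst path_op_yp)

lemma path_op_0: "path_op as 0 = 0"
  using path_op_kconst[of 0 as 0] by simp

lemma lookup_vscale: "lookup (vscale c F) k = kconst c * lookup F k"
  by (simp add: vscale_def map.rep_eq when_def)

lemma vscale_add_right: "vscale c (F + G) = vscale c F + vscale c G"
  by (rule poly_mapping_eqI) (simp add: lookup_vscale lookup_add distrib_left)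

lemma vscale_add_left: "vscale (c + d) F = vscale c F + vscale d F"
  by (rule poly_mapping_eqI) (simp add: lookup_vscale lookup_add kconst_add distrib_right)

lemma vscale_vscale: "vscale c (vscale d F) = vscale (c * d) F"
  by (rule poly_mapping_eqI) (simp add: lookup_vscale kconst_mult mult.assoc)

lemma vscale_0 [simp]: "vscale c 0 = 0" "vscale 0 F = 0"
  by (rule poly_mapping_eqI, simp add: lookup_vscale)+

lemma vscale_1 [simp]: "vscale 1 F = F"
  by (rule poly_mapping_eqI) (simp add: lookup_vscale)

lemma vscale_single: "vscale c (single k F) = single k (kconst c * F)"
  by (rule poly_mapping_eqI) (simp add: lookup_vscale lookup_single when_def)

lemma Vstar_lookup: "F \<in> Vstar \<Longrightarrow> lookup F k \<in> PV {1..k}"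
  by (simp add: Vstar_def V_PV)

lemma Vstar_lookup_yp: "F \<in> Vstar \<Longrightarrow> lookup F k \<in> yp"
  by (rule PV_yp[OF Vstar_lookup])

lemma Vstar_add: "F \<in> Vstar \<Longrightarrow> G \<in> Vstar \<Longrightarrow> F + G \<in> Vstar"
  by (simp add: Vstar_def V_PV lookup_add)

lemma Vstar_vscale: "F \<in> Vstar \<Longrightarrow> vscale c F \<in> Vstar"
  by (simp add: Vstar_def V_PV lookup_vscale)

lemma Vstar_single: "F \<in> PV {1..k} \<Longrightarrow> single k F \<in> Vstar"
  by (simp add: Vstar_def V_PV lookup_single when_def)

lemma Vstar_0: "0 \<in> Vstar"
  by (simp add: Vstar_def V_PV)

definition act_path :: "path \<Rightarrow> (nat \<Rightarrow>\<^sub>0 yring) \<Rightarrow> (nat \<Rightarrow>\<^sub>0 yring)" where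
  "act_path p G = single (ptgt p) (path_op (parrows p) (lookup G (psrc p)))"

definition act_palg :: "palg \<Rightarrow> (nat \<Rightarrow>\<^sub>0 yring) \<Rightarrow> (nat \<Rightarrow>\<^sub>0 yring)" where
  "act_palg f G = (\<Sum>p\<in>keys f. vscale (lookup f p) (act_path p G))"

lemma is_path_parrows: "is_path (psrc p) (parrows p)"
  by transfer auto

lemma ptgt_eq: "ptgt p = path_end (psrc p) (parrows p)"
  by transfer auto

lemma act_path_Vstar: "G \<in> Vstar \<Longrightarrow> act_path p G \<in> Vstar"
  unfolding act_path_def ptgt_eq
  by (intro Vstar_single path_op_PV is_path_parrows Vstar_lookup)

lemma act_path_add: "F \<in> Vstar \<Longrightarrow> G \<in> Vstar \<Longrightarrow> act_path p (F + G) = act_path p F + act_path p G"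
  by (simp add: act_path_def lookup_add path_op_add Vstar_lookup_yp single_add)

lemma act_path_vscale: "F \<in> Vstar \<Longrightarrow> act_path p (vscale c F) = vscale c (act_path p F)"
  by (simp add: act_path_def lookup_vscale path_op_kconst Vstar_lookup_yp vscale_single)

lemma act_palg_superset: "finite S \<Longrightarrow> keys f \<subseteq> S \<Longrightarrow>
    act_palg f G = (\<Sum>p\<in>S. vscale (lookup f p) (act_path p G))"
  unfolding act_palg_def by (rule sum.mono_neutral_left) (auto simp: in_keys_iff)

lemma act_palg_0 [simp]: "act_palg 0 G = 0"
  by (simp add: act_palg_def)

lemma act_palg_single: "act_palg (single p c) G = vscale c (act_path p G)"
  by (subst act_palg_superset[of "{p}"]) auto

lemma act_palg_add: "act_palg (f + g) G = act_palg f G + act_palg g G"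
proof -
  let ?S = "keys f \<union> keys g"
  have "keys (f + g) \<subseteq> ?S" by (rule keys_add)
  then show ?thesis
    by (simp add: act_palg_superset[of ?S] lookup_add vscale_add_left sum.distrib)
qed

lemma pscale_single: "pscale c (single p d) = single p (c * d)"
  by (rule poly_mapping_eqI) (auto simp: lookup_single when_def)

lemma pscale_0: "pscale c 0 = 0"
  by (rule poly_mapping_eqI) simp

lemma act_palg_pscale: "act_palg (pscale c f) G = vscale c (act_palg f G)"
proof (induction f rule: palg_induct)
  case (2 p d)
  show ?case by (simp add: pscale_single act_palg_single vscale_vscale)
qed (simp_all add: pscale_0 pscale_add act_palg_add vscale_add_right)

lemma act_palg_diff: "act_palg (f - g) G = act_palg f G - act_palg g G"
  using act_palg_add[of "f - g" g G] by simp

lemma act_palg_Vstar: "G \<in> Vstar \<Longrightarrow> act_palg f G \<in> Vstar"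
  by (induction f rule: palg_induct)
     (simp_all add: Vstar_0 act_palg_add act_palg_single Vstar_add Vstar_vscale act_path_Vstar)

lemma act_palg_add_right: "F \<in> Vstar \<Longrightarrow> G \<in> Vstar \<Longrightarrow> act_palg f (F + G) = act_palg f F + act_palg f G"
  by (simp add: act_palg_def act_path_add vscale_add_right sum.distrib)

lemma act_palg_vscale: "F \<in> Vstar \<Longrightarrow> act_palg f (vscale c F) = vscale c (act_palg f F)"
  by (induction f rule: palg_induct)
     (simp_all add: act_palg_add act_palg_single act_path_vscale vscale_vscale vscale_add_right mult.commute)

lemma act_path_pcomp:
  assumes "psrc p = ptgt r"
  shows "act_path (pcomp p r) G = act_path p (act_path r G)"
proof -
  have "parrows (pcomp p r) = parrows p @ parrows r"
    using assms by transfer auto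
  then show ?thesis using assms by (simp add: act_path_def)
qed

text \<open>r leaves its result in the component of its target, and p reads a different one; this
  matches the zero product in \<open>pbasis_mult\<close>.\<close>

lemma act_path_not_comp: "psrc p \<noteq> ptgt r \<Longrightarrow> act_path p (act_path r G) = 0"
  by (simp add: act_path_def lookup_single path_op_0)

lemma act_palg_mult:
  assumes G: "G \<in> Vstar"
  shows "act_palg (f \<odot> g) G = act_palg f (act_palg g G)"
proof (induction f rule: palg_induct)
  case (2 p c)
  show ?case
  proof (induction g rule: palg_induct)
    case 1
    have "act_path p 0 = 0" by (simp add: act_path_def path_op_0)
    then show ?case by (simp add: act_palg_single)
  next
    case (2 r d)
    show ?case
      using act_path_Vstar[OF G, of r]
      by (simp add: pmult_single pbasis_mult_def act_palg_single act_path_vscale vscale_vscale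
          act_path_pcomp act_path_not_comp)
  next
    case (3 g h)
    then show ?case
      by (simp add: pmult_add_right act_palg_add act_palg_add_right[OF act_palg_Vstar[OF G] act_palg_Vstar[OF G]])
  qed
qed (simp_all add: pmult_add_left act_palg_add)

lemma path_Abs:
  assumes "is_path k as"
  shows "psrc (Abs_path (k, as)) = k" "ptgt (Abs_path (k, as)) = path_end k as" "parrows (Abs_path (k, as)) = as"
  using assms by (simp_all add: psrc.rep_eq ptgt.rep_eq parrows.rep_eq Abs_path_inverse)

lemma act_ppath: "is_path k as \<Longrightarrow> act_palg (ppath k as) G = single (path_end k as) (path_op as (lookup G k))"
  by (simp add: ppath_def act_palg_single act_path_def path_Abs)

lemma act_pE: "act_palg (pE k) G = single k (lookup G k)"
  and act_pT: "1 \<le> i \<Longrightarrow> i < k \<Longrightarrow> act_palg (pT k i) G = single k (T_inv i (lookup G k))"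
  and act_pDp: "act_palg (pDp k) G = single (k + 1) (dplus_star k (lookup G k))"
  and act_pDm: "act_palg (pDm k) G = single k (dminus (k + 1) (lookup G (k + 1)))"
  by (simp_all add: act_ppath)

lemma act_pC:
  assumes "1 \<le> k" "G \<in> Vstar"
  shows "act_palg (pC k) G = single k (Cst k (lookup G k))"
proof -
  have k: "k - 1 + 1 = k" using assms(1) by simp
  show ?thesis
    by (simp only: act_palg_diff act_palg_mult[OF assms(2)] act_pDp act_pDm lookup_single_eq k
        Cst_def single_diff)
qed

text \<open>Each relation reduces to one already known for T_i, rewritten for the inverse; only the
  component of G at the starting vertex is involved.\<close>

lemma Aq_rel_act:
  assumes "Aq_rel (inverse qv) f g" "G \<in> Vstar"
  shows "act_palg f G = act_palg g G"
proof -
  note mult = act_palg_mult[OF assms(2)]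
  have m: "act_palg (a \<odot> b \<odot> c) G = act_palg a (act_palg b (act_palg c G))" for a b c
    by (simp add: pmult_assoc act_palg_mult act_palg_Vstar assms(2))
  have L: "lookup G k \<in> yp" for k by (rule Vstar_lookup_yp[OF assms(2)])
  have P: "lookup G k \<in> PV {1..k}" for k by (rule Vstar_lookup[OF assms(2)])
  note simps = mult act_palg_diff act_palg_add act_palg_pscale act_pE lookup_single_eq vscale_single
  show ?thesis
    using assms(1)
  proof cases
    case (quadratic i k)
    let ?x = "lookup G k"
    have "T_inv i (T_inv i ?x + kconst (inverse qv) * ?x) = T_inv i ?x + kconst (inverse qv) * ?x"
      by (simp add: T_inv_add T_inv_kconst T_inv_yp L T_inv_quadratic kconst_diff left_diff_distrib)
    then show ?thesis
      unfolding quadratic(1,2) simps act_pT[OF quadratic(3,4)] lookup_add act_palg_0 by simp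
  next
    case (braid i k)
    then have i: "1 \<le> i" "i < k" "1 \<le> i + 1" "i + 1 < k" by simp_all
    show ?thesis
      unfolding braid(1,2) m act_pT[OF i(1,2)] act_pT[OF i(3,4)] lookup_single_eq
      by (simp only: T_inv_braid[OF L])
  next
    case (commute i k j)
    show ?thesis
      unfolding commute(1,2) mult act_pT[OF commute(3,4)] act_pT[OF commute(5,6)] lookup_single_eq
      by (simp only: T_inv_commute[OF L commute(7)])
  next
    case (T_dm i k)
    then have i: "i < k" "i < k - 1" "k - 1 + 1 = k" "i + 1 < k" by simp_all
    show ?thesis
      unfolding T_dm(1,2) mult act_pT[OF T_dm(3) i(1)] act_pT[OF T_dm(3) i(2)] act_pDm lookup_single_eq i(3)
      by (simp only: dminus_T_inv[OF L i(4)])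
  next
    case (dp_T i k)
    then have i: "1 \<le> i + 1" "i + 1 < k + 1" by simp_all
    show ?thesis
      unfolding dp_T(1,2) mult act_pT[OF dp_T(3,4)] act_pT[OF i] act_pDp lookup_single_eq
      by (simp only: dplus_star_T_inv[OF P dp_T(3,4)])
  next
    case (T_dp_dp k)
    have k: "(1::nat) \<le> 1" "1 < k + 2" by simp_all
    have "T_inv 1 (dplus_star (k + 1) (dplus_star k (lookup G k))) = dplus_star (k + 1) (dplus_star k (lookup G k))"
      by (rule T_inv_eqI[OF _ T_op_dplus_star_twice[OF P]]) (intro is_hom_yp[OF is_hom_dplus_star] L)
    then show ?thesis
      unfolding T_dp_dp(1,2) m unfolding mult act_pT[OF k] act_pDp lookup_single_eq by simp
  next
    case (dm_dm_T k)
    then have k: "1 \<le> k - 1" "k - 1 < k" "k - 1 + 1 = k" "k - 2 + 1 = k - 1" by simp_all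
    have "dminus (k - 1) (dminus k (T_inv (k - 1) (lookup G k))) = dminus (k - 1) (dminus k (lookup G k))"
      using dminus_twice_T_op[OF T_inv_yp[OF L[of k]], of "k - 1" "k - 1"]
      by (simp only: k(3) T_op_T_inv(1)[OF L])
    then show ?thesis
      unfolding dm_dm_T(1,2) m unfolding mult act_pT[OF k(1,2)] act_pDm lookup_single_eq k(3,4) by simp
  next
    case (dm_C_T k)
    then have k: "1 \<le> k - 1" "k - 1 < k" "k - 1 + 1 = k" "1 \<le> k" by simp_all
    let ?x = "lookup G k"
    have T: "T_inv (k - 1) ?x \<in> PV {1..k}" using k by (intro T_inv_PV P) auto
    \<comment> \<open>The relation for T_{k-1} is evaluated at the inverse image of
      \<open>?x\<close>; this moves T_{k-1} to the other side and turns q into its inverse.\<close>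
    have "qk * dminus k (Cst k (T_inv (k - 1) ?x)) = Cst (k - 1) (dminus k ?x)"
      using dminus_Cst_T_op[OF dm_C_T(3) T] by (simp only: T_op_T_inv(1)[OF L])
    then have "dminus k (Cst k (T_inv (k - 1) ?x)) = kconst (inverse qv) * Cst (k - 1) (dminus k ?x)"
      by (metis (no_types, lifting) kconst_inverse qv_nonzero mult.assoc mult.commute mult_1)
    moreover note C = act_pC[OF k(4) Vstar_single[OF T]]
      act_pC[OF k(1) Vstar_single[OF dminus_V[OF k(4) P]]]
    ultimately show ?thesis
      unfolding dm_C_T(1,2) act_palg_pscale m
      unfolding mult act_pT[OF k(1,2)] act_pDm lookup_single_eq k(3) C vscale_single by simp
  next
    case (T_C_dp k)
    have k: "(1::nat) \<le> 1" "1 < k + 1" "1 \<le> k + 1" using T_C_dp(3) by simp_all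
    let ?x = "lookup G k"
    have y: "dplus_star k (Cst k ?x) \<in> yp"
      by (intro is_hom_yp[OF is_hom_dplus_star] PV_yp[OF Cst_PV[OF T_C_dp(3) P]])
    have z: "Cst (k + 1) (dplus_star k ?x) \<in> yp"
      by (rule PV_yp[OF Cst_PV[OF k(3) dplus_star_PV[OF P]]])
    \<comment> \<open>Here T_1 stands leftmost, so the relation is inverted after dividing by
      q.\<close>
    have "T_op 1 (kconst (inverse qv) * dplus_star k (Cst k ?x)) =
        kconst (inverse qv) * (qk * Cst (k + 1) (dplus_star k ?x))"
      by (simp only: T_op_kconst[OF y] T_op_Cst_dplus_star[OF T_C_dp(3) P])
    also have "\<dots> = Cst (k + 1) (dplus_star k ?x)"
      by (simp flip: kconst_mult mult.assoc)
    finally have "T_inv 1 (Cst (k + 1) (dplus_star k ?x)) = kconst (inverse qv) * dplus_star k (Cst k ?x)"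
      by (intro T_inv_eqI) (use y in simp_all)
    moreover note C = act_pC[OF T_C_dp(3) assms(2)] act_pC[OF k(3) Vstar_single[OF dplus_star_PV[OF P]]]
    ultimately show ?thesis
      unfolding T_C_dp(1,2) act_palg_pscale m
      unfolding mult act_pT[OF k(1,2)] act_pDp lookup_single_eq C vscale_single by simp
  qed
qed

lemma Aq_ideal_act:
  assumes "f \<in> Aq_ideal (inverse qv)" "G \<in> Vstar"
  shows "act_palg f G = 0"
  using assms
proof (induction f arbitrary: G)
  case (rel f g)
  then show ?case by (simp add: act_palg_diff Aq_rel_act)
next
  case (left f g)
  have "act_palg g 0 = 0" by (simp add: act_palg_def act_path_def path_op_0)
  with left show ?case by (simp add: act_palg_mult)
qed (simp_all add: act_palg_add act_palg_pscale act_palg_mult act_palg_Vstar)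

definition act_Astar :: "Astar \<Rightarrow> (nat \<Rightarrow>\<^sub>0 yring) \<Rightarrow> (nat \<Rightarrow>\<^sub>0 yring)" where
  "act_Astar a = act_palg (rep_Astar a)"

text \<open>The chosen representative differs from f by an element of the ideal, which acts by zero
  on \<open>Vstar\<close>.\<close>

lemma act_abs_Astar:
  assumes "G \<in> Vstar"
  shows "act_Astar (abs_Astar f) G = act_palg f G"
proof -
  have "Aq_cong (inverse qv) (rep_Astar (abs_Astar f)) f"
    by (rule Quotient3_rep_abs[OF Quotient3_Astar]) (rule equivp_reflp[OF equivp_Aq_cong])
  then have "act_palg (rep_Astar (abs_Astar f) - f) G = 0"
    unfolding Aq_cong_def by (rule Aq_ideal_act[OF _ assms])
  then show ?thesis by (simp add: act_Astar_def act_palg_diff)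
qed

lemma Astar_cases: obtains f where "a = abs_Astar f"
  by (metis Quotient3_abs_rep[OF Quotient3_Astar])

lemma act_Astar_add: "G \<in> Vstar \<Longrightarrow> act_Astar (a + b) G = act_Astar a G + act_Astar b G"
  by (rule Astar_cases[of a], rule Astar_cases[of b])
     (simp add: plus_Astar.abs_eq act_abs_Astar act_palg_add)

lemma act_Astar_diff: "G \<in> Vstar \<Longrightarrow> act_Astar (a - b) G = act_Astar a G - act_Astar b G"
  using act_Astar_add[of G "a - b" b] by simp

lemma act_Astar_ascale: "G \<in> Vstar \<Longrightarrow> act_Astar (ascale c a) G = vscale c (act_Astar a G)"
  by (rule Astar_cases[of a]) (simp add: ascale.abs_eq act_abs_Astar act_palg_pscale)

lemma act_Astar_mult: "G \<in> Vstar \<Longrightarrow> act_Astar (a * b) G = act_Astar a (act_Astar b G)"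
  by (rule Astar_cases[of a], rule Astar_cases[of b])
     (simp add: times_Astar.abs_eq act_abs_Astar act_palg_mult act_palg_Vstar)

lemma act_Astar_Vstar: "G \<in> Vstar \<Longrightarrow> act_Astar a G \<in> Vstar"
  by (simp add: act_Astar_def act_palg_Vstar)

lemma is_Astar_action_act_Astar: "is_Astar_action act_Astar"
  unfolding is_Astar_action_def
  by (intro conjI allI ballI act_Astar_Vstar act_Astar_add act_Astar_ascale act_Astar_mult)
     (simp_all add: act_Astar_def act_palg_add_right act_palg_vscale)

lemma act_aE: "G \<in> Vstar \<Longrightarrow> act_Astar (aE k) G = single k (lookup G k)"
  and act_aT: "G \<in> Vstar \<Longrightarrow> 1 \<le> i \<Longrightarrow> i < k \<Longrightarrow>
    act_Astar (aT k i) G = single k (T_inv i (lookup G k))"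
  and act_aDp: "G \<in> Vstar \<Longrightarrow> act_Astar (aDp k) G = single (k + 1) (dplus_star k (lookup G k))"
  and act_aDm: "G \<in> Vstar \<Longrightarrow> act_Astar (aDm k) G = single k (dminus (k + 1) (lookup G (k + 1)))"
  by (simp_all only: aE.abs_eq aT.abs_eq aDp.abs_eq aDm.abs_eq act_abs_Astar act_pE act_pT act_pDp act_pDm)

section \<open>Inverses of the loops, and the action of the elements z\<close>

lemma pscale_pmult_right: "f \<odot> pscale c g = pscale c (f \<odot> g)"
proof (induction f rule: palg_induct)
  case (2 p d)
  show ?case
    by (induction g rule: palg_induct)
       (auto simp: pmult_add_right pscale_add pmult_single pbasis_mult_def pscale_single pscale_0 ac_simps)
qed (auto simp: pmult_add_left pscale_add pscale_0)

lemma ppath_mult: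
  assumes "is_path k as" "is_path l bs" "k = path_end l bs"
  shows "ppath k as \<odot> ppath l bs = ppath l (as @ bs)"
proof -
  have "pcomp (Abs_path (k, as)) (Abs_path (l, bs)) = Abs_path (l, as @ bs)"
    by (rule Rep_path_inject[THEN iffD1]) (use assms in \<open>simp add: pcomp.rep_eq Abs_path_inverse is_path_append\<close>)
  then show ?thesis
    using assms by (simp add: ppath_def pmult_single pbasis_mult_def path_Abs is_path_append)
qed

lemma ascale_mult_left: "ascale c a * b = ascale c (a * b)"
  and ascale_mult_right: "a * ascale c b = ascale c (a * b)"
  and ascale_diff: "ascale c (a - b) = ascale c a - ascale c b"
  and ascale_ascale: "ascale c (ascale d a) = ascale (c * d) a"
  and ascale_add_left: "ascale (c + d) a = ascale c a + ascale d a"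
  and ascale_1: "ascale 1 a = a"
proof -
  note refl = equivp_reflp[OF equivp_Aq_cong]
  have "pscale c (pscale d f) = pscale (c * d) f" "pscale (c + d) f = pscale c f + pscale d f"
    "pscale 1 f = f" for f
    by (rule poly_mapping_eqI, simp add: lookup_add distrib_right mult.assoc)+
  then show "ascale c a * b = ascale c (a * b)" "a * ascale c b = ascale c (a * b)"
    "ascale c (a - b) = ascale c a - ascale c b" "ascale c (ascale d a) = ascale (c * d) a"
    "ascale (c + d) a = ascale c a + ascale d a" "ascale 1 a = a"
    by (transfer, simp add: pscale_pmult_left pscale_pmult_right pscale_add pscale_diff refl)+
qed

lemma aE_aT: "1 \<le> i \<Longrightarrow> i < k \<Longrightarrow> aE k * aT k i = aT k i"
  and aT_aE: "1 \<le> i \<Longrightarrow> i < k \<Longrightarrow> aT k i * aE k = aT k i"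
  and aE_aE: "aE k * aE k = aE k"
  by (simp_all only: aE.abs_eq aT.abs_eq times_Astar.abs_eq) (simp_all add: ppath_mult)

lemma aT_quadratic:
  assumes "1 \<le> i" "i < k"
  shows "(aT k i - aE k) * (aT k i + ascale (inverse qv) (aE k)) = 0"
proof -
  have "Aq_cong (inverse qv) ((pT k i - pE k) \<odot> (pT k i + pscale (inverse qv) (pE k))) 0"
    unfolding Aq_cong_def using Aq_ideal.rel[OF Aq_rel.quadratic[OF assms]] by simp
  then show ?thesis by transfer
qed

text \<open>The quadratic relation exhibits an inverse in the unital algebra at the vertex k.
  Inverses there are unique, which resolves the definite description in
  \<open>aT_inv\<close>.\<close>

lemma aT_inv_eq:
  assumes i: "1 \<le> i" "i < k"
  shows "aT_inv k i = ascale qv (aT k i + ascale (inverse qv - 1) (aE k))"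
proof -
  let ?T = "aT k i" and ?E = "aE k"
  let ?u = "ascale qv (?T + ascale (inverse qv - 1) ?E)"
  note E = aE_aT[OF i] aT_aE[OF i] aE_aE
  have "?T * ?T + ascale (inverse qv) ?T - ?T - ascale (inverse qv) ?E = 0"
    using aT_quadratic[OF i] by (simp add: left_diff_distrib distrib_left ascale_mult_right ascale_diff E algebra_simps)
  then have "?T * ?T + (ascale (inverse qv) ?T - ?T) = ascale (inverse qv) ?E"
    by (simp add: algebra_simps)
  moreover have "ascale (inverse qv - 1) ?T = ascale (inverse qv) ?T - ?T"
    using ascale_add_left[of "inverse qv - 1" 1 ?T] by (simp add: ascale_1)
  ultimately have TT: "?T * ?T + ascale (inverse qv - 1) ?T = ascale (inverse qv) ?E" by simp
  have u: "?E * ?u * ?E = ?u" "?u * ?T = ?E" "?T * ?u = ?E"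
    by (simp_all add: ascale_mult_left ascale_mult_right distrib_left distrib_right E TT)
       (simp_all add: ascale_ascale ascale_1)
  show ?thesis
    unfolding aT_inv_def
  proof (rule the_equality)
    show "?E * ?u * ?E = ?u \<and> ?u * ?T = ?E \<and> ?T * ?u = ?E" using u by blast
    fix v assume v: "?E * v * ?E = v \<and> v * ?T = ?E \<and> ?T * v = ?E"
    have "v = v * ?E" using v by (metis mult.assoc aE_aE)
    also have "\<dots> = v * ?T * ?u" using u(3) by (simp add: mult.assoc)
    also have "\<dots> = ?E * ?u" using v by simp
    also have "\<dots> = ?u" using u(1) by (metis mult.assoc aE_aE)
    finally show "v = ?u" .
  qed
qed

lemma act_aT_inv:
  assumes "G \<in> Vstar" "1 \<le> i" "i < k"
  shows "act_Astar (aT_inv k i) G = single k (T_op i (lookup G k))"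
proof -
  let ?x = "lookup G k"
  have "qk * (T_inv i ?x + kconst (inverse qv - 1) * ?x) =
      kconst (qv * inverse qv) * (T_op i ?x + kconst (qv - 1) * ?x) + kconst (qv * (inverse qv - 1)) * ?x"
    by (simp only: T_inv_def kconst_mult distrib_left mult.assoc)
  also have "\<dots> = T_op i ?x"
    by (simp add: right_diff_distrib kconst_diff algebra_simps)
  finally show ?thesis
    using assms by (simp add: aT_inv_eq act_Astar_ascale act_Astar_add act_aT act_aE vscale_single
        flip: single_add)
qed

text \<open>Induction along the recursion of \<open>z_act\<close>, which parallels that of
  \<open>z_elem\<close>; each intermediate vector lies in \<open>Vstar\<close>, where the action is
  multiplicative.\<close>

lemma act_z_elem:
  assumes "1 \<le> i" "i \<le> k" "F \<in> PV {1..k}"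
  shows "act_Astar (z_elem k i) (single k F) = single k (z_act k i F)"
  using assms
proof (induction k i F rule: z_act.induct)
  case (1 k i F)
  have V: "single k F \<in> Vstar" using 1 by (intro Vstar_single)
  show ?case
  proof (cases "i < k")
    case True
    have T: "T_inv i F \<in> PV {1..k}" using 1 True by (intro T_inv_PV) auto
    have IH: "act_Astar (z_elem k (i + 1)) (single k (T_inv i F)) =
        single k (z_act k (i + 1) (T_inv i F))"
      using True T by (intro 1(1)) auto
    have Z: "z_act k (i + 1) (T_inv i F) \<in> PV {1..k}" using True T by (intro z_act_PV) auto
    show ?thesis
      using True
      by (subst z_elem.simps, subst z_act.simps)
         (simp only: if_True act_Astar_ascale[OF V] act_Astar_mult[OF V] act_aT[OF V 1(2) True]
           act_Astar_mult[OF Vstar_single[OF T]] act_aT[OF Vstar_single[OF Z] 1(2) True]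
           lookup_single_eq IH vscale_single)
  next
    case False
    have k: "1 \<le> k" "k - 1 + 1 = k" using 1 by simp_all
    let ?a = "aDp (k - 1) * aDm (k - 1) - aDm k * aDp k"
    have DV: "single (k - 1) (dminus k F) \<in> Vstar"
      and SV: "single (k + 1) (dplus_star k F) \<in> Vstar"
      using 1 k(1) by (auto intro!: Vstar_single dminus_V[simplified] dplus_star_PV[simplified])
    have C: "act_Astar ?a (single k F) = single k (Cst k F)"
      by (simp only: act_Astar_diff[OF V] act_Astar_mult[OF V] act_aDp[OF DV] act_aDm[OF SV]
          act_aDp[OF V] act_aDm[OF V] lookup_single_eq k(2) single_diff Cst_def)
    have "act_Astar (foldr (\<lambda>j a. aT_inv k j * a) js ?a) (single k F) =
        single k (foldr T_op js (Cst k F))" if "set js \<subseteq> {1..<k}" for js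
      using that
    proof (induction js)
      case (Cons j js)
      then have j: "1 \<le> j" "j < k" by auto
      have "single k (foldr T_op js (Cst k F)) \<in> Vstar"
        using Cons.prems 1(4) k(1) by (intro Vstar_single foldr_T_op_PV Cst_PV) auto
      from act_aT_inv[OF this j] show ?case
        using Cons by (simp add: act_Astar_mult[OF V])
    qed (simp only: foldr.simps id_apply C)
    from this[of "rev [1..<k]"] show ?thesis
      using False
      by (subst z_elem.simps, subst z_act.simps)
         (simp add: act_Astar_ascale[OF V] vscale_single z_const_def)
  qed
qed

lemma z_op_eq: "1 \<le> i \<Longrightarrow> i \<le> k \<Longrightarrow> F \<in> PV {1..k} \<Longrightarrow> z_op act_Astar k i F = z_act k i F"
  by (simp add: z_op_def act_z_elem[simplified])

lemma dplus_PV: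
  assumes "F \<in> PV {1..k}"
  shows "dplus k F \<in> PV {1..k + 1}"
  unfolding dplus_def
  by (intro foldr_T_op_PV taup_PV) (auto intro: PV_mono[OF assms])

theorem theorem6p1:
  shows "\<exists>act. is_Astar_action act \<and>
    (\<forall>k. \<forall>F\<in>Vstar. act (aE k) F = Poly_Mapping.single k (lookup F k)) \<and>
    (\<forall>k i. \<forall>F\<in>Vstar. 1 \<le> i \<and> i < k \<longrightarrow>
       act (aT k i) F = Poly_Mapping.single k (T_inv_op k i (lookup F k))) \<and>
    (\<forall>k. \<forall>F\<in>Vstar. act (aDm k) F = Poly_Mapping.single k (dminus (k + 1) (lookup F (k + 1)))) \<and>
    (\<forall>k. \<forall>F\<in>Vstar. act (aDp k) F = Poly_Mapping.single (k + 1) (dplus_star k (lookup F k))) \<and>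
    (\<forall>k i. \<forall>F\<in>V k. 1 \<le> i \<and> i \<le> k \<longrightarrow>
       z_op act (k + 1) (i + 1) (dplus k F) = dplus k (z_op act k i F)) \<and>
    (\<forall>k i. \<forall>F\<in>V k. 1 \<le> i \<and> i \<le> k \<longrightarrow>
       yv (i + 1) * dplus_star k F = dplus_star k (yv i * F)) \<and>
    (\<forall>k. \<forall>F\<in>V k.
       z_op act (k + 1) 1 (dplus k F) = - yv 1 * dplus_star k (kconst (tv * qv ^ (k + 1)) * F)) \<and>
    (\<forall>m. dplus_star m (dplus_pow m) = dplus_pow (Suc m))"
proof (intro exI[of _ act_Astar] conjI allI ballI impI; (elim conjE)?)
  show "is_Astar_action act_Astar" by (rule is_Astar_action_act_Astar)
next
  fix k :: nat and F assume "F \<in> Vstar"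
  then show "act_Astar (aE k) F = Poly_Mapping.single k (lookup F k)" by (rule act_aE)
next
  fix k i :: nat and F assume F: "F \<in> Vstar" and i: "1 \<le> i" "i < k"
  have "lookup F k \<in> V k" using F by (simp add: Vstar_def)
  then show "act_Astar (aT k i) F = Poly_Mapping.single k (T_inv_op k i (lookup F k))"
    by (simp only: T_inv_op_eq[OF i] act_aT[OF F i])
next
  fix k :: nat and F assume "F \<in> Vstar"
  then show "act_Astar (aDm k) F = Poly_Mapping.single k (dminus (k + 1) (lookup F (k + 1)))" by (rule act_aDm)
next
  fix k :: nat and F assume "F \<in> Vstar"
  then show "act_Astar (aDp k) F = Poly_Mapping.single (k + 1) (dplus_star k (lookup F k))" by (rule act_aDp)
next
  fix k i :: nat and F assume "F \<in> V k" and i: "1 \<le> i" "i \<le> k"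
  then have F: "F \<in> PV {1..k}" by (simp only: V_PV)
  have "1 \<le> i + 1" "i + 1 \<le> k + 1" using i by simp_all
  then show "z_op act_Astar (k + 1) (i + 1) (dplus k F) = dplus k (z_op act_Astar k i F)"
    by (simp only: z_op_eq[OF _ _ dplus_PV[OF F]] z_op_eq[OF i F] z_act_dplus[OF i F])
next
  fix k i :: nat and F assume "F \<in> V k" and i: "1 \<le> i" "i \<le> k"
  then have F: "F \<in> yp" by (auto simp: V_PV intro: PV_yp)
  show "yv (i + 1) * dplus_star k F = dplus_star k (yv i * F)"
    using i F by (simp add: is_hom_mult[OF is_hom_dplus_star] dplus_star_yv)
next
  fix k :: nat and F assume "F \<in> V k"
  then have F: "F \<in> PV {1..k}" by (simp only: V_PV)
  have "(1::nat) \<le> 1" "1 \<le> k + 1" by simp_all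
  then show "z_op act_Astar (k + 1) 1 (dplus k F) = - yv 1 * dplus_star k (kconst (tv * qv ^ (k + 1)) * F)"
    by (simp only: z_op_eq[OF _ _ dplus_PV[OF F]] z_act_first_dplus[OF F])
next
  fix m :: nat show "dplus_star m (dplus_pow m) = dplus_pow (Suc m)"
    by (simp only: dplus_pow_eq_1 is_hom_1[OF is_hom_dplus_star])
qed

end
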